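(* Let $1<p<\infty$, $a,b\in SO(\mathbb{R}_+)$ and $\alpha\in SOS(\mathbb{R}_+)$. The functional operator $aI-bW_\alpha$ is invertible on $L^p(\mathbb{R}_+)$ if and only if either \[ \text{(1)}\quad \inf_{t\in\mathbb{R}_+}|a(t)|>0\ \text{ and }\ \liminf_{t\to s}\Big(|a(t)|-|b(t)|(\alpha'(t))^{-1/p}\Big)>0\ \ (s\in\{0,\infty\}), \] or \[ \text{(2)}\quad \inf_{t\in\mathbb{R}_+}|b(t)|>0\ \text{ and }\ \limsup_{t\to s}\Big(|a(t)|-|b(t)|(\alpha'(t))^{-1/p}\Big)<0\ \ (s\in\{0,\infty\}). \] If (1) holds, then $(aI-bW_\alpha)^{-1}=\sum_{n=0}^\infty(a^{-1}bW_\alpha)^na^{-1}I$. If (2) holds, then $(aI-bW_\alpha)^{-1}=-W_\alpha^{-1}\sum_{n=0}^\infty(b^{-1}aW_\alpha^{-1})^nb^{-1}I$.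
   Context: $\mathbb{R}_+=(0,\infty)$. $C_b(\mathbb{R}_+)$: bounded continuous complex functions on $\mathbb{R}_+$. $\operatorname{osc}(f,[\lambda r,r]):=\sup\{|f(t)-f(\tau)|:t,\tau\in[\lambda r,r]\}$. $SO(\mathbb{R}_+)$ is the set of $f\in C_b(\mathbb{R}_+)$ with $\lim_{r\to s}\operatorname{osc}(f,[\lambda r,r])=0$ for $s\in\{0,\infty\}$ and each (equivalently, some) $\lambda\in(0,1)$. $SOS(\mathbb{R}_+)$ is the set of orientation-preserving diffeomorphisms $\alpha$ of $\mathbb{R}_+$ onto itself having no fixed points in $\mathbb{R}_+$ (only fixed points $0,\infty$) such that $\log\alpha'\in C_b(\mathbb{R}_+)$ and $\alpha'\in SO(\mathbb{R}_+)$. $W_\alpha f:=f\circ\alpha$, a bounded invertible operator on $L^p(\mathbb{R}_+)$. *)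

theory Defs
  imports "HOL-Analysis.Analysis"
begin

abbreviation Rplus :: "real set" where "Rplus \<equiv> {0<..}"

definition Cb :: "(real \<Rightarrow> 'a::real_normed_vector) set" where
  "Cb = {f. continuous_on Rplus f \<and> bounded (f ` Rplus)}"

definition osc :: "(real \<Rightarrow> 'a::real_normed_vector) \<Rightarrow> real set \<Rightarrow> real" where
  "osc f S = (SUP tt\<in>S \<times> S. norm (f (fst tt) - f (snd tt)))"

definition SO :: "(real \<Rightarrow> 'a::real_normed_vector) set" where
  "SO = {f. f \<in> Cb \<and>
     (\<forall>l\<in>{0<..<1}. ((\<lambda>r. osc f {l*r..r}) \<longlongrightarrow> 0) (at_right 0) \<and>
                   ((\<lambda>r. osc f {l*r..r}) \<longlongrightarrow> 0) at_top)}"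

definition SOS :: "(real \<Rightarrow> real) set" where
  "SOS = {\<alpha>. bij_betw \<alpha> Rplus Rplus \<and> strict_mono_on Rplus \<alpha>
      \<and> (\<forall>t\<in>Rplus. \<alpha> differentiable (at t)) \<and> continuous_on Rplus (deriv \<alpha>)
      \<and> (\<forall>t\<in>Rplus. inv_into Rplus \<alpha> differentiable (at t))
      \<and> continuous_on Rplus (deriv (inv_into Rplus \<alpha>))
      \<and> (\<forall>t\<in>Rplus. \<alpha> t \<noteq> t)
      \<and> (\<forall>t\<in>Rplus. deriv \<alpha> t > 0)
      \<and> (\<lambda>t. ln (deriv \<alpha> t)) \<in> Cb
      \<and> deriv \<alpha> \<in> SO}"

text \<open>L^p(R_+) (functions are considered on (0,inf) only, modulo a.e. equality).\<close>
definition Lp :: "real \<Rightarrow> (real \<Rightarrow> complex) set" where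
  "Lp p = {f. f \<in> borel_measurable (lebesgue_on Rplus)
              \<and> integrable (lebesgue_on Rplus) (\<lambda>t. norm (f t) powr p)}"

definition Lp_norm :: "real \<Rightarrow> (real \<Rightarrow> complex) \<Rightarrow> real" where
  "Lp_norm p f = (LINT t|lebesgue_on Rplus. norm (f t) powr p) powr (1/p)"

definition Lp_inverse ::
  "real \<Rightarrow> ((real \<Rightarrow> complex) \<Rightarrow> (real \<Rightarrow> complex)) \<Rightarrow> ((real \<Rightarrow> complex) \<Rightarrow> (real \<Rightarrow> complex)) \<Rightarrow> bool" where
  "Lp_inverse p A B \<longleftrightarrow>
     (\<forall>g\<in>Lp p. B g \<in> Lp p)
   \<and> (\<forall>g\<in>Lp p. \<forall>g'\<in>Lp p. (AE t in lebesgue_on Rplus. g t = g' t) \<longrightarrow>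
          (AE t in lebesgue_on Rplus. B g t = B g' t))
   \<and> (\<forall>g\<in>Lp p. \<forall>g'\<in>Lp p. \<forall>c::complex.
          AE t in lebesgue_on Rplus. B (\<lambda>s. c * g s + g' s) t = c * B g t + B g' t)
   \<and> (\<exists>C. \<forall>g\<in>Lp p. Lp_norm p (B g) \<le> C * Lp_norm p g)
   \<and> (\<forall>g\<in>Lp p. AE t in lebesgue_on Rplus. A (B g) t = g t)
   \<and> (\<forall>f\<in>Lp p. AE t in lebesgue_on Rplus. B (A f) t = f t)"

definition Lp_invertible ::
  "real \<Rightarrow> ((real \<Rightarrow> complex) \<Rightarrow> (real \<Rightarrow> complex)) \<Rightarrow> bool" where
  "Lp_invertible p A \<longleftrightarrow> (\<exists>B. Lp_inverse p A B)"

definition Wop :: "(real \<Rightarrow> real) \<Rightarrow> (real \<Rightarrow> complex) \<Rightarrow> (real \<Rightarrow> complex)" where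
  "Wop \<alpha> f = (\<lambda>t. f (\<alpha> t))"

definition funop :: "(real \<Rightarrow> complex) \<Rightarrow> (real \<Rightarrow> complex) \<Rightarrow> (real \<Rightarrow> real)
    \<Rightarrow> (real \<Rightarrow> complex) \<Rightarrow> (real \<Rightarrow> complex)" where
  "funop a b \<alpha> f = (\<lambda>t. a t * f t - b t * Wop \<alpha> f t)"

definition mulop :: "(real \<Rightarrow> complex) \<Rightarrow> (real \<Rightarrow> complex) \<Rightarrow> (real \<Rightarrow> complex)" where
  "mulop c f = (\<lambda>t. c t * f t)"

definition Lp_opnorm_conv ::
  "real \<Rightarrow> (nat \<Rightarrow> (real \<Rightarrow> complex) \<Rightarrow> (real \<Rightarrow> complex)) \<Rightarrow> ((real \<Rightarrow> complex) \<Rightarrow> (real \<Rightarrow> complex)) \<Rightarrow> bool" where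
  "Lp_opnorm_conv p S B \<longleftrightarrow>
     (\<forall>\<epsilon>>0. \<exists>N. \<forall>n\<ge>N. \<forall>g\<in>Lp p. Lp_norm p (\<lambda>t. B g t - S n g t) \<le> \<epsilon> * Lp_norm p g)"

definition series1 :: "(real \<Rightarrow> complex) \<Rightarrow> (real \<Rightarrow> complex) \<Rightarrow> (real \<Rightarrow> real)
    \<Rightarrow> nat \<Rightarrow> (real \<Rightarrow> complex) \<Rightarrow> (real \<Rightarrow> complex)" where
  "series1 a b \<alpha> N g = (\<lambda>t. \<Sum>n<N.
      ((mulop (\<lambda>s. b s / a s) \<circ> Wop \<alpha>) ^^ n) (mulop (\<lambda>s. inverse (a s)) g) t)"

definition series2 :: "(real \<Rightarrow> complex) \<Rightarrow> (real \<Rightarrow> complex) \<Rightarrow> (real \<Rightarrow> real)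
    \<Rightarrow> nat \<Rightarrow> (real \<Rightarrow> complex) \<Rightarrow> (real \<Rightarrow> complex)" where
  "series2 a b \<alpha> N g = (\<lambda>t. - Wop (inv_into Rplus \<alpha>) (\<lambda>u. \<Sum>n<N.
      ((mulop (\<lambda>s. a s / b s) \<circ> Wop (inv_into Rplus \<alpha>)) ^^ n)
         (mulop (\<lambda>s. inverse (b s)) g) u) t)"

end

theory Submission
  imports Defs
begin

text \<open>
  With \<open>T = (b/a) W\<^sub>\<alpha>\<close> one has \<open>aI - bW\<^sub>\<alpha> = a(I - T)\<close>, and \<open>\<parallel>T\<^sup>n\<parallel>\<^sup>p\<close> is controlled by the products of
  \<open>|b/a|\<^sup>p/\<alpha>'\<close> along orbits. Every orbit of \<open>\<alpha>\<close> spends a bounded number of steps in a compact part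
  of the half-line, so under (1) these products decay geometrically and the Neumann series converges.
  Under (2) one writes \<open>aI - bW\<^sub>\<alpha> = -b(I - T')W\<^sub>\<alpha>\<close> with \<open>T' = (a/b) W\<^sub>\<alpha>\<^sup>-\<^sup>1\<close>.

  Conversely, put \<open>U = |a|\<^sup>p\<close> and \<open>V = |b|\<^sup>p/\<alpha>'\<close>. Testing the bounded invertibility on functions
  supported on finitely many images of a short interval yields inequalities between products of
  \<open>U\<close> and \<open>V\<close> along finite orbit segments. Slow oscillation makes \<open>U\<close> and \<open>V\<close> almost constant along
  segments far out, whence \<open>U - V\<close> is bounded away from zero near both ends. If the signs at the two ends
  differ, one of the inequalities fails on long segments; if they agree, the dominating coefficient
  cannot vanish on any orbit.
\<close>

section \<open>Change of variables\<close>

text \<open>Since \<open>a\<close> and \<open>b\<close> may vanish, the converse cannot use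
  quotients along orbits: the test functions carry products of coefficients, and the inequalities
  obtained from them never divide by \<open>a\<close> or \<open>b\<close>. Two inequalities are
  needed because invertibility has two halves. If \<open>V\<close> dominates along forward orbits
  and \<open>U\<close> along backward ones, formal solutions of a f = b (f o \<alpha>) decay in both
  directions, so boundedness below must fail. In the opposite mixed pattern the same happens for the
  adjoint, so surjectivity must fail. Each half therefore excludes one pattern, and each is turned
  into an inequality valid for all segment lengths with a single constant; only growth in the length
  matters, and crude factors such as 2^p do no harm. A single orbit is a null set. Short intervals
  with disjoint images replace it, and continuity of the coefficients leads from integrals back to
  points. An inverse is determined only up to almost everywhere equality, so convergence of the
  series is shown for each inverse, by applying the remainder identity to its values.\<close>

abbreviation LR :: "real measure" where "LR \<equiv> lebesgue_on Rplus"

text \<open>The p-th power of the norm, kept in \<open>ennreal\<close>: estimates then require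
  measurability alone, and membership in \<open>Lp p\<close> becomes finiteness of a number.\<close>

definition Np :: "real \<Rightarrow> (real \<Rightarrow> complex) \<Rightarrow> ennreal" where
  "Np p f = (\<integral>\<^sup>+ t. ennreal (norm (f t) powr p) \<partial>LR)"

lemma space_LR [simp]: "space LR = Rplus"
  by simp

lemma sets_LR_iff: "A \<in> sets LR \<longleftrightarrow> A \<subseteq> Rplus \<and> A \<in> sets lebesgue"
  by (subst sets_restrict_space_iff) auto

lemma continuous_measurable_LR:
  fixes f :: "real \<Rightarrow> 'a::euclidean_space"
  shows "continuous_on Rplus f \<Longrightarrow> f \<in> borel_measurable LR"
  by (rule continuous_imp_measurable_on_sets_lebesgue) auto

lemma Lp_iff: "f \<in> Lp p \<longleftrightarrow> f \<in> borel_measurable LR \<and> Np p f < \<infinity>"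
  unfolding Lp_def Np_def by (auto simp: integrable_iff_bounded)

lemma Lp_norm_eq:
  assumes "f \<in> borel_measurable LR"
  shows "Lp_norm p f = enn2real (Np p f) powr (1/p)"
  unfolding Lp_norm_def Np_def using assms by (subst integral_eq_nn_integral) auto

lemma Np_cong_AE:
  assumes "AE t in LR. f t = g t"
  shows "Np p f = Np p g"
  unfolding Np_def by (rule nn_integral_cong_AE) (use assms in auto)

lemma Np_le_imp_Lp_norm_le:
  assumes "0 < p" "0 \<le> C" "f \<in> borel_measurable LR" "g \<in> Lp p" "Np p f \<le> ennreal C * Np p g"
  shows "Lp_norm p f \<le> C powr (1/p) * Lp_norm p g"
proof -
  have g: "g \<in> borel_measurable LR" "Np p g < \<infinity>"
    using assms(4) by (auto simp: Lp_iff)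
  have "enn2real (Np p f) \<le> enn2real (ennreal C * Np p g)"
    using assms(5) g(2) by (intro enn2real_mono) (auto simp: ennreal_mult_less_top)
  also have "\<dots> = C * enn2real (Np p g)"
    using assms(2) by (simp add: enn2real_mult)
  finally have "enn2real (Np p f) powr (1/p) \<le> (C * enn2real (Np p g)) powr (1/p)"
    using assms(1) by (intro powr_mono2) auto
  then show ?thesis
    using assms(2,3) g by (simp add: Lp_norm_eq powr_mult)
qed

lemma Lp_norm_le_imp_Np_le:
  assumes "0 < p" "0 \<le> C" "f \<in> Lp p" "g \<in> Lp p" "Lp_norm p f \<le> C * Lp_norm p g"
  shows "Np p f \<le> ennreal (C powr p) * Np p g"
proof -
  have m: "f \<in> borel_measurable LR" "g \<in> borel_measurable LR" and fin: "Np p f < \<infinity>" "Np p g < \<infinity>"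
    using assms by (auto simp: Lp_iff)
  have "(enn2real (Np p f) powr (1/p)) powr p \<le> (C * enn2real (Np p g) powr (1/p)) powr p"
    using assms m by (intro powr_mono2) (auto simp: Lp_norm_eq)
  then have "enn2real (Np p f) \<le> C powr p * enn2real (Np p g)"
    using assms by (simp add: powr_mult powr_powr)
  then have "ennreal (enn2real (Np p f)) \<le> ennreal (C powr p * enn2real (Np p g))"
    by (rule ennreal_leI)
  then show ?thesis
    using fin by (simp add: ennreal_mult less_top)
qed

text \<open>Bounding the sum by twice the larger norm gives this for every p > 0. The loss of 2^p
  does not depend on the length of the orbit segments to which it is applied.\<close>

lemma powr_norm_add_le:
  fixes x y :: "'a::real_normed_vector"
  assumes "0 < p"
  shows "norm (x + y) powr p \<le> 2 powr p * (norm x powr p + norm y powr p)"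
proof -
  have "norm (x + y) powr p \<le> (2 * max (norm x) (norm y)) powr p"
    using assms norm_triangle_ineq[of x y] by (intro powr_mono2) auto
  also have "\<dots> = 2 powr p * max (norm x) (norm y) powr p"
    by (simp add: powr_mult)
  also have "max (norm x) (norm y) powr p \<le> norm x powr p + norm y powr p"
    by (auto simp: max_def)
  finally show ?thesis by simp
qed

lemma Np_add_le:
  assumes "0 < p" "f \<in> borel_measurable LR" "g \<in> borel_measurable LR"
  shows "Np p (\<lambda>t. f t + g t) \<le> ennreal (2 powr p) * (Np p f + Np p g)"
proof -
  have "Np p (\<lambda>t. f t + g t) \<le>
      (\<integral>\<^sup>+ t. ennreal (2 powr p) * (ennreal (norm (f t) powr p) + ennreal (norm (g t) powr p)) \<partial>LR)"
    unfolding Np_def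
    by (intro nn_integral_mono)
      (auto simp: ennreal_mult' [symmetric] ennreal_plus [symmetric] simp del: ennreal_plus
        intro!: ennreal_leI powr_norm_add_le assms)
  also have "\<dots> = ennreal (2 powr p) * (Np p f + Np p g)"
    unfolding Np_def using assms by (subst nn_integral_cmult) (auto simp: nn_integral_add)
  finally show ?thesis .
qed

lemma Np_mult_le:
  assumes "0 < p" "0 \<le> K" "f \<in> borel_measurable LR" "\<And>t. 0 < t \<Longrightarrow> norm (c t) \<le> K"
  shows "Np p (\<lambda>t. c t * f t) \<le> ennreal (K powr p) * Np p f"
proof -
  have "Np p (\<lambda>t. c t * f t) \<le> (\<integral>\<^sup>+ t. ennreal (K powr p) * ennreal (norm (f t) powr p) \<partial>LR)"
    unfolding Np_def
  proof (intro nn_integral_mono)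
    fix t assume "t \<in> space LR"
    then have "norm (c t) \<le> K" using assms by auto
    then have "norm (c t) powr p * norm (f t) powr p \<le> K powr p * norm (f t) powr p"
      using assms by (intro mult_right_mono powr_mono2) auto
    then show "ennreal (norm (c t * f t) powr p) \<le> ennreal (K powr p) * ennreal (norm (f t) powr p)"
      by (simp add: norm_mult powr_mult ennreal_mult' [symmetric] ennreal_leI)
  qed
  also have "\<dots> = ennreal (K powr p) * Np p f"
    unfolding Np_def using assms by (subst nn_integral_cmult) auto
  finally show ?thesis .
qed

lemma Lp_add [intro]:
  assumes "0 < p" "f \<in> Lp p" "g \<in> Lp p"
  shows "(\<lambda>t. f t + g t) \<in> Lp p"
proof -
  have "Np p (\<lambda>t. f t + g t) \<le> ennreal (2 powr p) * (Np p f + Np p g)"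
    using assms by (intro Np_add_le) (auto simp: Lp_iff)
  also have "\<dots> < \<infinity>" using assms by (auto simp: Lp_iff ennreal_mult_less_top)
  finally show ?thesis using assms by (auto simp: Lp_iff)
qed

lemma Lp_mult:
  assumes "0 < p" "f \<in> Lp p" "c \<in> borel_measurable LR" "\<And>t. 0 < t \<Longrightarrow> norm (c t) \<le> K"
  shows "(\<lambda>t. c t * f t) \<in> Lp p"
proof -
  have "0 \<le> K" using assms(4)[of 1] norm_ge_zero[of "c 1"] by linarith
  then have "Np p (\<lambda>t. c t * f t) \<le> ennreal (K powr p) * Np p f"
    using assms by (intro Np_mult_le) (auto simp: Lp_iff)
  also have "\<dots> < \<infinity>" using assms by (auto simp: Lp_iff ennreal_mult_less_top)
  finally show ?thesis using assms by (auto simp: Lp_iff)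
qed

lemma Lp_cmult: "0 < p \<Longrightarrow> f \<in> Lp p \<Longrightarrow> (\<lambda>t. c * f t) \<in> Lp p"
  by (rule Lp_mult[where K = "norm c"]) auto

lemma Lp_diff:
  assumes "0 < p" "f \<in> Lp p" "g \<in> Lp p"
  shows "(\<lambda>t. f t - g t) \<in> Lp p"
  using Lp_add[OF assms(1,2) Lp_cmult[OF assms(1,3), of "-1"]] by simp

text \<open>The inverse \<open>h\<close> is a parameter and the derivative is pinched between
  positive constants so that the locale is closed under exchanging \<open>g\<close> and
  \<open>h\<close> (\<open>inverse_diffeo\<close>). Facts about forward orbits then transfer to
  backward orbits by interpretation.\<close>

locale Rplus_diffeo =
  fixes g h g' :: "real \<Rightarrow> real" and m M :: real
  assumes g_pos: "\<And>t. 0 < t \<Longrightarrow> 0 < g t" and h_pos: "\<And>t. 0 < t \<Longrightarrow> 0 < h t"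
    and hg: "\<And>t. 0 < t \<Longrightarrow> h (g t) = t" and gh: "\<And>t. 0 < t \<Longrightarrow> g (h t) = t"
    and g_deriv: "\<And>t. 0 < t \<Longrightarrow> (g has_real_derivative g' t) (at t)"
    and g'_cont: "continuous_on Rplus g'"
    and m_pos: "0 < m" and g'_ge: "\<And>t. 0 < t \<Longrightarrow> m \<le> g' t" and g'_le: "\<And>t. 0 < t \<Longrightarrow> g' t \<le> M"
    and g_ne: "\<And>t. 0 < t \<Longrightarrow> g t \<noteq> t"
begin

lemma M_pos: "0 < M"
  using g'_ge[of 1] g'_le[of 1] m_pos by linarith

lemma g'_pos: "0 < t \<Longrightarrow> 0 < g' t"
  using g'_ge[of t] m_pos by linarith

lemma isCont_g: "0 < t \<Longrightarrow> isCont g t"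
  using g_deriv DERIV_isCont by blast

lemma continuous_on_g: "continuous_on Rplus g"
  by (rule continuous_at_imp_continuous_on) (simp add: isCont_g)

lemma g_less:
  assumes "0 < s" "s < t"
  shows "g s < g t"
proof (rule DERIV_pos_imp_increasing[OF assms(2)])
  fix x assume "s \<le> x" "x \<le> t"
  with assms(1) have "0 < x" by simp
  then show "\<exists>y. (g has_real_derivative y) (at x) \<and> 0 < y"
    using g_deriv g'_pos by blast
qed

lemma g_le: "0 < s \<Longrightarrow> s \<le> t \<Longrightarrow> g s \<le> g t"
  using g_less[of s t] by (cases "s = t") auto

lemma isCont_h:
  assumes "0 < t"
  shows "isCont h t"
proof -
  have "isCont h (g (h t))"
    by (rule isCont_inverse_function[where d = "h t / 2"])
      (use h_pos[OF assms] in \<open>auto intro!: hg isCont_g simp: field_simps abs_if split: if_splits\<close>)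
  then show ?thesis using gh[OF assms] by simp
qed

lemma continuous_on_h: "continuous_on Rplus h"
  by (rule continuous_at_imp_continuous_on) (simp add: isCont_h)

lemma h_deriv:
  assumes "0 < t"
  shows "(h has_real_derivative inverse (g' (h t))) (at t)"
  by (rule DERIV_inverse_function[where a = 0 and b = "t + 1" and f = g])
    (use assms g_deriv[OF h_pos] g'_pos[OF h_pos[OF assms]] gh isCont_h in auto)

lemma inverse_diffeo: "Rplus_diffeo h g (\<lambda>t. inverse (g' (h t))) (inverse M) (inverse m)"
proof
  show "continuous_on Rplus (\<lambda>t. inverse (g' (h t)))"
  proof (intro continuous_on_inverse)
    show "continuous_on Rplus (\<lambda>t. g' (h t))"
      using continuous_on_compose2[OF g'_cont continuous_on_h] h_pos by auto
    show "\<forall>t\<in>Rplus. g' (h t) \<noteq> 0"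
      using g'_pos h_pos by fastforce
  qed
next
  fix t :: real assume t: "0 < t"
  show "inverse M \<le> inverse (g' (h t))" "inverse (g' (h t)) \<le> inverse m"
    using g'_le[OF h_pos[OF t]] g'_ge[OF h_pos[OF t]] g'_pos[OF h_pos[OF t]] m_pos
    by (auto intro!: le_imp_inverse_le)
  show "h t \<noteq> t"
    using g_ne[OF t] gh[OF t] by metis
qed (use g_pos h_pos hg gh h_deriv M_pos in auto)

lemma inj_on_g: "inj_on g Rplus"
  by (rule inj_on_inverseI[where g = h]) (simp add: hg)

lemma g_image: "g ` Rplus = Rplus"
proof
  show "Rplus \<subseteq> g ` Rplus"
    using h_pos gh by (force simp: image_iff)
qed (use g_pos in auto)

lemma measurable_g: "g \<in> measurable LR LR"
proof (rule measurableI)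
  show "g t \<in> space LR" if "t \<in> space LR" for t
    using that g_pos by auto
next
  fix A assume A: "A \<in> sets LR"
  then have sub: "A \<subseteq> Rplus" "A \<in> sets lebesgue" by (auto simp: sets_LR_iff)
  have "h ` A \<in> sets lebesgue"
  proof (rule differentiable_image_in_sets_lebesgue)
    show "h differentiable_on A"
      using h_deriv sub by (intro differentiable_at_imp_differentiable_on)
        (auto simp: real_differentiable_def)
  qed (use sub in auto)
  moreover have "h ` A = g -` A \<inter> Rplus"
  proof safe
    fix t assume "g t \<in> A" "0 < t"
    then show "t \<in> h ` A" using hg[of t] by (metis imageI)
  qed (use sub h_pos gh in force)+
  ultimately show "g -` A \<inter> space LR \<in> sets LR"
    by (auto simp: sets_LR_iff)
qed

text \<open>The transformation formula as an identity of measures, tested on sets. Change of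
  variables for absolutely integrable functions settles sets of finite measure. Otherwise neither
  integrand is integrable, and both integrals, being those of nonnegative functions, are
  infinite.\<close>

lemma distr_density_g: "distr (density LR (\<lambda>t. ennreal (g' t))) LR g = LR"
proof (rule measure_eqI)
  fix A assume "A \<in> sets (distr (density LR (\<lambda>t. ennreal (g' t))) LR g)"
  then have A: "A \<in> sets LR" by simp
  then have sub: "A \<subseteq> Rplus" "A \<in> sets lebesgue" by (auto simp: sets_LR_iff)
  have g'm [measurable]: "g' \<in> borel_measurable LR"
    using g'_cont by (rule continuous_measurable_LR)
  note measurable_g [measurable]
  define F where "F = (\<lambda>t. g' t * indicat_real A (g t))"
  have Fm [measurable]: "F \<in> borel_measurable LR"
    unfolding F_def using A by measurable
  have F0: "0 \<le> F t" if "0 < t" for t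
    using g'_pos[OF that] by (auto simp: F_def)
  have "emeasure (distr (density LR (\<lambda>t. ennreal (g' t))) LR g) A
      = (\<integral>\<^sup>+ t. ennreal (g' t) * indicator (g -` A \<inter> Rplus) t \<partial>LR)"
    using A by (subst emeasure_distr) (auto intro!: emeasure_density simp: measurable_sets_borel
        measurable_sets[OF measurable_g A, simplified] intro: measurable_g)
  also have "\<dots> = (\<integral>\<^sup>+ t. ennreal (F t) \<partial>LR)"
    by (intro nn_integral_cong) (auto simp: F_def indicator_def)
  finally have 1: "emeasure (distr (density LR (\<lambda>t. ennreal (g' t))) LR g) A = (\<integral>\<^sup>+ t. ennreal (F t) \<partial>LR)" .
  have 2: "emeasure LR A = (\<integral>\<^sup>+ t. ennreal (indicat_real A t) \<partial>LR)"
    using nn_integral_indicator[OF A] by (simp add: ennreal_indicator)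
  \<comment> \<open>Leaving the value \<open>b\<close> arbitrary makes the equivalence transfer
    integrability and the value of the integral at once.\<close>
  have cv: "integrable LR F \<and> integral\<^sup>L LR F = b \<longleftrightarrow>
      integrable LR (indicat_real A) \<and> integral\<^sup>L LR (indicat_real A) = b" for b
  proof -
    have *: "set_integrable lebesgue Rplus k \<longleftrightarrow> integrable LR k"
      "set_integrable lebesgue Rplus k \<Longrightarrow> integral Rplus k = integral\<^sup>L LR k" for k :: "real \<Rightarrow> real"
      using set_lebesgue_integral_eq_integral(2)[of Rplus k]
      by (auto simp: set_integrable_def integrable_restrict_space set_lebesgue_integral_def
          integral_restrict_space)
    have abs: "\<bar>g' x\<bar> = g' x" if "0 < x" for x
      using g'_pos[OF that] by simp
    have "(\<lambda>x. \<bar>g' x\<bar> * indicat_real A (g x)) absolutely_integrable_on Rplus \<and>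
           integral Rplus (\<lambda>x. \<bar>g' x\<bar> * indicat_real A (g x)) = b
     \<longleftrightarrow> indicat_real A absolutely_integrable_on (g ` Rplus) \<and> integral (g ` Rplus) (indicat_real A) = b"
      by (rule has_absolute_integral_change_of_variables_1')
        (auto intro: inj_on_g has_field_derivative_at_within g_deriv)
    moreover have "(\<lambda>x. \<bar>g' x\<bar> * indicat_real A (g x)) absolutely_integrable_on Rplus \<longleftrightarrow>
        F absolutely_integrable_on Rplus"
      by (intro set_integrable_cong) (auto simp: F_def abs)
    moreover have "integral Rplus (\<lambda>x. \<bar>g' x\<bar> * indicat_real A (g x)) = integral Rplus F"
      by (intro integral_cong) (auto simp: F_def abs)
    ultimately have "F absolutely_integrable_on Rplus \<and> integral Rplus F = b \<longleftrightarrow>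
        indicat_real A absolutely_integrable_on Rplus \<and> integral Rplus (indicat_real A) = b"
      unfolding g_image by simp
    then show ?thesis
      using *(1)[of F] *(2)[of F] *(1)[of "indicat_real A"] *(2)[of "indicat_real A"] by argo
  qed
  show "emeasure (distr (density LR (\<lambda>t. ennreal (g' t))) LR g) A = emeasure LR A"
  proof (cases "integrable LR F")
    case True
    then have "integrable LR (indicat_real A)" "integral\<^sup>L LR (indicat_real A) = integral\<^sup>L LR F"
      using cv[of "integral\<^sup>L LR F"] by auto
    then show ?thesis
      unfolding 1 2 using True F0 by (subst (1 2) nn_integral_eq_integral) auto
  next
    case False
    then have not_int: "\<not> integrable LR (indicat_real A)"
      using cv[of "integral\<^sup>L LR (indicat_real A)"] by auto
    have inf: "(\<integral>\<^sup>+ t. ennreal (k t) \<partial>LR) = \<infinity>"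
      if "k \<in> borel_measurable LR" "\<And>t. 0 < t \<Longrightarrow> 0 \<le> k t" "\<not> integrable LR k" for k :: "real \<Rightarrow> real"
    proof (rule ccontr)
      assume "(\<integral>\<^sup>+ t. ennreal (k t) \<partial>LR) \<noteq> \<infinity>"
      then have "(\<integral>\<^sup>+ t. ennreal (k t) \<partial>LR) < \<infinity>" by (simp add: less_top)
      moreover have "AE t in LR. 0 \<le> k t" using that(2) by (intro AE_I2) simp
      ultimately show False using integrableI_nonneg[OF that(1)] that(3) by blast
    qed
    have "(\<integral>\<^sup>+ t. ennreal (indicat_real A t) \<partial>LR) = \<infinity>"
      using not_int A by (intro inf) auto
    moreover have "(\<integral>\<^sup>+ t. ennreal (F t) \<partial>LR) = \<infinity>"
      using False Fm F0 by (intro inf) auto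
    ultimately show ?thesis unfolding 1 2 by simp
  qed
qed simp

lemma nn_integral_change:
  assumes [measurable]: "F \<in> borel_measurable LR"
  shows "(\<integral>\<^sup>+ t. F (g t) * ennreal (g' t) \<partial>LR) = (\<integral>\<^sup>+ t. F t \<partial>LR)"
proof -
  have g'm [measurable]: "g' \<in> borel_measurable LR"
    using g'_cont by (rule continuous_measurable_LR)
  note measurable_g [measurable]
  have "(\<integral>\<^sup>+ t. F t \<partial>LR) = (\<integral>\<^sup>+ t. F t \<partial>distr (density LR (\<lambda>t. ennreal (g' t))) LR g)"
    by (simp add: distr_density_g)
  also have "\<dots> = (\<integral>\<^sup>+ t. F (g t) \<partial>density LR (\<lambda>t. ennreal (g' t)))"
    by (rule nn_integral_distr) auto
  also have "\<dots> = (\<integral>\<^sup>+ t. ennreal (g' t) * F (g t) \<partial>LR)"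
    by (rule nn_integral_density) auto
  finally show ?thesis by (simp add: mult.commute)
qed

end

section \<open>Iterates and operators on Lp\<close>

context Rplus_diffeo
begin

lemma g_iter_pos: "0 < t \<Longrightarrow> 0 < (g ^^ k) t"
  by (induction k) (auto intro: g_pos)

lemma measurable_g_iter: "g ^^ k \<in> measurable LR LR"
proof (induction k)
  case (Suc k)
  then show ?case using measurable_comp[OF Suc measurable_g] by (simp add: comp_def)
qed (simp add: id_def)

lemma h_iter_g_iter: "0 < t \<Longrightarrow> (h ^^ k) ((g ^^ k) t) = t"
proof (induction k)
  case (Suc k)
  have "(h ^^ Suc k) ((g ^^ Suc k) t) = (h ^^ k) (h (g ((g ^^ k) t)))"
    by (simp add: funpow_swap1)
  also have "\<dots> = t" using Suc g_iter_pos by (simp add: hg)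
  finally show ?case .
qed simp

lemma continuous_on_g_iter: "continuous_on Rplus (g ^^ k)"
proof (induction k)
  case (Suc k)
  have "continuous_on Rplus (\<lambda>t. g ((g ^^ k) t))"
    by (rule continuous_on_compose2[OF continuous_on_g Suc]) (auto intro: g_iter_pos)
  then show ?case by (simp add: comp_def)
qed (simp add: id_def)

text \<open>By the chain rule this is the derivative of \<open>g ^^ k\<close>, hence the Jacobian of
  the k-fold change of variables.\<close>

definition w :: "nat \<Rightarrow> real \<Rightarrow> real" where
  "w k t = (\<Prod>i<k. g' ((g ^^ i) t))"

lemma w_Suc_shift: "w (Suc k) t = g' t * w k (g t)"
  unfolding w_def by (simp add: prod.lessThan_Suc_shift funpow_swap1 del: prod.lessThan_Suc)

lemma w_pos: "0 < t \<Longrightarrow> 0 < w k t"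
  unfolding w_def by (intro prod_pos) (auto intro: g'_pos g_iter_pos)

lemma continuous_on_w: "continuous_on Rplus (w k)"
  unfolding w_def
  by (intro continuous_on_prod continuous_on_compose2[OF g'_cont continuous_on_g_iter])
    (auto intro: g_iter_pos)

lemma measurable_w: "w k \<in> borel_measurable LR"
  using continuous_on_w by (rule continuous_measurable_LR)

lemma nn_integral_change_iter:
  assumes [measurable]: "F \<in> borel_measurable LR"
  shows "(\<integral>\<^sup>+ t. F ((g ^^ k) t) * ennreal (w k t) \<partial>LR) = (\<integral>\<^sup>+ t. F t \<partial>LR)"
proof (induction k)
  case 0
  then show ?case by (simp add: w_def)
next
  case (Suc k)
  note [measurable] = measurable_g_iter measurable_w
  have "(\<integral>\<^sup>+ t. F ((g ^^ Suc k) t) * ennreal (w (Suc k) t) \<partial>LR)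
      = (\<integral>\<^sup>+ t. (F ((g ^^ k) (g t)) * ennreal (w k (g t))) * ennreal (g' t) \<partial>LR)"
  proof (rule nn_integral_cong)
    fix t assume "t \<in> space LR"
    then have "0 < t" by simp
    then show "F ((g ^^ Suc k) t) * ennreal (w (Suc k) t)
        = F ((g ^^ k) (g t)) * ennreal (w k (g t)) * ennreal (g' t)"
      unfolding w_Suc_shift using w_pos[OF g_pos, of t k] g'_pos[of t]
      by (simp add: ennreal_mult funpow_swap1 mult_ac)
  qed
  also have "\<dots> = (\<integral>\<^sup>+ t. F ((g ^^ k) t) * ennreal (w k t) \<partial>LR)"
    by (rule nn_integral_change) measurable
  finally show ?case using Suc by simp
qed

text \<open>Null sets have null preimages: the pulled-back indicator times \<open>g'\<close> has
  integral 0 by the change of variables, and \<open>g'\<close> is positive.\<close>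

lemma AE_g:
  assumes "AE t in LR. P t"
  shows "AE t in LR. P (g t)"
proof -
  obtain N where N: "{t\<in>space LR. \<not> P t} \<subseteq> N" "emeasure LR N = 0" "N \<in> sets LR"
    using assms by (rule AE_E)
  note [measurable] = measurable_g
  have [measurable]: "g' \<in> borel_measurable LR"
    using g'_cont by (rule continuous_measurable_LR)
  have [measurable]: "(\<lambda>t. indicator N (g t) :: ennreal) \<in> borel_measurable LR"
    using measurable_compose[OF measurable_g borel_measurable_indicator[OF N(3)]] .
  have "(\<integral>\<^sup>+ t. indicator N (g t) * ennreal (g' t) \<partial>LR) = 0"
    using N by (subst nn_integral_change) auto
  then have "AE t in LR. indicator N (g t) * ennreal (g' t) = 0"
    by (subst (asm) nn_integral_0_iff_AE) simp_all
  then show ?thesis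
  proof (rule AE_mp, intro AE_I2 impI)
    fix t assume t: "t \<in> space LR" "indicator N (g t) * ennreal (g' t) = 0"
    then have "g t \<notin> N" using g'_pos[of t] by (auto simp: indicator_def split: if_splits)
    then show "P (g t)" using N(1) t g_pos[of t] by auto
  qed
qed

lemma AE_g_iter:
  assumes "AE t in LR. P t"
  shows "AE t in LR. P ((g ^^ k) t)"
proof (induction k)
  case (Suc k)
  then show ?case using AE_g[OF Suc] by (simp add: funpow_swap1)
qed (use assms in simp)

lemma Np_comp_le:
  assumes [measurable]: "f \<in> borel_measurable LR"
  shows "Np p (\<lambda>t. f (g t)) \<le> ennreal (1 / m) * Np p f"
proof -
  note [measurable] = measurable_g
  have [measurable]: "g' \<in> borel_measurable LR"
    using g'_cont by (rule continuous_measurable_LR)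
  have "Np p (\<lambda>t. f (g t)) \<le>
      (\<integral>\<^sup>+ t. ennreal (1 / m) * (ennreal (norm (f (g t)) powr p) * ennreal (g' t)) \<partial>LR)"
    unfolding Np_def
  proof (rule nn_integral_mono)
    fix t assume "t \<in> space LR"
    then have "1 \<le> 1 / m * g' t" using g'_ge[of t] m_pos by simp
    then have "norm (f (g t)) powr p * 1 \<le> norm (f (g t)) powr p * (1 / m * g' t)"
      by (intro mult_left_mono) auto
    then show "ennreal (norm (f (g t)) powr p) \<le>
        ennreal (1 / m) * (ennreal (norm (f (g t)) powr p) * ennreal (g' t))"
      using m_pos by (simp add: ennreal_mult' [symmetric] ennreal_mult'' [symmetric] mult_ac ennreal_leI)
  qed
  also have "\<dots> = ennreal (1 / m) * Np p f"
    unfolding Np_def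
    by (subst nn_integral_cmult, measurable) (subst nn_integral_change, measurable)
  finally show ?thesis .
qed

lemma Lp_comp:
  assumes "f \<in> Lp p"
  shows "(\<lambda>t. f (g t)) \<in> Lp p"
proof -
  have "Np p (\<lambda>t. f (g t)) \<le> ennreal (1 / m) * Np p f"
    using assms by (intro Np_comp_le) (auto simp: Lp_iff)
  also have "\<dots> < \<infinity>" using assms by (auto simp: Lp_iff ennreal_mult_less_top)
  finally show ?thesis
    using assms measurable_compose[OF measurable_g, of f] by (auto simp: Lp_iff)
qed

lemma weighted_shift_iter:
  "((mulop c \<circ> Wop g) ^^ n) f t = (\<Prod>i<n. c ((g ^^ i) t)) * f ((g ^^ n) t)"
proof (induction n arbitrary: t)
  case (Suc n)
  have "((mulop c \<circ> Wop g) ^^ Suc n) f t = c t * ((mulop c \<circ> Wop g) ^^ n) f (g t)"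
    by (simp add: mulop_def Wop_def)
  also have "\<dots> = (c t * (\<Prod>i<n. c ((g ^^ i) (g t)))) * f ((g ^^ n) (g t))"
    unfolding Suc by simp
  also have "c t * (\<Prod>i<n. c ((g ^^ i) (g t))) = (\<Prod>i<Suc n. c ((g ^^ i) t))"
    by (simp add: prod.lessThan_Suc_shift funpow_swap1 del: prod.lessThan_Suc)
  finally show ?case by (simp add: funpow_swap1)
qed simp

end

section \<open>Operators on representatives and composition of their inverses\<close>

definition Lp_op :: "real \<Rightarrow> ((real \<Rightarrow> complex) \<Rightarrow> (real \<Rightarrow> complex)) \<Rightarrow> bool" where
  "Lp_op p A \<longleftrightarrow> (\<forall>f\<in>Lp p. A f \<in> Lp p) \<and>
     (\<forall>f\<in>Lp p. \<forall>f'\<in>Lp p. (AE t in LR. f t = f' t) \<longrightarrow> (AE t in LR. A f t = A f' t))"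

lemma Lp_op_comp: "Lp_op p A \<Longrightarrow> Lp_op p A' \<Longrightarrow> Lp_op p (A \<circ> A')"
  unfolding Lp_op_def by simp

lemma Lp_inverseD:
  assumes "Lp_inverse p A B" "f \<in> Lp p"
  shows "B f \<in> Lp p" "AE t in LR. A (B f) t = f t" "AE t in LR. B (A f) t = f t"
    and "f' \<in> Lp p \<Longrightarrow> AE t in LR. f t = f' t \<Longrightarrow> AE t in LR. B f t = B f' t"
    and "f' \<in> Lp p \<Longrightarrow> AE t in LR. B (\<lambda>s. c * f s + f' s) t = c * B f t + B f' t"
  using assms by (simp_all add: Lp_inverse_def)

lemma Lp_inverse_bound:
  assumes "Lp_inverse p A B"
  obtains C where "0 \<le> C" "\<And>f. f \<in> Lp p \<Longrightarrow> Lp_norm p (B f) \<le> C * Lp_norm p f"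
proof -
  obtain C where C: "\<forall>f\<in>Lp p. Lp_norm p (B f) \<le> C * Lp_norm p f"
    using assms unfolding Lp_inverse_def by (elim conjE exE)
  have "Lp_norm p (B f) \<le> max C 0 * Lp_norm p f" if "f \<in> Lp p" for f
  proof -
    have "C * Lp_norm p f \<le> max C 0 * Lp_norm p f"
      by (intro mult_right_mono) (auto simp: Lp_norm_def)
    with C that show ?thesis by fastforce
  qed
  then show ?thesis using that[of "max C 0"] by simp
qed

text \<open>Operators act on representatives, so an identity such as \<open>A2 (B2 f) = f\<close>
  holds only almost everywhere and cannot simply be substituted under \<open>A1\<close>. The
  \<open>Lp_op\<close> hypotheses provide this compatibility and keep all arguments in
  \<open>Lp p\<close>.\<close>

lemma Lp_inverse_comp:
  assumes p: "0 < p" and A1: "Lp_inverse p A1 B1" and A2: "Lp_inverse p A2 B2" and op: "Lp_op p A1" "Lp_op p A2"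
  shows "Lp_inverse p (A1 \<circ> A2) (B2 \<circ> B1)"
proof -
  note B1 = Lp_inverseD[OF A1] and B2 = Lp_inverseD[OF A2]
  obtain C1 where C1: "0 \<le> C1" "\<And>f. f \<in> Lp p \<Longrightarrow> Lp_norm p (B1 f) \<le> C1 * Lp_norm p f"
    using Lp_inverse_bound[OF A1] by blast
  obtain C2 where C2: "0 \<le> C2" "\<And>f. f \<in> Lp p \<Longrightarrow> Lp_norm p (B2 f) \<le> C2 * Lp_norm p f"
    using Lp_inverse_bound[OF A2] by blast
  have Aop: "\<And>f. f \<in> Lp p \<Longrightarrow> A1 f \<in> Lp p" "\<And>f. f \<in> Lp p \<Longrightarrow> A2 f \<in> Lp p"
    "\<And>f f'. f \<in> Lp p \<Longrightarrow> f' \<in> Lp p \<Longrightarrow> AE t in LR. f t = f' t \<Longrightarrow> AE t in LR. A1 f t = A1 f' t"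
    using op by (simp_all add: Lp_op_def)
  show ?thesis
    unfolding Lp_inverse_def comp_def
  proof (intro conjI ballI allI impI)
    fix g g' :: "real \<Rightarrow> complex" and c :: complex
    assume g: "g \<in> Lp p" "g' \<in> Lp p"
    have lp: "(\<lambda>s. c * g s + g' s) \<in> Lp p" "(\<lambda>s. c * B1 g s + B1 g' s) \<in> Lp p"
      by (intro Lp_add Lp_cmult B1(1) p g)+
    have "AE t in LR. B2 (B1 (\<lambda>s. c * g s + g' s)) t = B2 (\<lambda>s. c * B1 g s + B1 g' s) t"
      by (intro B2(4) B1(1) B1(5) lp g)
    moreover have "AE t in LR. B2 (\<lambda>s. c * B1 g s + B1 g' s) t = c * B2 (B1 g) t + B2 (B1 g') t"
      by (intro B2(5) B1(1) g)
    ultimately show "AE t in LR. B2 (B1 (\<lambda>s. c * g s + g' s)) t = c * B2 (B1 g) t + B2 (B1 g') t"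
      by eventually_elim simp
  next
    have "Lp_norm p (B2 (B1 g)) \<le> (C2 * C1) * Lp_norm p g" if "g \<in> Lp p" for g
    proof -
      have "Lp_norm p (B2 (B1 g)) \<le> C2 * Lp_norm p (B1 g)"
        using C2(2) B1(1) that by blast
      also have "\<dots> \<le> C2 * (C1 * Lp_norm p g)"
        using C1(2)[OF that] C2(1) by (rule mult_left_mono)
      finally show ?thesis by simp
    qed
    then show "\<exists>C. \<forall>g\<in>Lp p. Lp_norm p (B2 (B1 g)) \<le> C * Lp_norm p g" by blast
  next
    fix g assume g: "g \<in> Lp p"
    have "AE t in LR. A1 (A2 (B2 (B1 g))) t = A1 (B1 g) t"
      by (intro Aop B2(1,2) B1(1) g)
    then show "AE t in LR. A1 (A2 (B2 (B1 g))) t = g t"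
      using B1(2)[OF g] by eventually_elim simp
  next
    fix f assume f: "f \<in> Lp p"
    have "AE t in LR. B2 (B1 (A1 (A2 f))) t = B2 (A2 f) t"
      by (intro Aop(1,2) B2(4) B1(1,3) f)
    then show "AE t in LR. B2 (B1 (A1 (A2 f))) t = f t"
      using B2(3)[OF f] by eventually_elim simp
  qed (blast intro: B1(1,4) B2(1,4))+
qed

text \<open>Meant for factorisations of \<open>funop\<close>: they agree with it only at positive
  arguments, where the coefficient to be divided by is known to be nonzero.\<close>

lemma Lp_inverse_cong:
  assumes inv: "Lp_inverse p A B" and op: "Lp_op p A"
    and eq: "\<And>f t. 0 < t \<Longrightarrow> A' f t = A f t"
  shows "Lp_inverse p A' B"
proof -
  note B = Lp_inverseD[OF inv]
  have AE: "AE t in LR. A' f t = A f t" for f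
    by (intro AE_I2) (simp add: eq)
  have Lp: "A f \<in> Lp p" "A' f \<in> Lp p" if "f \<in> Lp p" for f
  proof -
    show "A f \<in> Lp p" using that op by (simp add: Lp_op_def)
    moreover have "A' f \<in> borel_measurable LR \<longleftrightarrow> A f \<in> borel_measurable LR"
      by (intro measurable_cong) (simp add: eq)
    ultimately show "A' f \<in> Lp p"
      using Np_cong_AE[OF AE, of p f] by (simp add: Lp_iff)
  qed
  have 1: "AE t in LR. A' (B f) t = f t" if "f \<in> Lp p" for f
    using B(2)[OF that] AE[of "B f"] by eventually_elim simp
  have 2: "AE t in LR. B (A' f) t = f t" if "f \<in> Lp p" for f
    using B(4)[OF Lp(2)[OF that] Lp(1)[OF that] AE] B(3)[OF that] by eventually_elim simp
  show ?thesis
    using inv 1 2 unfolding Lp_inverse_def by simp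
qed

lemma Lp_inverseI:
  assumes p: "0 < p" and C: "0 \<le> C"
    and "\<And>f. f \<in> Lp p \<Longrightarrow> B f \<in> Lp p"
    and "\<And>f f'. f \<in> Lp p \<Longrightarrow> f' \<in> Lp p \<Longrightarrow> AE t in LR. f t = f' t \<Longrightarrow> AE t in LR. B f t = B f' t"
    and "\<And>f f' c. f \<in> Lp p \<Longrightarrow> f' \<in> Lp p \<Longrightarrow> AE t in LR. B (\<lambda>s. c * f s + f' s) t = c * B f t + B f' t"
    and bound: "\<And>f. f \<in> Lp p \<Longrightarrow> Np p (B f) \<le> ennreal C * Np p f"
    and "\<And>f. f \<in> Lp p \<Longrightarrow> AE t in LR. A (B f) t = f t"
    and "\<And>f. f \<in> Lp p \<Longrightarrow> AE t in LR. B (A f) t = f t"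
  shows "Lp_inverse p A B"
proof -
  have "Lp_norm p (B f) \<le> C powr (1/p) * Lp_norm p f" if "f \<in> Lp p" for f
    using assms(3)[OF that] bound[OF that] that p C by (intro Np_le_imp_Lp_norm_le) (auto simp: Lp_iff)
  then have "\<exists>C. \<forall>f\<in>Lp p. Lp_norm p (B f) \<le> C * Lp_norm p f" by blast
  then show ?thesis
    unfolding Lp_inverse_def using assms by simp
qed

lemma Lp_op_mulop:
  assumes "0 < p" "c \<in> borel_measurable LR" "\<And>t. 0 < t \<Longrightarrow> norm (c t) \<le> K"
  shows "Lp_op p (mulop c)"
  unfolding Lp_op_def mulop_def using Lp_mult[OF assms(1) _ assms(2,3)] by auto

lemma Lp_inverse_mulop:
  assumes p: "0 < p" and c: "c \<in> borel_measurable LR"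
    and K: "0 < K" "\<And>t. 0 < t \<Longrightarrow> K \<le> norm (c t)"
  shows "Lp_inverse p (mulop c) (mulop (\<lambda>t. inverse (c t)))"
proof -
  have nz: "c t \<noteq> 0" if "0 < t" for t using K(1) K(2)[OF that] by auto
  have bd: "norm (inverse (c t)) \<le> 1 / K" if "0 < t" for t
    using K(1) K(2)[OF that] unfolding norm_inverse by (simp add: inverse_eq_divide frac_le)
  show ?thesis
  proof (rule Lp_inverseI[OF p, of "(1 / K) powr p"])
    fix f assume f: "f \<in> Lp p"
    show "mulop (\<lambda>t. inverse (c t)) f \<in> Lp p"
      unfolding mulop_def by (rule Lp_mult[OF p f _ bd]) (use c in measurable)
    show "Np p (mulop (\<lambda>t. inverse (c t)) f) \<le> ennreal ((1 / K) powr p) * Np p f"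
      unfolding mulop_def using f K by (intro Np_mult_le[OF p _ _ bd]) (auto simp: Lp_iff)
    show "AE t in LR. mulop c (mulop (\<lambda>t. inverse (c t)) f) t = f t"
      "AE t in LR. mulop (\<lambda>t. inverse (c t)) (mulop c f) t = f t"
      by (intro AE_I2; simp add: mulop_def nz)+
  qed (auto simp: mulop_def algebra_simps)
qed

context Rplus_diffeo
begin

lemma Lp_op_Wop: "Lp_op p (Wop g)"
  unfolding Lp_op_def Wop_def using Lp_comp AE_g by blast

lemma Lp_inverse_Wop:
  assumes p: "0 < p"
  shows "Lp_inverse p (Wop g) (Wop h)"
proof -
  interpret inv: Rplus_diffeo h g "\<lambda>t. inverse (g' (h t))" "inverse M" "inverse m"
    by (rule inverse_diffeo)
  show ?thesis
  proof (rule Lp_inverseI[OF p, of M])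
    fix f assume f: "f \<in> Lp p"
    show "Np p (Wop h f) \<le> ennreal M * Np p f"
      using inv.Np_comp_le[of f p] f by (simp add: Wop_def Lp_iff divide_inverse)
    show "AE t in LR. Wop g (Wop h f) t = f t" "AE t in LR. Wop h (Wop g f) t = f t"
      by (intro AE_I2; simp add: Wop_def hg gh)+
  qed (use M_pos inv.Lp_op_Wop[of p] in \<open>auto simp: Lp_op_def Wop_def\<close>)
qed

end

section \<open>Neumann series of a weighted shift\<close>

text \<open>The quotient by \<open>g'\<close> is the Jacobian correction: after the change of
  variables the product bounds the p-th power of the norm of the n-th iterate of the weighted shift.
  The factor \<open>K\<close> leaves room for the shift itself to be expanding; only its powers must
  decay.\<close>

locale contractive_weighted_shift = Rplus_diffeo +
  fixes p :: real and c :: "real \<Rightarrow> complex" and K q :: real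
  assumes p_pos: "0 < p" and c_meas: "c \<in> borel_measurable LR" and K_nonneg: "0 \<le> K"
    and q: "0 < q" "q < 1"
    and orbit_prod: "\<And>n t. 0 < t \<Longrightarrow>
      (\<Prod>i<n. norm (c ((g ^^ i) t)) powr p / g' ((g ^^ i) t)) \<le> K * q ^ n"
begin

abbreviation T :: "(real \<Rightarrow> complex) \<Rightarrow> (real \<Rightarrow> complex)" where "T \<equiv> mulop c \<circ> Wop g"

lemma T_iter_Suc: "(T ^^ Suc n) f t = c t * (T ^^ n) f (g t)"
  by (simp add: mulop_def Wop_def)

lemma T_iter_linear: "(T ^^ n) (\<lambda>s. k * f s + f' s) t = k * (T ^^ n) f t + (T ^^ n) f' t"
  unfolding weighted_shift_iter by (simp add: algebra_simps)

lemma T_iter_diff: "(T ^^ n) (\<lambda>s. f s - T f s) t = (T ^^ n) f t - (T ^^ Suc n) f t"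
proof -
  have "(T ^^ Suc n) f = (T ^^ n) (T f)"
    unfolding funpow_Suc_right by (rule comp_apply)
  then show ?thesis using T_iter_linear[of n "-1" "T f" f t] by simp
qed

lemma T_iter_measurable [measurable]:
  assumes "f \<in> borel_measurable LR"
  shows "(T ^^ n) f \<in> borel_measurable LR"
proof -
  have "(\<lambda>t. (\<Prod>i<n. c ((g ^^ i) t)) * f ((g ^^ n) t)) \<in> borel_measurable LR"
    by (intro borel_measurable_times borel_measurable_prod
        measurable_compose[OF measurable_g_iter c_meas] measurable_compose[OF measurable_g_iter assms])
  moreover have "(T ^^ n) f = (\<lambda>t. (\<Prod>i<n. c ((g ^^ i) t)) * f ((g ^^ n) t))"
    by (rule ext) (rule weighted_shift_iter)
  ultimately show ?thesis by simp
qed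

lemma Np_T_iter_le:
  assumes f: "f \<in> borel_measurable LR"
  shows "Np p ((T ^^ n) f) \<le> ennreal (K * q ^ n) * Np p f"
proof -
  define F where "F = (\<lambda>t. ennreal (norm (f t) powr p))"
  have F: "F \<in> borel_measurable LR" unfolding F_def using f by measurable
  have "Np p ((T ^^ n) f) \<le> (\<integral>\<^sup>+ t. ennreal (K * q ^ n) * (F ((g ^^ n) t) * ennreal (w n t)) \<partial>LR)"
    unfolding Np_def
  proof (rule nn_integral_mono)
    fix t assume "t \<in> space LR"
    then have t: "0 < t" by simp
    have "norm (\<Prod>i<n. c ((g ^^ i) t)) powr p = (\<Prod>i<n. norm (c ((g ^^ i) t)) powr p)"
      unfolding prod_norm [symmetric] by (rule prod_powr_distrib)
    also have "\<dots> = (\<Prod>i<n. norm (c ((g ^^ i) t)) powr p / g' ((g ^^ i) t)) * w n t"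
      using w_pos[OF t, of n] by (simp add: prod_dividef flip: w_def)
    also have "\<dots> \<le> K * q ^ n * w n t"
      using orbit_prod[OF t] w_pos[OF t, of n] by (intro mult_right_mono) auto
    finally have "norm ((T ^^ n) f t) powr p \<le> (K * q ^ n * w n t) * norm (f ((g ^^ n) t)) powr p"
      unfolding weighted_shift_iter norm_mult by (simp add: powr_mult mult_right_mono)
    then show "ennreal (norm ((T ^^ n) f t) powr p) \<le> ennreal (K * q ^ n) * (F ((g ^^ n) t) * ennreal (w n t))"
      using w_pos[OF t, of n] K_nonneg q unfolding F_def
      by (simp add: ennreal_mult' [symmetric] ennreal_mult'' [symmetric] mult_ac ennreal_leI)
  qed
  also have "\<dots> = ennreal (K * q ^ n) * (\<integral>\<^sup>+ t. F ((g ^^ n) t) * ennreal (w n t) \<partial>LR)"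
    using measurable_compose[OF measurable_g_iter F] measurable_w
    by (intro nn_integral_cmult) simp
  also have "(\<integral>\<^sup>+ t. F ((g ^^ n) t) * ennreal (w n t) \<partial>LR) = Np p f"
    unfolding nn_integral_change_iter[OF F] by (simp add: F_def Np_def)
  finally show ?thesis .
qed

lemma T_iter_cong_AE:
  assumes "AE t in LR. f t = f' t"
  shows "AE t in LR. (T ^^ n) f t = (T ^^ n) f' t"
  using AE_g_iter[OF assms, of n] unfolding weighted_shift_iter by eventually_elim simp

definition R :: "(real \<Rightarrow> complex) \<Rightarrow> (real \<Rightarrow> complex)" where
  "R f t = (\<Sum>n. (T ^^ n) f t)"

text \<open>Weighting the \<open>n\<close>-th term by \<open>s\<close> to the power \<open>-n\<close> with \<open>q < s < 1\<close> leaves an integrable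
  function \<open>S\<close>, and \<open>S\<close> dominates the orbit sums pointwise; this replaces Minkowski's inequality.\<close>

lemma Neumann_series:
  obtains C where "0 \<le> C"
    and "\<And>f. f \<in> Lp p \<Longrightarrow> AE t in LR. summable (\<lambda>n. (T ^^ n) f t)"
    and "\<And>f. f \<in> Lp p \<Longrightarrow> Np p (R f) \<le> ennreal C * Np p f"
proof -
  define s where "s = (1 + q) / 2"
  have s: "q < s" "s < 1" "0 < s" using q by (auto simp: s_def)
  \<comment> \<open>A bound by a multiple of \<open>s ^ n\<close> for p-th powers becomes one by a
    multiple of \<open>r ^ n\<close> for the terms themselves, and the geometric series in
    \<open>r\<close> converges.\<close>
  define r where "r = s powr (1 / p)"
  have r: "0 < r" "r < 1"
    using s p_pos powr_less_mono2[of "1 / p" s 1] by (auto simp: r_def)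
  have r_powr: "(r ^ n) powr p = s ^ n" for n
    using s p_pos by (simp add: r_def powr_powr flip: powr_realpow powr_mult)
  \<comment> \<open>The first factor compares \<open>norm (R f t) powr p\<close> with
    \<open>S f t\<close>; the second bounds the integral of \<open>S f\<close>.\<close>
  define C where "C = (1 / (1 - r)) powr p * (K * (1 / (1 - q / s)))"
  define S where "S f t = (\<Sum>n. ennreal ((1 / s) ^ n) * ennreal (norm ((T ^^ n) f t) powr p))"
    for f :: "real \<Rightarrow> complex" and t
  have pt: "summable (\<lambda>n. (T ^^ n) f t) \<and>
      ennreal (norm (R f t) powr p) \<le> ennreal ((1 / (1 - r)) powr p) * S f t"
    if fin: "S f t < \<infinity>" for f t
  proof -
    define x where "x = enn2real (S f t)"
    have x: "S f t = ennreal x" "0 \<le> x" using fin by (auto simp: x_def less_top)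
    have le: "norm ((T ^^ n) f t) \<le> x powr (1 / p) * r ^ n" for n
    proof -
      have "ennreal ((1 / s) ^ n) * ennreal (norm ((T ^^ n) f t) powr p) \<le> S f t"
        unfolding S_def using sum_le_suminf[of "\<lambda>n. ennreal ((1 / s) ^ n) * ennreal (norm ((T ^^ n) f t) powr p)" "{n}"]
        by simp
      then have "(1 / s) ^ n * norm ((T ^^ n) f t) powr p \<le> x"
        using s x by (simp add: ennreal_mult' [symmetric] ennreal_mult'' [symmetric] ennreal_le_iff)
      then have "norm ((T ^^ n) f t) powr p \<le> x * s ^ n"
        using s by (simp add: field_simps power_one_over)
      also have "\<dots> = (x powr (1 / p) * r ^ n) powr p"
        using x p_pos r r_powr[of n] by (simp add: powr_mult powr_powr)
      finally have "\<not> x powr (1 / p) * r ^ n < norm ((T ^^ n) f t)"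
        using powr_less_mono2[OF p_pos, of "x powr (1 / p) * r ^ n"] r by force
      then show ?thesis by simp
    qed
    have sm: "summable (\<lambda>n. x powr (1 / p) * r ^ n)"
      using r by (intro summable_mult summable_geometric) auto
    have sum: "summable (\<lambda>n. norm ((T ^^ n) f t))"
      by (rule summable_comparison_test'[OF sm]) (use le in auto)
    have "norm (R f t) \<le> (\<Sum>n. norm ((T ^^ n) f t))"
      unfolding R_def by (rule summable_norm[OF sum])
    also have "\<dots> \<le> (\<Sum>n. x powr (1 / p) * r ^ n)"
      by (rule suminf_le[OF le sum sm])
    also have "\<dots> = x powr (1 / p) * (1 / (1 - r))"
      using r by (simp add: suminf_mult suminf_geometric summable_geometric)
    finally have "norm (R f t) powr p \<le> (x powr (1 / p) * (1 / (1 - r))) powr p"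
      using p_pos by (intro powr_mono2) auto
    also have "\<dots> = (1 / (1 - r)) powr p * x"
      using x p_pos r by (simp add: powr_mult powr_powr powr_divide)
    finally show ?thesis
      using sum x summable_norm_cancel[OF sum]
      by (simp add: ennreal_mult' [symmetric] ennreal_mult'' [symmetric] ennreal_leI)
  qed
  have int_S: "(\<integral>\<^sup>+ t. S f t \<partial>LR) \<le> ennreal (K * (1 / (1 - q / s))) * Np p f"
    if f: "f \<in> borel_measurable LR" for f
  proof -
    note T_iter_measurable[OF f, measurable]
    have "(\<integral>\<^sup>+ t. S f t \<partial>LR) = (\<Sum>n. \<integral>\<^sup>+ t. ennreal ((1 / s) ^ n) * ennreal (norm ((T ^^ n) f t) powr p) \<partial>LR)"
      unfolding S_def by (rule nn_integral_suminf) measurable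
    also have "\<dots> = (\<Sum>n. ennreal ((1 / s) ^ n) * Np p ((T ^^ n) f))"
      unfolding Np_def by (subst nn_integral_cmult) auto
    also have "\<dots> \<le> (\<Sum>n. ennreal (K * (q / s) ^ n) * Np p f)"
    proof (intro suminf_le)
      fix n
      have "ennreal ((1 / s) ^ n) * Np p ((T ^^ n) f) \<le> ennreal ((1 / s) ^ n) * (ennreal (K * q ^ n) * Np p f)"
        by (intro mult_left_mono Np_T_iter_le f) auto
      also have "\<dots> = ennreal ((1 / s) ^ n * (K * q ^ n)) * Np p f"
        using s K_nonneg q by (subst ennreal_mult) (auto simp: mult.assoc)
      also have "(1 / s) ^ n * (K * q ^ n) = K * (q / s) ^ n"
        by (simp add: power_divide)
      finally show "ennreal ((1 / s) ^ n) * Np p ((T ^^ n) f) \<le> ennreal (K * (q / s) ^ n) * Np p f" .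
    qed auto
    also have "\<dots> = (\<Sum>n. ennreal (K * (q / s) ^ n)) * Np p f"
      by (rule ennreal_suminf_multc)
    also have "(\<Sum>n. ennreal (K * (q / s) ^ n)) = ennreal (K * (1 / (1 - q / s)))"
    proof (rule suminf_ennreal_eq)
      show "(\<lambda>n. K * (q / s) ^ n) sums (K * (1 / (1 - q / s)))"
        using s q by (intro sums_mult geometric_sums) auto
    qed (use K_nonneg q s in auto)
    finally show ?thesis .
  qed
  show ?thesis
  proof (rule that)
    show "0 \<le> C" using K_nonneg r s q by (simp add: C_def)
    fix f assume f: "f \<in> Lp p"
    then have fm: "f \<in> borel_measurable LR" and fin: "Np p f < \<infinity>" by (auto simp: Lp_iff)
    note T_iter_measurable[OF fm, measurable]
    have Sm [measurable]: "S f \<in> borel_measurable LR"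
      unfolding S_def by measurable
    have "(\<integral>\<^sup>+ t. S f t \<partial>LR) \<noteq> \<infinity>"
      using int_S[OF fm] fin by (auto simp: less_top[symmetric] ennreal_mult_less_top top_unique ennreal_mult_eq_top_iff)
    then have "AE t in LR. S f t \<noteq> \<infinity>"
      by (intro nn_integral_noteq_infinite) auto
    then have AE_fin: "AE t in LR. S f t < \<infinity>"
      by eventually_elim (simp add: less_top)
    show "AE t in LR. summable (\<lambda>n. (T ^^ n) f t)"
      using AE_fin by eventually_elim (use pt in blast)
    have "Np p (R f) \<le> (\<integral>\<^sup>+ t. ennreal ((1 / (1 - r)) powr p) * S f t \<partial>LR)"
      unfolding Np_def by (intro nn_integral_mono_AE) (use AE_fin in eventually_elim, use pt in blast)
    also have "\<dots> = ennreal ((1 / (1 - r)) powr p) * (\<integral>\<^sup>+ t. S f t \<partial>LR)"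
      by (rule nn_integral_cmult) measurable
    also have "\<dots> \<le> ennreal ((1 / (1 - r)) powr p) * (ennreal (K * (1 / (1 - q / s))) * Np p f)"
      by (intro mult_left_mono int_S fm) auto
    also have "\<dots> = ennreal C * Np p f"
      unfolding C_def using K_nonneg s q by (subst ennreal_mult) (auto simp: mult.assoc)
    finally show "Np p (R f) \<le> ennreal C * Np p f" .
  qed
qed

lemma Lp_inverse_Neumann: "Lp_inverse p (\<lambda>f t. f t - T f t) R"
proof -
  obtain C where C: "0 \<le> C" and sm: "\<And>f. f \<in> Lp p \<Longrightarrow> AE t in LR. summable (\<lambda>n. (T ^^ n) f t)"
    and bd: "\<And>f. f \<in> Lp p \<Longrightarrow> Np p (R f) \<le> ennreal C * Np p f"
    using Neumann_series by blast
  show ?thesis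
  proof (rule Lp_inverseI[OF p_pos C])
    fix f assume f: "f \<in> Lp p"
    then have fm: "f \<in> borel_measurable LR" and fin: "Np p f < \<infinity>" by (auto simp: Lp_iff)
    note T_iter_measurable[OF fm, measurable]
    have "R f \<in> borel_measurable LR"
      unfolding R_def by measurable
    moreover have "Np p (R f) < \<infinity>"
      using le_less_trans[OF bd[OF f], of \<infinity>] fin by (auto simp: ennreal_mult_less_top)
    ultimately show "R f \<in> Lp p" by (simp add: Lp_iff)
    show "Np p (R f) \<le> ennreal C * Np p f" by (rule bd[OF f])
    show "AE t in LR. R f t - T (R f) t = f t"
      using sm[OF f]
    proof eventually_elim
      case (elim t)
      have split: "(\<Sum>n. (T ^^ n) f t) = (\<Sum>n. (T ^^ Suc n) f t) + f t"
        using suminf_split_head[OF elim] by simp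
      have "T (R f) t = (\<Sum>n. (T ^^ Suc n) f t)"
      \<comment> \<open>Summability at \<open>t\<close> passes to \<open>g t\<close> only after
        cancelling \<open>c t\<close>. If \<open>c t = 0\<close>, all terms beyond the zeroth vanish
        anyway.\<close>
      proof (cases "c t = 0")
        case True
        then show ?thesis unfolding T_iter_Suc by (simp add: mulop_def)
      next
        case False
        have "summable (\<lambda>n. c t * (T ^^ n) f (g t))"
          using elim summable_Suc_iff[of "\<lambda>n. (T ^^ n) f t"] unfolding T_iter_Suc by simp
        then have "summable (\<lambda>n. (T ^^ n) f (g t))" using False by (simp add: summable_cmult_iff)
        then show ?thesis unfolding T_iter_Suc by (simp add: mulop_def Wop_def R_def suminf_mult)
      qed
      then show ?case using split by (simp add: R_def)
    qed
    show "AE t in LR. R (\<lambda>s. f s - T f s) t = f t"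
      using sm[OF f]
    proof eventually_elim
      case (elim t)
      have "(\<lambda>n. (T ^^ n) f t - (T ^^ Suc n) f t) sums ((T ^^ 0) f t - 0)"
        by (rule telescope_sums'[OF summable_LIMSEQ_zero[OF elim]])
      then show ?case unfolding R_def T_iter_diff by (simp add: sums_iff)
    qed
  next
    fix f f' :: "real \<Rightarrow> complex" assume "AE t in LR. f t = f' t"
    then have "AE t in LR. \<forall>n. (T ^^ n) f t = (T ^^ n) f' t"
      by (intro AE_all_countable[THEN iffD2] allI T_iter_cong_AE)
    then show "AE t in LR. R f t = R f' t"
      by eventually_elim (simp add: R_def)
  next
    fix f f' :: "real \<Rightarrow> complex" and k assume f: "f \<in> Lp p" "f' \<in> Lp p"
    show "AE t in LR. R (\<lambda>s. k * f s + f' s) t = k * R f t + R f' t"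
      using sm[OF f(1)] sm[OF f(2)]
      by eventually_elim (simp add: R_def T_iter_linear suminf_add [symmetric] suminf_mult summable_mult)
  qed
qed

text \<open>Telescoping. Here \<open>f\<close> is any solution of f - T f = u, not necessarily the
  value of \<open>R\<close>, so that the remainder is available for whatever inverse of the operator
  is given.\<close>

lemma Neumann_remainder:
  assumes "AE t in LR. f t - T f t = u t"
  shows "AE t in LR. f t - (\<Sum>n<N. (T ^^ n) u t) = (T ^^ N) f t"
proof -
  have "AE t in LR. \<forall>n. (T ^^ n) (\<lambda>t. f t - T f t) t = (T ^^ n) u t"
    using assms by (intro AE_all_countable[THEN iffD2] allI T_iter_cong_AE)
  then show ?thesis
  proof eventually_elim
    case (elim t)
    have "(T ^^ n) u t = (T ^^ n) f t - (T ^^ Suc n) f t" for n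
      using elim T_iter_diff[of n f t] by simp
    then have "(\<Sum>n<N. (T ^^ n) u t) = (\<Sum>n<N. (T ^^ n) f t - (T ^^ Suc n) f t)" by simp
    also have "\<dots> = (T ^^ 0) f t - (T ^^ N) f t" by (rule sum_lessThan_telescope')
    finally show ?case by simp
  qed
qed

lemma Lp_op_Neumann:
  assumes "\<And>t. 0 < t \<Longrightarrow> norm (c t) \<le> k"
  shows "Lp_op p (\<lambda>f t. f t - T f t)"
proof -
  have "Lp_op p T"
    by (intro Lp_op_comp Lp_op_mulop[OF p_pos c_meas assms] Lp_op_Wop)
  then have T: "\<And>f. f \<in> Lp p \<Longrightarrow> T f \<in> Lp p"
    "\<And>f f'. f \<in> Lp p \<Longrightarrow> f' \<in> Lp p \<Longrightarrow> AE t in LR. f t = f' t \<Longrightarrow> AE t in LR. T f t = T f' t"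
    unfolding Lp_op_def by blast+
  show ?thesis
    unfolding Lp_op_def
  proof (intro conjI ballI impI)
    fix f f' assume f: "f \<in> Lp p" "f' \<in> Lp p" "AE t in LR. f t = f' t"
    show "AE t in LR. f t - T f t = f' t - T f' t"
      using f(3) T(2)[OF f] by eventually_elim simp
  qed (intro Lp_diff p_pos T)
qed

end

section \<open>Orbit dynamics\<close>

text \<open>The conditions at 0 and infinity give an additive gap, whereas products along orbits
  require a ratio. Below a bounded quantity the former implies the latter: x <= y - c <= (1 - c/Z) y
  as soon as y <= Z.\<close>

lemma powr_gap:
  fixes c p Y :: real
  assumes "0 < c" "0 < p"
  obtains q where "0 < q" "q < 1" "\<And>x y. 0 \<le> x \<Longrightarrow> x \<le> y - c \<Longrightarrow> y \<le> Y \<Longrightarrow> x powr p \<le> q * y powr p"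
proof -
  \<comment> \<open>The maximum with \<open>2 * c\<close> keeps \<open>1 - c / Z\<close>
    positive.\<close>
  define Z where "Z = max Y (2 * c)"
  have Z: "0 < Z" "Y \<le> Z" "c / Z < 1" "0 < c / Z" using assms by (auto simp: Z_def max_def)
  show ?thesis
  proof (rule that[of "(1 - c / Z) powr p"])
    show "0 < (1 - c / Z) powr p" using Z by simp
    show "(1 - c / Z) powr p < 1"
      using powr_less_mono2[OF assms(2), of "1 - c / Z" 1] Z by simp
    fix x y :: real assume xy: "0 \<le> x" "x \<le> y - c" "y \<le> Y"
    have "y / Z \<le> 1" using xy Z by simp
    then have "c * (y / Z) \<le> c * 1" using assms by (intro mult_left_mono) auto
    then have "x \<le> (1 - c / Z) * y" using xy by (simp add: algebra_simps)
    then have "x powr p \<le> ((1 - c / Z) * y) powr p"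
      using xy assms by (intro powr_mono2) auto
    also have "\<dots> = (1 - c / Z) powr p * y powr p"
      using xy Z assms by (simp add: powr_mult)
    finally show "x powr p \<le> (1 - c / Z) powr p * y powr p" .
  qed
qed

context Rplus_diffeo
begin

lemma up_or_down: "(\<forall>t>0. t < g t) \<or> (\<forall>t>0. g t < t)"
proof (rule ccontr)
  assume "\<not> ?thesis"
  then obtain s t where st: "0 < s" "g s \<le> s" "0 < t" "t \<le> g t" by (auto simp: not_less)
  have "connected ((\<lambda>t. g t - t) ` Rplus)"
    by (intro connected_continuous_image continuous_on_diff continuous_on_g continuous_on_id)
      (simp add: connected_Ioi)
  then have "0 \<in> (\<lambda>t. g t - t) ` Rplus"
    by (rule connectedD_interval[of _ "g s - s" "g t - t"]) (use st in auto)
  then show False using g_ne by auto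
qed

lemma g_iter_le: "0 < s \<Longrightarrow> s \<le> t \<Longrightarrow> (g ^^ k) s \<le> (g ^^ k) t"
  by (induction k) (auto intro: g_le g_iter_pos)

lemma no_orbit_limit:
  assumes "0 < t" "0 < l"
  shows "\<not> (\<lambda>k. (g ^^ k) t) \<longlonglongrightarrow> l"
proof
  assume lim: "(\<lambda>k. (g ^^ k) t) \<longlonglongrightarrow> l"
  then have "(\<lambda>k. g ((g ^^ k) t)) \<longlonglongrightarrow> g l"
    by (rule isCont_tendsto_compose[OF isCont_g[OF assms(2)]])
  moreover have "(\<lambda>k. (g ^^ Suc k) t) \<longlonglongrightarrow> l"
    using lim by (rule LIMSEQ_Suc)
  ultimately have "g l = l" using LIMSEQ_unique by simp
  then show False using g_ne assms by blast
qed

lemma orbit_at_top: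
  assumes up: "\<forall>t>0. t < g t" and t: "0 < t"
  shows "filterlim (\<lambda>k. (g ^^ k) t) at_top sequentially"
proof -
  have inc: "incseq (\<lambda>k. (g ^^ k) t)"
    using up g_iter_pos[OF t] by (intro incseq_SucI) (auto simp: less_imp_le)
  have "\<not> bdd_above (range (\<lambda>k. (g ^^ k) t))"
  proof
    assume "bdd_above (range (\<lambda>k. (g ^^ k) t))"
    then have "(\<lambda>k. (g ^^ k) t) \<longlonglongrightarrow> (SUP k. (g ^^ k) t)"
      by (rule LIMSEQ_incseq_SUP[OF _ inc])
    moreover have "t \<le> (SUP k. (g ^^ k) t)"
      using cSUP_upper[OF UNIV_I[of 0] \<open>bdd_above _\<close>] by simp
    ultimately show False using no_orbit_limit t by fastforce
  qed
  then have "\<exists>k. B < (g ^^ k) t" for B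
    unfolding bdd_above_def by (auto simp: not_le)
  then have "\<exists>k0. \<forall>k\<ge>k0. B \<le> (g ^^ k) t" for B
    using inc unfolding incseq_def by (meson less_imp_le order_trans)
  then show ?thesis
    unfolding filterlim_at_top eventually_sequentially by blast
qed

lemma orbit_at_0:
  assumes down: "\<forall>t>0. g t < t" and t: "0 < t"
  shows "filterlim (\<lambda>k. (g ^^ k) t) (at_right 0) sequentially"
proof -
  have dec: "decseq (\<lambda>k. (g ^^ k) t)"
    using down g_iter_pos[OF t] by (intro decseq_SucI) (auto simp: less_imp_le)
  have bdd: "bdd_below (range (\<lambda>k. (g ^^ k) t))"
    using g_iter_pos[OF t] by (intro bdd_belowI[of _ 0]) (auto simp: less_imp_le)
  have lim: "(\<lambda>k. (g ^^ k) t) \<longlonglongrightarrow> (INF k. (g ^^ k) t)"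
    by (rule LIMSEQ_decseq_INF[OF bdd dec])
  moreover have "0 \<le> (INF k. (g ^^ k) t)"
    using g_iter_pos[OF t] by (intro cINF_greatest) (auto simp: less_imp_le)
  ultimately have "(\<lambda>k. (g ^^ k) t) \<longlonglongrightarrow> 0"
    using no_orbit_limit[OF t, of "INF k. (g ^^ k) t"] by fastforce
  then show ?thesis
    using g_iter_pos[OF t] by (intro tendsto_imp_filterlim_at_right) auto
qed

text \<open>The number of steps is uniform because the iterates are increasing: if orbits move up,
  the whole interval stays ahead of the orbit of \<open>d\<close>; if they move down, it stays
  behind the orbit of \<open>e\<close>.\<close>

lemma orbit_leaves_compact:
  assumes d: "0 < d"
  obtains K where "\<And>t k. t \<in> {d..e} \<Longrightarrow> K \<le> k \<Longrightarrow> (g ^^ k) t \<notin> {d..e}"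
proof (cases "d \<le> e")
  case True
  show ?thesis using up_or_down
  proof
    assume up: "\<forall>t>0. t < g t"
    then have "eventually (\<lambda>k. e < (g ^^ k) d) sequentially"
      using orbit_at_top[OF up d] by (simp add: filterlim_at_top_dense)
    then obtain K where K: "\<And>k. K \<le> k \<Longrightarrow> e < (g ^^ k) d"
      by (auto simp: eventually_sequentially)
    show ?thesis
    proof (rule that[of K])
      fix t k assume "t \<in> {d..e}" "K \<le> k"
      then show "(g ^^ k) t \<notin> {d..e}"
        using K[of k] g_iter_le[OF d, of t k] by auto
    qed
  next
    assume down: "\<forall>t>0. g t < t"
    have e: "0 < e" using d True by simp
    have "eventually (\<lambda>k. (g ^^ k) e < d) sequentially"
      using orbit_at_0[OF down e] d unfolding filterlim_at by (blast dest: order_tendstoD(2))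
    then obtain K where K: "\<And>k. K \<le> k \<Longrightarrow> (g ^^ k) e < d"
      by (auto simp: eventually_sequentially)
    show ?thesis
    proof (rule that[of K])
      fix t k assume "t \<in> {d..e}" "K \<le> k"
      then show "(g ^^ k) t \<notin> {d..e}"
        using K[of k] g_iter_le[of t e k] d by auto
    qed
  qed
qed auto

text \<open>From \<open>k\<close> steps after the first visit to \<open>{d..e}\<close> on, the orbit
  avoids this interval. Hence all visits fall into a time window of length \<open>k\<close>,
  wherever the orbit starts, and all other steps contribute at most \<open>q\<close>.\<close>

lemma orbit_prod_bound:
  fixes \<psi> :: "real \<Rightarrow> real"
  assumes d: "0 < d" and q: "0 < q"
    and psi: "\<And>t. 0 < t \<Longrightarrow> 0 \<le> \<psi> t" "\<And>t. 0 < t \<Longrightarrow> \<psi> t \<le> B"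
    and out: "\<And>t. 0 < t \<Longrightarrow> t \<notin> {d..e} \<Longrightarrow> \<psi> t \<le> q"
  obtains K where "0 \<le> K" "\<And>t n. 0 < t \<Longrightarrow> (\<Prod>i<n. \<psi> ((g ^^ i) t)) \<le> K * q ^ n"
proof -
  obtain k where k: "\<And>t i. t \<in> {d..e} \<Longrightarrow> k \<le> i \<Longrightarrow> (g ^^ i) t \<notin> {d..e}"
    using orbit_leaves_compact[OF d] by metis
  \<comment> \<open>Relative to \<open>q\<close>, a visit to \<open>{d..e}\<close> costs at most the
    factor \<open>C\<close>; being at least 1, it makes \<open>C ^ k\<close> an upper bound for
    fewer visits as well.\<close>
  define C where "C = max 1 (B / q)"
  have C: "1 \<le> C" "B / q \<le> C" by (auto simp: C_def)
  show ?thesis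
  proof (rule that[of "C ^ k"])
    show "0 \<le> C ^ k" using C by simp
    fix t :: real and n assume t: "0 < t"
    define V where "V = {i\<in>{..<n}. (g ^^ i) t \<in> {d..e}}"
    have "card V \<le> k"
    proof (cases "V = {}")
      case False
      define j where "j = Min V"
      have fin: "finite V" by (simp add: V_def)
      have j: "j \<in> V" "\<And>i. i \<in> V \<Longrightarrow> j \<le> i"
        using Min_in[OF fin False] Min_le[OF fin] by (auto simp: j_def)
      have "V \<subseteq> {j..<j + k}"
      proof
        fix i assume i: "i \<in> V"
        have "(g ^^ (i - j)) ((g ^^ j) t) = (g ^^ i) t"
          using j(2)[OF i] by (metis comp_apply funpow_add le_add_diff_inverse2)
        then have "\<not> k \<le> i - j"
          using k[of "(g ^^ j) t" "i - j"] i j(1) by (auto simp: V_def)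
        then show "i \<in> {j..<j + k}" using j(2)[OF i] by auto
      qed
      then show ?thesis using card_mono[of "{j..<j + k}" V] by simp
    qed simp
    have "(\<Prod>i<n. \<psi> ((g ^^ i) t)) \<le> (\<Prod>i<n. q * (if i \<in> V then C else 1))"
    proof (rule prod_mono)
      fix i assume i: "i \<in> {..<n}"
      have pos: "0 < (g ^^ i) t" by (rule g_iter_pos[OF t])
      show "0 \<le> \<psi> ((g ^^ i) t) \<and> \<psi> ((g ^^ i) t) \<le> q * (if i \<in> V then C else 1)"
      proof (cases "i \<in> V")
        case True
        have "q * (B / q) \<le> q * C" using C q by (intro mult_left_mono) auto
        then show ?thesis using True psi[OF pos] q by auto
      next
        case False
        then show ?thesis using psi(1)[OF pos] out[OF pos] i by (auto simp: V_def)
      qed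
    qed
    also have "\<dots> = q ^ n * C ^ card V"
      unfolding prod.distrib by (simp add: prod.If_cases V_def Int_def)
    also have "\<dots> \<le> q ^ n * C ^ k"
      using C q \<open>card V \<le> k\<close> by (intro mult_left_mono power_increasing) auto
    finally show "(\<Prod>i<n. \<psi> ((g ^^ i) t)) \<le> C ^ k * q ^ n" by (simp add: mult.commute)
  qed
qed

section \<open>Contractivity when one coefficient dominates near both ends\<close>

lemma weight_powr:
  assumes "0 < p" "0 < t"
  shows "(norm (b t) * g' t powr (-1/p)) powr p = norm (b t) powr p / g' t"
proof -
  have "(g' t powr (-1/p)) powr p = g' t powr (-1)"
    using assms by (simp only: powr_powr) simp
  then show ?thesis
    using assms g'_pos[of t] by (simp add: powr_mult powr_minus divide_inverse)
qed

lemma contractive_if_a_dominates: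
  fixes a b :: "real \<Rightarrow> complex"
  assumes p: "0 < p" and meas: "a \<in> borel_measurable LR" "b \<in> borel_measurable LR"
    and A: "\<And>t. 0 < t \<Longrightarrow> norm (a t) \<le> A" and B: "\<And>t. 0 < t \<Longrightarrow> norm (b t) \<le> B"
    and k: "0 < k" "\<And>t. 0 < t \<Longrightarrow> k \<le> norm (a t)"
    and c: "0 < c" and d: "0 < d"
    and out: "\<And>t. 0 < t \<Longrightarrow> t \<notin> {d..e} \<Longrightarrow> c \<le> norm (a t) - norm (b t) * g' t powr (-1/p)"
  obtains K q where "contractive_weighted_shift g h g' m M p (\<lambda>t. b t / a t) K q"
proof -
  obtain q where q: "0 < q" "q < 1"
    and gap: "\<And>x y. 0 \<le> x \<Longrightarrow> x \<le> y - c \<Longrightarrow> y \<le> A \<Longrightarrow> x powr p \<le> q * y powr p"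
    using powr_gap[OF c p] by metis
  define \<psi> where "\<psi> t = norm (b t / a t) powr p / g' t" for t
  have eq: "\<psi> t = (norm (b t) powr p / g' t) / norm (a t) powr p" for t
    by (simp add: \<psi>_def norm_divide powr_divide)
  have "0 \<le> \<psi> t" if "0 < t" for t
    using g'_pos[OF that] by (simp add: \<psi>_def)
  moreover have "\<psi> t \<le> (B powr p / m) / k powr p" if "0 < t" for t
    unfolding eq using that k B g'_ge m_pos p by (intro frac_le powr_mono2) auto
  moreover have "\<psi> t \<le> q" if t: "0 < t" "t \<notin> {d..e}" for t
  proof -
    have "norm (b t) powr p / g' t \<le> q * norm (a t) powr p"
      unfolding weight_powr[OF p t(1), symmetric] using out[OF t] A[OF t(1)] by (intro gap) auto
    moreover have "0 < norm (a t) powr p" using k(1) k(2)[OF t(1)] by auto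
    ultimately show ?thesis unfolding eq by (simp only: pos_divide_le_eq)
  qed
  ultimately obtain K where K: "0 \<le> K" "\<And>t n. 0 < t \<Longrightarrow> (\<Prod>i<n. \<psi> ((g ^^ i) t)) \<le> K * q ^ n"
    using orbit_prod_bound[OF d q(1), of \<psi>] by metis
  have "contractive_weighted_shift g h g' m M p (\<lambda>t. b t / a t) K q"
  proof unfold_locales
    show "(\<lambda>t. b t / a t) \<in> borel_measurable LR" using meas by measurable
  qed (use p K q in \<open>auto simp: \<psi>_def\<close>)
  then show ?thesis by (rule that)
qed

text \<open>The Jacobian of the inverse shift involves \<open>g' (h t)\<close>, while the hypothesis
  compares the coefficients through \<open>g' t\<close>. Along an orbit the two products differ only
  by the quotient of \<open>g'\<close> at the last and the first point, which is at most
  \<open>M / m\<close>; this is where the constant \<open>K * (M / m)\<close> comes from.\<close>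

lemma contractive_if_b_dominates:
  fixes a b :: "real \<Rightarrow> complex"
  assumes p: "0 < p" and meas: "a \<in> borel_measurable LR" "b \<in> borel_measurable LR"
    and A: "\<And>t. 0 < t \<Longrightarrow> norm (a t) \<le> A" and B: "\<And>t. 0 < t \<Longrightarrow> norm (b t) \<le> B"
    and k: "0 < k" "\<And>t. 0 < t \<Longrightarrow> k \<le> norm (b t)"
    and c: "0 < c" and d: "0 < d"
    and out: "\<And>t. 0 < t \<Longrightarrow> t \<notin> {d..e} \<Longrightarrow> norm (a t) - norm (b t) * g' t powr (-1/p) \<le> - c"
  obtains K q where "contractive_weighted_shift h g (\<lambda>t. inverse (g' (h t))) (inverse M) (inverse m) p (\<lambda>t. a t / b t) K q"
proof -
  interpret inv: Rplus_diffeo h g "\<lambda>t. inverse (g' (h t))" "inverse M" "inverse m"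
    by (rule inverse_diffeo)
  have bound: "norm (b t) * g' t powr (-1/p) \<le> B * m powr (-1/p)" if "0 < t" for t
    using B[OF that] g'_ge[OF that] m_pos p norm_ge_zero[of "b t"]
    by (intro mult_mono powr_mono2') (auto simp del: norm_ge_zero)
  obtain q where q: "0 < q" "q < 1"
    and gap: "\<And>x y. 0 \<le> x \<Longrightarrow> x \<le> y - c \<Longrightarrow> y \<le> B * m powr (-1/p) \<Longrightarrow> x powr p \<le> q * y powr p"
    using powr_gap[OF c p] by metis
  define \<psi> where "\<psi> t = norm (a t / b t) powr p * g' t" for t
  have eq: "\<psi> t = norm (a t) powr p / norm (b t) powr p * g' t" for t
    by (simp add: \<psi>_def norm_divide powr_divide)
  have "0 \<le> \<psi> t" if "0 < t" for t
    using g'_pos[OF that] by (simp add: \<psi>_def)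
  moreover have "\<psi> t \<le> A powr p / k powr p * M" if "0 < t" for t
    unfolding eq using that k A g'_le g'_pos[OF that] p by (intro mult_mono frac_le powr_mono2) auto
  moreover have "\<psi> t \<le> q" if t: "0 < t" "t \<notin> {d..e}" for t
  proof -
    have "norm (a t) powr p \<le> q * (norm (b t) powr p / g' t)"
      unfolding weight_powr[OF p t(1), symmetric] using out[OF t] bound[OF t(1)] by (intro gap) auto
    moreover have "0 < norm (b t) powr p" using k(1) k(2)[OF t(1)] by auto
    ultimately show ?thesis unfolding eq using g'_pos[OF t(1)] by (simp add: field_simps)
  qed
  ultimately obtain K where K: "0 \<le> K" "\<And>t n. 0 < t \<Longrightarrow> (\<Prod>i<n. \<psi> ((h ^^ i) t)) \<le> K * q ^ n"
    using inv.orbit_prod_bound[OF d q(1), of \<psi>] by metis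
  have "contractive_weighted_shift h g (\<lambda>t. inverse (g' (h t))) (inverse M) (inverse m) p (\<lambda>t. a t / b t) (K * (M / m)) q"
  proof unfold_locales
    show "(\<lambda>t. a t / b t) \<in> borel_measurable LR" using meas by measurable
    show "0 \<le> K * (M / m)" using K m_pos M_pos by simp
    fix n and t :: real assume t: "0 < t"
    let ?X = "\<Prod>i<n. norm (a ((h ^^ i) t) / b ((h ^^ i) t)) powr p"
    have shift: "(\<Prod>i<n. g' (h ((h ^^ i) t))) = (\<Prod>i<n. g' ((h ^^ i) t)) * (g' ((h ^^ n) t) / g' t)"
    proof -
      have "g' t * (\<Prod>i<n. g' (h ((h ^^ i) t))) = (\<Prod>i<Suc n. g' ((h ^^ i) t))"
        by (simp add: prod.lessThan_Suc_shift del: prod.lessThan_Suc)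
      then show ?thesis using g'_pos[OF t] by (simp add: field_simps)
    qed
    have "(\<Prod>i<n. norm (a ((h ^^ i) t) / b ((h ^^ i) t)) powr p / inverse (g' (h ((h ^^ i) t))))
        = (\<Prod>i<n. \<psi> ((h ^^ i) t)) * (g' ((h ^^ n) t) / g' t)"
      by (simp add: divide_inverse prod.distrib shift \<psi>_def)
    also have "\<dots> \<le> (K * q ^ n) * (M / m)"
      using K t q g'_le[OF inv.g_iter_pos[OF t]] g'_ge[OF t] m_pos M_pos g'_pos[OF inv.g_iter_pos[OF t], of n] g'_pos[OF t]
      by (intro mult_mono frac_le) auto
    finally show "(\<Prod>i<n. norm (a ((h ^^ i) t) / b ((h ^^ i) t)) powr p / inverse (g' (h ((h ^^ i) t)))) \<le> K * (M / m) * q ^ n"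
      by (simp add: mult_ac)
  qed (use p q in auto)
  then show ?thesis by (rule that)
qed

end

section \<open>Convergence of the inverse series\<close>

lemma Wop_apply: "Wop g f t = f (g t)"
  by (simp add: Wop_def)

lemma Lp_opnorm_convI:
  assumes p: "0 < p" and K: "0 \<le> K" and q: "0 < q" "q < 1"
    and meas: "\<And>n u. u \<in> Lp p \<Longrightarrow> (\<lambda>t. B u t - S n u t) \<in> borel_measurable LR"
    and bound: "\<And>n u. u \<in> Lp p \<Longrightarrow> Np p (\<lambda>t. B u t - S n u t) \<le> ennreal (K * q ^ n) * Np p u"
  shows "Lp_opnorm_conv p S B"
  unfolding Lp_opnorm_conv_def
proof (intro allI impI)
  fix \<epsilon> :: real assume \<epsilon>: "0 < \<epsilon>"
  have "(\<lambda>n. K * q ^ n) \<longlonglongrightarrow> K * 0"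
    using q by (intro tendsto_mult_left LIMSEQ_power_zero) auto
  then have "eventually (\<lambda>n. K * q ^ n < \<epsilon> powr p) sequentially"
    using \<epsilon> by (intro order_tendstoD) auto
  then obtain N where N: "\<And>n. N \<le> n \<Longrightarrow> K * q ^ n < \<epsilon> powr p"
    by (auto simp: eventually_sequentially)
  have "Lp_norm p (\<lambda>t. B u t - S n u t) \<le> \<epsilon> * Lp_norm p u" if n: "N \<le> n" and u: "u \<in> Lp p" for n u
  proof -
    have "Lp_norm p (\<lambda>t. B u t - S n u t) \<le> (K * q ^ n) powr (1/p) * Lp_norm p u"
      using K q by (intro Np_le_imp_Lp_norm_le[OF p _ meas[OF u] u bound[OF u]]) auto
    also have "(K * q ^ n) powr (1/p) \<le> (\<epsilon> powr p) powr (1/p)"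
      using N[OF n] K q p by (intro powr_mono2) auto
    also have "(\<epsilon> powr p) powr (1/p) = \<epsilon>"
      using \<epsilon> p by (simp add: powr_powr)
    finally show ?thesis by (simp add: mult_right_mono Lp_norm_def)
  qed
  then show "\<exists>N. \<forall>n\<ge>N. \<forall>u\<in>Lp p. Lp_norm p (\<lambda>t. B u t - S n u t) \<le> \<epsilon> * Lp_norm p u"
    by blast
qed

lemma Lp_inverse_Np_bound:
  assumes "0 < p" "Lp_inverse p A B"
  obtains C where "0 \<le> C" "\<And>f. f \<in> Lp p \<Longrightarrow> Np p (B f) \<le> ennreal C * Np p f"
proof -
  obtain C where C: "0 \<le> C" "\<And>f. f \<in> Lp p \<Longrightarrow> Lp_norm p (B f) \<le> C * Lp_norm p f"
    using Lp_inverse_bound[OF assms(2)] by blast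
  have "Np p (B f) \<le> ennreal (C powr p) * Np p f" if "f \<in> Lp p" for f
    using C that Lp_inverseD(1)[OF assms(2) that] assms(1) by (intro Lp_norm_le_imp_Np_le) auto
  then show ?thesis using that[of "C powr p"] by simp
qed

context Rplus_diffeo
begin

lemma Lp_op_funop:
  assumes "0 < p" "a \<in> borel_measurable LR" "b \<in> borel_measurable LR"
    and "\<And>t. 0 < t \<Longrightarrow> norm (a t) \<le> A" "\<And>t. 0 < t \<Longrightarrow> norm (b t) \<le> B"
  shows "Lp_op p (funop a b g)"
  unfolding Lp_op_def
proof (intro conjI ballI impI)
  fix f assume "f \<in> Lp p"
  then show "funop a b g f \<in> Lp p"
    unfolding funop_def Wop_def using assms by (intro Lp_diff Lp_mult[of p _ a A] Lp_mult[of p _ b B] Lp_comp)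
next
  fix f f' :: "real \<Rightarrow> complex" assume "AE t in LR. f t = f' t"
  then show "AE t in LR. funop a b g f t = funop a b g f' t"
    using AE_g[OF \<open>AE t in LR. f t = f' t\<close>] by eventually_elim (simp add: funop_def Wop_def)
qed

text \<open>Invertibility follows from the factorisation a (I - T). For a given inverse
  \<open>Q\<close>, the function \<open>Q u\<close> solves f - T f = u / a, so the error of the n-th
  partial sum is the n-th iterate of \<open>T\<close> applied to \<open>Q u\<close>; the boundedness
  of \<open>Q\<close> then yields a geometric rate.\<close>

lemma funop_invertible_series1:
  assumes p: "0 < p" and meas: "a \<in> borel_measurable LR" "b \<in> borel_measurable LR"
    and A: "\<And>t. 0 < t \<Longrightarrow> norm (a t) \<le> A" and B: "\<And>t. 0 < t \<Longrightarrow> norm (b t) \<le> B"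
    and k: "0 < k" "\<And>t. 0 < t \<Longrightarrow> k \<le> norm (a t)"
    and contr: "contractive_weighted_shift g h g' m M p (\<lambda>t. b t / a t) K q"
  shows "Lp_invertible p (funop a b g)"
    and "Lp_inverse p (funop a b g) Q \<Longrightarrow> Lp_opnorm_conv p (series1 a b g) Q"
proof -
  interpret contractive_weighted_shift g h g' m M p "\<lambda>t. b t / a t" K q by (rule contr)
  have nz: "a t \<noteq> 0" if "0 < t" for t using k(1) k(2)[OF that] by auto
  have c: "norm (b t / a t) \<le> B / k" if "0 < t" for t
    unfolding norm_divide using that k B order_trans[OF norm_ge_zero B[OF that]] by (intro frac_le) auto
  have "Lp_inverse p (mulop a \<circ> (\<lambda>f t. f t - T f t)) (R \<circ> mulop (\<lambda>t. inverse (a t)))"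
    by (intro Lp_inverse_comp p Lp_inverse_mulop[OF p meas(1) k] Lp_inverse_Neumann
        Lp_op_mulop[OF p meas(1) A] Lp_op_Neumann[OF c])
  then have "Lp_inverse p (funop a b g) (R \<circ> mulop (\<lambda>t. inverse (a t)))"
    by (rule Lp_inverse_cong[OF _ Lp_op_comp[OF Lp_op_mulop[OF p meas(1) A] Lp_op_Neumann[OF c]]])
      (auto simp: funop_def mulop_def Wop_def nz field_simps)
  then show "Lp_invertible p (funop a b g)"
    unfolding Lp_invertible_def by blast
  assume Q: "Lp_inverse p (funop a b g) Q"
  obtain C where C: "0 \<le> C" "\<And>f. f \<in> Lp p \<Longrightarrow> Np p (Q f) \<le> ennreal C * Np p f"
    using Lp_inverse_Np_bound[OF p Q] by blast
  show "Lp_opnorm_conv p (series1 a b g) Q"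
  proof (rule Lp_opnorm_convI[OF p _ q])
    show "0 \<le> K * C" using K_nonneg C by simp
    fix n u assume u: "u \<in> Lp p"
    define v where "v = mulop (\<lambda>s. inverse (a s)) u"
    have vm: "v \<in> borel_measurable LR"
      unfolding v_def mulop_def using meas u by (auto simp: Lp_iff)
    have Qu: "Q u \<in> Lp p" "Q u \<in> borel_measurable LR"
      using Lp_inverseD(1)[OF Q u] by (auto simp: Lp_iff)
    have S: "series1 a b g n u t = (\<Sum>i<n. (T ^^ i) v t)" for t
      by (simp add: series1_def v_def)
    show "(\<lambda>t. Q u t - series1 a b g n u t) \<in> borel_measurable LR"
      unfolding S by (intro borel_measurable_diff Qu borel_measurable_sum T_iter_measurable vm)
    have "AE t in LR. 0 < t" by (rule AE_I2) simp
    then have "AE t in LR. Q u t - T (Q u) t = v t"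
      using Lp_inverseD(2)[OF Q u]
      by eventually_elim (auto simp: funop_def mulop_def Wop_def v_def nz field_simps)
    then have "AE t in LR. Q u t - series1 a b g n u t = (T ^^ n) (Q u) t"
      unfolding S by (rule Neumann_remainder)
    then have "Np p (\<lambda>t. Q u t - series1 a b g n u t) = Np p ((T ^^ n) (Q u))"
      by (rule Np_cong_AE)
    also have "\<dots> \<le> ennreal (K * q ^ n) * Np p (Q u)"
      by (rule Np_T_iter_le[OF Qu(2)])
    also have "\<dots> \<le> ennreal (K * q ^ n) * (ennreal C * Np p u)"
      by (intro mult_left_mono C u) auto
    also have "\<dots> = ennreal (K * C * q ^ n) * Np p u"
      using K_nonneg C q by (simp add: ennreal_mult mult_ac)
    finally show "Np p (\<lambda>t. Q u t - series1 a b g n u t) \<le> ennreal (K * C * q ^ n) * Np p u" .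
  qed
qed

text \<open>The rightmost factor is now the shift, so it is \<open>Wop g (Q u)\<close> that
  satisfies a Neumann equation. The remainder is carried back by composing with \<open>h\<close>,
  which costs \<open>M\<close>, and the norm of \<open>Wop g (Q u)\<close> costs
  \<open>1 / m\<close>; both enter the constant of the geometric bound.\<close>

lemma funop_invertible_series2:
  assumes p: "0 < p" and meas: "a \<in> borel_measurable LR" "b \<in> borel_measurable LR"
    and A: "\<And>t. 0 < t \<Longrightarrow> norm (a t) \<le> A" and B: "\<And>t. 0 < t \<Longrightarrow> norm (b t) \<le> B"
    and k: "0 < k" "\<And>t. 0 < t \<Longrightarrow> k \<le> norm (b t)"
    and contr: "contractive_weighted_shift h g (\<lambda>t. inverse (g' (h t))) (inverse M) (inverse m) p (\<lambda>t. a t / b t) K q"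
    and h: "h = inv_into Rplus g"
  shows "Lp_invertible p (funop a b g)"
    and "Lp_inverse p (funop a b g) Q \<Longrightarrow> Lp_opnorm_conv p (series2 a b g) Q"
proof -
  interpret inv: contractive_weighted_shift h g "\<lambda>t. inverse (g' (h t))" "inverse M" "inverse m" p "\<lambda>t. a t / b t" K q
    by (rule contr)
  have nz: "b t \<noteq> 0" if "0 < t" for t using k(1) k(2)[OF that] by auto
  have c: "norm (a t / b t) \<le> A / k" if "0 < t" for t
    unfolding norm_divide using that k A order_trans[OF norm_ge_zero A[OF that]] by (intro frac_le) auto
  define nb where "nb = (\<lambda>t. - b t)"
  have nb: "nb \<in> borel_measurable LR" "\<And>t. 0 < t \<Longrightarrow> norm (nb t) \<le> B" "\<And>t. 0 < t \<Longrightarrow> k \<le> norm (nb t)"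
    using meas B k by (auto simp: nb_def)
  have op: "Lp_op p (mulop nb)" "Lp_op p (\<lambda>f t. f t - inv.T f t)" "Lp_op p (Wop g)"
    by (intro Lp_op_mulop[OF p nb(1,2)] inv.Lp_op_Neumann[OF c] Lp_op_Wop; assumption)+
  have "Lp_inverse p (mulop nb \<circ> (\<lambda>f t. f t - inv.T f t) \<circ> Wop g) (Wop h \<circ> (inv.R \<circ> mulop (\<lambda>t. inverse (nb t))))"
    by (intro Lp_inverse_comp p Lp_inverse_mulop[OF p nb(1) k(1) nb(3)] inv.Lp_inverse_Neumann op Lp_op_comp Lp_inverse_Wop)
  then have "Lp_inverse p (funop a b g) (Wop h \<circ> (inv.R \<circ> mulop (\<lambda>t. inverse (nb t))))"
    by (rule Lp_inverse_cong[OF _ Lp_op_comp[OF Lp_op_comp[OF op(1,2)] op(3)]])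
      (auto simp: funop_def mulop_def Wop_def nz nb_def gh field_simps)
  then show "Lp_invertible p (funop a b g)"
    unfolding Lp_invertible_def by blast
  assume Q: "Lp_inverse p (funop a b g) Q"
  obtain C where C: "0 \<le> C" "\<And>f. f \<in> Lp p \<Longrightarrow> Np p (Q f) \<le> ennreal C * Np p f"
    using Lp_inverse_Np_bound[OF p Q] by blast
  show "Lp_opnorm_conv p (series2 a b g) Q"
  proof (rule Lp_opnorm_convI[OF p _ inv.q])
    show "0 \<le> M * K * (1 / m) * C" using inv.K_nonneg C M_pos m_pos by simp
    fix n u assume u: "u \<in> Lp p"
    define v where "v = mulop (\<lambda>s. inverse (b s)) u"
    have vm: "v \<in> borel_measurable LR"
      unfolding v_def mulop_def using meas u by (auto simp: Lp_iff)
    have Qu: "Q u \<in> Lp p" "Q u \<in> borel_measurable LR"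
      using Lp_inverseD(1)[OF Q u] by (auto simp: Lp_iff)
    have WQu: "Wop g (Q u) \<in> borel_measurable LR"
      using Lp_comp[OF Qu(1)] by (simp add: Wop_def Lp_iff)
    have S: "series2 a b g n u t = - (\<Sum>i<n. (inv.T ^^ i) v (h t))" for t
      by (simp add: series2_def v_def Wop_apply h)
    show "(\<lambda>t. Q u t - series2 a b g n u t) \<in> borel_measurable LR"
      unfolding S by (intro borel_measurable_diff Qu borel_measurable_uminus borel_measurable_sum
          measurable_compose[OF inv.measurable_g inv.T_iter_measurable] vm)
    have pos: "AE t in LR. 0 < t" by (rule AE_I2) simp
    then have "AE t in LR. Wop g (Q u) t - inv.T (Wop g (Q u)) t = - v t"
      using Lp_inverseD(2)[OF Q u]
      by eventually_elim (auto simp: funop_def mulop_def Wop_def v_def nz gh field_simps)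
    then have "AE t in LR. Wop g (Q u) t - (\<Sum>i<n. (inv.T ^^ i) (\<lambda>t. - v t) t) = (inv.T ^^ n) (Wop g (Q u)) t"
      by (rule inv.Neumann_remainder)
    then have "AE t in LR. Wop g (Q u) (h t) - (\<Sum>i<n. (inv.T ^^ i) (\<lambda>t. - v t) (h t)) = (inv.T ^^ n) (Wop g (Q u)) (h t)"
      by (rule inv.AE_g)
    with pos have "AE t in LR. Q u t - series2 a b g n u t = (inv.T ^^ n) (Wop g (Q u)) (h t)"
    proof eventually_elim
      case (elim t)
      have "(inv.T ^^ i) (\<lambda>t. - v t) s = - (inv.T ^^ i) v s" for i s
        using inv.T_iter_linear[of i "-1" v "\<lambda>_. 0" s] by (simp add: inv.weighted_shift_iter)
      with elim show ?case by (simp add: S sum_negf Wop_def gh)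
    qed
    then have "Np p (\<lambda>t. Q u t - series2 a b g n u t) = Np p (\<lambda>t. (inv.T ^^ n) (Wop g (Q u)) (h t))"
      by (rule Np_cong_AE)
    also have "\<dots> \<le> ennreal M * Np p ((inv.T ^^ n) (Wop g (Q u)))"
      using inv.Np_comp_le[OF inv.T_iter_measurable[OF WQu], of p n] by (simp add: divide_inverse)
    also have "\<dots> \<le> ennreal M * (ennreal (K * q ^ n) * (ennreal (1 / m) * (ennreal C * Np p u)))"
    proof (intro mult_left_mono)
      have "Np p ((inv.T ^^ n) (Wop g (Q u))) \<le> ennreal (K * q ^ n) * Np p (Wop g (Q u))"
        by (rule inv.Np_T_iter_le[OF WQu])
      also have "Np p (Wop g (Q u)) \<le> ennreal (1 / m) * Np p (Q u)"
        unfolding Wop_def by (rule Np_comp_le[OF Qu(2)])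
      also have "Np p (Q u) \<le> ennreal C * Np p u" by (rule C(2)[OF u])
      finally show "Np p ((inv.T ^^ n) (Wop g (Q u))) \<le> ennreal (K * q ^ n) * (ennreal (1 / m) * (ennreal C * Np p u))"
        by (simp add: mult_left_mono)
    qed simp
    also have "\<dots> = ennreal (M * K * (1 / m) * C * q ^ n) * Np p u"
    proof -
      define x where "x = 1 / m"
      have "0 \<le> x" using m_pos by (simp add: x_def)
      then show ?thesis
        unfolding x_def [symmetric] using inv.K_nonneg C inv.q M_pos by (simp add: ennreal_mult mult_ac)
    qed
    finally show "Np p (\<lambda>t. Q u t - series2 a b g n u t) \<le> ennreal (M * K * (1 / m) * C * q ^ n) * Np p u" .
  qed
qed

end

section \<open>Orbit inequalities\<close>

lemma emeasure_LR_Icc: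
  assumes "0 < t" "0 \<le> d"
  shows "emeasure LR {t..t + d} = ennreal d"
  using assms by (subst emeasure_restrict_space) auto

lemma Icc_in_sets_LR: "0 < t \<Longrightarrow> {t..t + d} \<in> sets LR"
  by (auto simp: sets_LR_iff)

text \<open>Test functions in \<open>Lp p\<close> yield only integrated inequalities; this localises
  them to one point. If the conclusion failed, a constant would separate the two functions near
  \<open>t\<close>, contradicting the inequality on a short interval. The sign condition at
  \<open>t\<close> is there because \<open>ennreal\<close> sends negative values to 0.\<close>

lemma le_if_local_averages_le:
  fixes L R :: "real \<Rightarrow> real"
  assumes t: "0 < t" and cont: "continuous_on Rplus L" "continuous_on Rplus R" and "0 \<le> R t"
    and d0: "0 < d0"
    and le: "\<And>d. 0 < d \<Longrightarrow> d \<le> d0 \<Longrightarrow>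
      (\<integral>\<^sup>+ s. ennreal (L s) * indicator {t..t + d} s \<partial>LR) \<le> (\<integral>\<^sup>+ s. ennreal (R s) * indicator {t..t + d} s \<partial>LR)"
  shows "L t \<le> R t"
proof (rule ccontr)
  assume "\<not> L t \<le> R t"
  then obtain c where c: "R t < c" "c < L t" using dense by (metis not_le)
  obtain c' where c': "c < c'" "c' < L t" using dense[OF c(2)] by blast
  have isC: "isCont L t" "isCont R t"
    using cont t by (auto simp: continuous_on_eq_continuous_at)
  have "eventually (\<lambda>s. c' < L s \<and> R s < c) (nhds t)"
    using isC c(1) c'(2) unfolding isCont_def tendsto_at_iff_tendsto_nhds
    by (intro eventually_conj order_tendstoD) auto
  then obtain e where e: "0 < e" "\<And>s. dist s t < e \<Longrightarrow> c' < L s \<and> R s < c"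
    by (auto simp: eventually_nhds_metric)
  define d where "d = min d0 (e / 2)"
  have d: "0 < d" "d \<le> d0" "d < e" using d0 e by (auto simp: d_def)
  have J: "c' < L s \<and> R s < c" if "s \<in> {t..t + d}" for s
    using e(2)[of s] that d by (auto simp: dist_real_def)
  have *: "(\<integral>\<^sup>+ s. ennreal k * indicator {t..t + d} s \<partial>LR) = ennreal k * ennreal d" for k
    using d t by (simp add: nn_integral_cmult_indicator Icc_in_sets_LR emeasure_LR_Icc)
  have "ennreal c' * ennreal d \<le> (\<integral>\<^sup>+ s. ennreal (L s) * indicator {t..t + d} s \<partial>LR)"
    unfolding * [symmetric] using J
    by (intro nn_integral_mono) (auto simp: indicator_def less_imp_le intro!: ennreal_leI)
  also have "\<dots> \<le> (\<integral>\<^sup>+ s. ennreal (R s) * indicator {t..t + d} s \<partial>LR)"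
    by (rule le[OF d(1,2)])
  also have "\<dots> \<le> ennreal c * ennreal d"
    unfolding * [symmetric] using J
    by (intro nn_integral_mono) (auto simp: indicator_def less_imp_le intro!: ennreal_leI)
  finally have "c' * d \<le> c * d"
    using c c' d assms(4) by (simp add: ennreal_mult' [symmetric] ennreal_mult'' [symmetric] ennreal_le_iff)
  then show False using c' d by simp
qed

lemma nn_integral_Icc_finite:
  fixes G :: "real \<Rightarrow> real"
  assumes "0 < t" "0 \<le> d" "continuous_on Rplus G"
  shows "(\<integral>\<^sup>+ s. ennreal (G s) * indicator {t..t + d} s \<partial>LR) < \<infinity>"
proof -
  have "continuous_on {t..t + d} G"
    by (rule continuous_on_subset[OF assms(3)]) (use assms in auto)
  then have "bounded (G ` {t..t + d})"
    by (intro compact_imp_bounded compact_continuous_image) auto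
  then obtain B where B: "\<And>s. s \<in> {t..t + d} \<Longrightarrow> norm (G s) \<le> B"
    unfolding bounded_iff by blast
  then have B': "G s \<le> B" if "t \<le> s" "s \<le> t + d" for s
    using that by (force intro: order_trans[OF abs_ge_self])
  have "(\<integral>\<^sup>+ s. ennreal (G s) * indicator {t..t + d} s \<partial>LR) \<le> (\<integral>\<^sup>+ s. ennreal B * indicator {t..t + d} s \<partial>LR)"
    by (intro nn_integral_mono) (auto simp: indicator_def intro!: ennreal_leI B')
  also have "\<dots> = ennreal B * ennreal d"
    using assms by (simp add: nn_integral_cmult_indicator Icc_in_sets_LR emeasure_LR_Icc)
  finally show ?thesis by (auto simp: less_top[symmetric] top_unique ennreal_mult_eq_top_iff)
qed

lemma powr_norm_sum_disjoint:
  fixes x :: "'i \<Rightarrow> 'a::real_normed_vector"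
  assumes "finite I" "\<And>i j. i \<in> I \<Longrightarrow> j \<in> I \<Longrightarrow> x i \<noteq> 0 \<Longrightarrow> x j \<noteq> 0 \<Longrightarrow> i = j"
  shows "norm (\<Sum>i\<in>I. x i) powr p = (\<Sum>i\<in>I. norm (x i) powr p)"
proof (cases "\<exists>i\<in>I. x i \<noteq> 0")
  case True
  then obtain i where i: "i \<in> I" "x i \<noteq> 0" by blast
  then have z: "x j = 0" if "j \<in> I - {i}" for j using assms(2)[of i j] that by auto
  show ?thesis
    using assms(1) i z by (simp add: sum.remove[of I i])
qed simp

context Rplus_diffeo
begin

text \<open>A wandering set in the sense of dynamics. Since \<open>g\<close> is injective, its
  forward images are pairwise disjoint, so pieces of a function living on different images do not
  overlap.\<close>

definition wandering :: "real set \<Rightarrow> bool" where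
  "wandering J \<longleftrightarrow> J \<subseteq> Rplus \<and> (\<forall>n\<ge>1. \<forall>s\<in>J. (g ^^ n) s \<notin> J)"

lemma wandering_subset: "wandering J \<Longrightarrow> J' \<subseteq> J \<Longrightarrow> wandering J'"
  unfolding wandering_def by blast

lemma wandering_interval:
  assumes t: "0 < t"
  obtains d where "0 < d" "wandering {t..t + d}"
proof -
  have iter: "(g ^^ Suc n) s = (g ^^ n) (g s)" for n s by (simp add: funpow_swap1)
  show ?thesis using up_or_down
  proof
    assume up: "\<forall>t>0. t < g t"
    have ge: "s \<le> (g ^^ n) s" if "0 < s" for n s
    proof (induction n)
      case (Suc n)
      then show ?case using up g_iter_pos[OF that, of n] by (force intro: order_trans less_imp_le)
    qed simp
    \<comment> \<open>Half of the gap to \<open>g t\<close>: the interval ends before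
      \<open>g t\<close>, while all its forward images lie at or above \<open>g t\<close>.\<close>
    define d where "d = (g t - t) / 2"
    have d: "0 < d" "t + d < g t" using up t by (auto simp: d_def field_simps)
    have "(g ^^ n) s \<notin> {t..t + d}" if n: "1 \<le> n" and sJ: "s \<in> {t..t + d}" for n s
    proof -
      have s: "0 < s" "t \<le> s" using sJ t by auto
      obtain k where k: "n = Suc k" using n by (cases n) auto
      have "g t \<le> g s" using g_le t s by blast
      also have "g s \<le> (g ^^ n) s" unfolding k iter using ge[OF g_pos[OF s(1)]] .
      finally show ?thesis using d by auto
    qed
    then have "wandering {t..t + d}" unfolding wandering_def using t by auto
    with d(1) show ?thesis by (rule that)
  next
    assume down: "\<forall>t>0. g t < t"
    have le: "(g ^^ n) s \<le> s" if "0 < s" for n s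
    proof (induction n)
      case (Suc n)
      then show ?case using down g_iter_pos[OF that, of n] by (force intro: order_trans less_imp_le)
    qed simp
    have "eventually (\<lambda>s. g s < t) (nhds t)"
      using isCont_g[OF t] down t unfolding isCont_def tendsto_at_iff_tendsto_nhds
      by (intro order_tendstoD(2)[of g "g t"]) auto
    then obtain e where e: "0 < e" "\<And>s. dist s t < e \<Longrightarrow> g s < t"
      by (auto simp: eventually_nhds_metric)
    have "(g ^^ n) s \<notin> {t..t + e / 2}" if n: "1 \<le> n" and sJ: "s \<in> {t..t + e / 2}" for n s
    proof -
      have s: "0 < s" using sJ t by auto
      obtain k where k: "n = Suc k" using n by (cases n) auto
      have "(g ^^ n) s \<le> g s" unfolding k iter using le[OF g_pos[OF s]] .
      also have "\<dots> < t" using e sJ by (auto simp: dist_real_def)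
      finally show ?thesis by auto
    qed
    then have "wandering {t..t + e / 2}" unfolding wandering_def using t by auto
    with e(1) show ?thesis using that[of "e / 2"] by auto
  qed
qed

lemma g_iter_h_iter: "0 < t \<Longrightarrow> (g ^^ k) ((h ^^ k) t) = t"
  by (rule Rplus_diffeo.h_iter_g_iter[OF inverse_diffeo])

lemma h_iter_pos: "0 < t \<Longrightarrow> 0 < (h ^^ k) t"
  by (rule Rplus_diffeo.g_iter_pos[OF inverse_diffeo])

lemma measurable_h_iter: "h ^^ k \<in> measurable LR LR"
  by (rule Rplus_diffeo.measurable_g_iter[OF inverse_diffeo])

text \<open>At most one image of \<open>J\<close> contains \<open>r\<close>: two different indices
  would bring a point of \<open>J\<close> back into \<open>J\<close> after as many steps as they
  differ.\<close>

lemma wandering_unique: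
  assumes "wandering J" "0 < r" "(h ^^ j) r \<in> J" "(h ^^ k) r \<in> J"
  shows "j = k"
proof -
  have *: "False" if "j < k" "(h ^^ j) r \<in> J" "(h ^^ k) r \<in> J" for j k
  proof -
    have "(g ^^ (k - j)) ((h ^^ k) r) = (g ^^ (k - j)) ((h ^^ (k - j)) ((h ^^ j) r))"
      using that(1) by (metis comp_apply funpow_add le_add_diff_inverse2 less_imp_le)
    also have "\<dots> = (h ^^ j) r" using assms(2) by (intro g_iter_h_iter h_iter_pos)
    finally show False using assms(1) that unfolding wandering_def by (metis One_nat_def Suc_leI zero_less_diff)
  qed
  show ?thesis using *[of j k] *[of k j] assms(3,4) by (cases j k rule: linorder_cases) auto
qed

lemma Np_push_forward:
  assumes [measurable]: "\<phi> \<in> borel_measurable LR"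
  shows "Np p (\<lambda>r. \<phi> ((h ^^ k) r)) = (\<integral>\<^sup>+ s. ennreal (norm (\<phi> s) powr p * w k s) \<partial>LR)"
proof -
  note [measurable] = measurable_h_iter
  have "Np p (\<lambda>r. \<phi> ((h ^^ k) r)) =
      (\<integral>\<^sup>+ s. ennreal (norm (\<phi> ((h ^^ k) ((g ^^ k) s))) powr p) * ennreal (w k s) \<partial>LR)"
    unfolding Np_def
    by (subst nn_integral_change_iter[of "\<lambda>r. ennreal (norm (\<phi> ((h ^^ k) r)) powr p)"]) auto
  also have "\<dots> = (\<integral>\<^sup>+ s. ennreal (norm (\<phi> s) powr p * w k s) \<partial>LR)"
    by (intro nn_integral_cong) (simp add: h_iter_g_iter ennreal_mult' [symmetric])
  finally show ?thesis .
qed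

end

context Rplus_diffeo
begin

lemma continuous_on_comp_g_iter:
  "continuous_on Rplus f \<Longrightarrow> continuous_on Rplus (\<lambda>s. f ((g ^^ k) s))"
  by (rule continuous_on_compose2[OF _ continuous_on_g_iter]) (auto intro: g_iter_pos)

lemma w_split:
  assumes "k \<le> N"
  shows "w (Suc N) t = w (Suc k) t * (\<Prod>i\<in>{k<..N}. g' ((g ^^ i) t))"
proof -
  have "{..<Suc N} = {..<Suc k} \<union> {k<..N}" using assms by auto
  moreover have "{..<Suc k} \<inter> {k<..N} = {}" by auto
  ultimately show ?thesis unfolding w_def by (simp add: prod.union_disjoint del: prod.lessThan_Suc)
qed

text \<open>The test function carries the weight \<open>x k\<close> on the \<open>(k+1)\<close>-st iterate of a short wandering
  interval; the weights are chosen so that the operator annihilates everything except at the two ends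
  of the orbit segment.\<close>

lemma orbit_inequality_lower:
  fixes a b :: "real \<Rightarrow> complex"
  assumes p: "0 < p" and cont: "continuous_on Rplus a" "continuous_on Rplus b" and C: "0 \<le> C"
    and lower: "\<And>f. f \<in> Lp p \<Longrightarrow> Np p f \<le> ennreal C * Np p (funop a b g f)"
    and t: "0 < t"
  shows "(\<Sum>k\<le>N. (\<Prod>i<k. norm (a ((g ^^ Suc i) t)) powr p) *
            (\<Prod>i\<in>{k<..N}. norm (b ((g ^^ i) t)) powr p / g' ((g ^^ i) t)))
    \<le> (C * 2 powr p) * ((\<Prod>i<Suc N. norm (a ((g ^^ Suc i) t)) powr p) +
            (\<Prod>i<Suc N. norm (b ((g ^^ i) t)) powr p / g' ((g ^^ i) t)))"
proof -
  \<comment> \<open>The index missing between the two products is what makes this work: multiplying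
    \<open>x k\<close> by \<open>b\<close> at iterate \<open>k\<close> gives \<open>z k\<close>,
    multiplying it by \<open>a\<close> at iterate \<open>k + 1\<close> gives
    \<open>z (Suc k)\<close>. Neighbouring contributions then cancel without any division.\<close>
  define x where "x k s = (\<Prod>i<k. a ((g ^^ Suc i) s)) * (\<Prod>i\<in>{k<..N}. b ((g ^^ i) s))" for k s
  define z where "z k s = (\<Prod>i<k. a ((g ^^ Suc i) s)) * (\<Prod>i\<in>{k..N}. b ((g ^^ i) s))" for k s
  have bx: "b ((g ^^ k) s) * x k s = z k s" if "k \<le> N" for k s
  proof -
    have "{k..N} = insert k {k<..N}" using that by auto
    then show ?thesis unfolding x_def z_def by (simp add: mult_ac)
  qed
  have ax: "a ((g ^^ Suc k) s) * x k s = z (Suc k) s" for k s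
    unfolding x_def z_def by (simp add: mult_ac atLeastSucAtMost_greaterThanAtMost)
  have xcont: "continuous_on Rplus (x k)" and zcont: "continuous_on Rplus (z k)" for k
    unfolding x_def z_def
    by (intro continuous_on_mult continuous_on_prod continuous_on_comp_g_iter cont)+
  define L where "L s = (\<Sum>k\<le>N. norm (x k s) powr p * w (Suc k) s)" for s
  define E where "E s = (C * 2 powr p) * (norm (z (Suc N) s) powr p * w (Suc N) s + norm (z 0 s) powr p)" for s
  have powr_cont: "continuous_on Rplus (\<lambda>s. norm (f s) powr p)" if "continuous_on Rplus f" for f :: "real \<Rightarrow> complex"
    using that p by (intro continuous_on_powr' continuous_on_norm continuous_on_const) auto
  have Lcont: "continuous_on Rplus L" and Econt: "continuous_on Rplus E"
    unfolding L_def E_def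
    by (intro continuous_intros powr_cont xcont zcont continuous_on_w)+
  obtain d0 where d0: "0 < d0" "wandering {t..t + d0}"
    using wandering_interval[OF t] by blast
  have "L t \<le> E t"
  proof (rule le_if_local_averages_le[OF t Lcont Econt _ d0(1)])
    show "0 \<le> E t" using C w_pos[OF t, of "Suc N"] by (simp add: E_def)
    fix d :: real assume d: "0 < d" "d \<le> d0"
    define J where "J = {t..t + d}"
    have wJ: "wandering J" using d d0(2) by (auto simp: J_def intro: wandering_subset)
    have Jset [measurable]: "J \<in> sets LR" unfolding J_def using t by (rule Icc_in_sets_LR)
    have Jpos: "0 < s" if "s \<in> J" for s using that t by (auto simp: J_def)
    define \<phi> where "\<phi> k s = indicator J s * x k s" for k s
    define \<zeta> where "\<zeta> k s = indicator J s * z k s" for k s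
    have [measurable]: "\<phi> k \<in> borel_measurable LR" "\<zeta> k \<in> borel_measurable LR" for k
      unfolding \<phi>_def \<zeta>_def using continuous_measurable_LR[OF xcont] continuous_measurable_LR[OF zcont]
      by measurable
    note [measurable] = measurable_h_iter measurable_w
      continuous_measurable_LR[OF xcont] continuous_measurable_LR[OF zcont]
    define f where "f r = (\<Sum>k\<le>N. \<phi> k ((h ^^ Suc k) r))" for r
    have fm [measurable]: "f \<in> borel_measurable LR"
      unfolding f_def by (intro borel_measurable_sum measurable_compose[OF measurable_h_iter]) simp
    have "norm (f r) powr p = (\<Sum>k\<le>N. norm (\<phi> k ((h ^^ Suc k) r)) powr p)" if "0 < r" for r
      unfolding f_def
    proof (rule powr_norm_sum_disjoint)
      fix i j assume "\<phi> i ((h ^^ Suc i) r) \<noteq> 0" "\<phi> j ((h ^^ Suc j) r) \<noteq> 0"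
      then have "(h ^^ Suc i) r \<in> J" "(h ^^ Suc j) r \<in> J"
        unfolding \<phi>_def by (auto simp: indicator_def split: if_splits)
      then show "i = j" using wandering_unique[OF wJ that, of "Suc i" "Suc j"] by simp
    qed simp
    then have "Np p f = (\<integral>\<^sup>+ r. (\<Sum>k\<le>N. ennreal (norm (\<phi> k ((h ^^ Suc k) r)) powr p)) \<partial>LR)"
      unfolding Np_def by (intro nn_integral_cong) (simp add: sum_ennreal)
    also have "\<dots> = (\<Sum>k\<le>N. Np p (\<lambda>r. \<phi> k ((h ^^ Suc k) r)))"
    proof -
      have "(\<lambda>r. \<phi> k ((h ^^ Suc k) r)) \<in> borel_measurable LR" for k
        by (rule measurable_compose[OF measurable_h_iter]) simp
      then show ?thesis unfolding Np_def by (intro nn_integral_sum) (simp del: funpow.simps)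
    qed
    also have "\<dots> = (\<Sum>k\<le>N. \<integral>\<^sup>+ s. ennreal (norm (x k s) powr p * w (Suc k) s) * indicator J s \<partial>LR)"
    proof (intro sum.cong refl)
      fix k
      show "Np p (\<lambda>r. \<phi> k ((h ^^ Suc k) r)) = (\<integral>\<^sup>+ s. ennreal (norm (x k s) powr p * w (Suc k) s) * indicator J s \<partial>LR)"
        by (subst Np_push_forward) (auto simp: \<phi>_def indicator_def intro!: nn_integral_cong)
    qed
    finally have Npf: "Np p f = (\<Sum>k\<le>N. \<integral>\<^sup>+ s. ennreal (norm (x k s) powr p * w (Suc k) s) * indicator J s \<partial>LR)" .
    have "Np p f < \<infinity>"
    proof -
      have "(\<integral>\<^sup>+ s. ennreal (norm (x k s) powr p * w (Suc k) s) * indicator J s \<partial>LR) < \<infinity>" for k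
        unfolding J_def using t d
        by (intro nn_integral_Icc_finite continuous_on_mult powr_cont xcont continuous_on_w) auto
      then show ?thesis unfolding Npf by (simp add: ennreal_sum_less_top)
    qed
    then have fLp: "f \<in> Lp p" using fm by (simp add: Lp_iff)
    \<comment> \<open>Multiplication by \<open>a\<close> keeps the k-th piece on the image of
      \<open>J\<close> with index \<open>k + 1\<close>, while the shift moves it to the image with
      index \<open>k\<close>. The sum telescopes and only the two extreme images survive.\<close>
    have Af: "funop a b g f r = \<zeta> (Suc N) ((h ^^ Suc N) r) - \<zeta> 0 r" if r: "0 < r" for r
    proof -
      have "a r * \<phi> k ((h ^^ Suc k) r) = \<zeta> (Suc k) ((h ^^ Suc k) r)" for k
        using ax[of k "(h ^^ Suc k) r"] g_iter_h_iter[OF r, of "Suc k"]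
        by (simp add: \<phi>_def \<zeta>_def mult_ac del: funpow.simps)
      moreover have "b r * \<phi> k ((h ^^ Suc k) (g r)) = \<zeta> k ((h ^^ k) r)" if "k \<le> N" for k
      proof -
        have "(h ^^ Suc k) (g r) = (h ^^ k) r"
          using hg[OF r] by (simp add: funpow_swap1)
        then show ?thesis
          using bx[OF that, of "(h ^^ k) r"] g_iter_h_iter[OF r, of k]
          by (simp add: \<phi>_def \<zeta>_def mult_ac del: funpow.simps)
      qed
      ultimately have "funop a b g f r = (\<Sum>k\<le>N. \<zeta> (Suc k) ((h ^^ Suc k) r) - \<zeta> k ((h ^^ k) r))"
        unfolding funop_def Wop_def f_def sum_subtractf sum_distrib_left by simp
      also have "\<dots> = \<zeta> (Suc N) ((h ^^ Suc N) r) - \<zeta> 0 ((h ^^ 0) r)"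
        by (subst lessThan_Suc_atMost[symmetric]) (rule sum_lessThan_telescope)
      finally show ?thesis by simp
    qed
    have "Np p (funop a b g f) = Np p (\<lambda>r. \<zeta> (Suc N) ((h ^^ Suc N) r) + - \<zeta> 0 r)"
      by (intro Np_cong_AE AE_I2) (simp add: Af del: funpow.simps)
    also have "\<dots> \<le> ennreal (2 powr p) * (Np p (\<lambda>r. \<zeta> (Suc N) ((h ^^ Suc N) r)) + Np p (\<lambda>r. - \<zeta> 0 r))"
      by (intro Np_add_le p measurable_compose[OF measurable_h_iter, of "\<zeta> (Suc N)"]) measurable
    also have "Np p (\<lambda>r. \<zeta> (Suc N) ((h ^^ Suc N) r)) = (\<integral>\<^sup>+ s. ennreal (norm (z (Suc N) s) powr p * w (Suc N) s) * indicator J s \<partial>LR)"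
      by (subst Np_push_forward) (auto simp: \<zeta>_def indicator_def intro!: nn_integral_cong)
    also have "Np p (\<lambda>r. - \<zeta> 0 r) = (\<integral>\<^sup>+ s. ennreal (norm (z 0 s) powr p) * indicator J s \<partial>LR)"
      unfolding Np_def by (auto simp: \<zeta>_def indicator_def intro!: nn_integral_cong)
    finally have NpAf: "Np p (funop a b g f) \<le> ennreal (2 powr p) *
      ((\<integral>\<^sup>+ s. ennreal (norm (z (Suc N) s) powr p * w (Suc N) s) * indicator J s \<partial>LR) +
       (\<integral>\<^sup>+ s. ennreal (norm (z 0 s) powr p) * indicator J s \<partial>LR))" .
    have "(\<integral>\<^sup>+ s. ennreal (L s) * indicator J s \<partial>LR)
        = (\<integral>\<^sup>+ s. (\<Sum>k\<le>N. ennreal (norm (x k s) powr p * w (Suc k) s) * indicator J s) \<partial>LR)"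
    proof (rule nn_integral_cong)
      fix s assume "s \<in> space LR"
      then have "0 \<le> norm (x k s) powr p * w (Suc k) s" for k using w_pos[of s "Suc k"] by simp
      then show "ennreal (L s) * indicator J s = (\<Sum>k\<le>N. ennreal (norm (x k s) powr p * w (Suc k) s) * indicator J s)"
        unfolding L_def by (subst sum_ennreal [symmetric]) (auto simp: sum_distrib_right simp del: sum_ennreal)
    qed
    also have "\<dots> = Np p f"
      unfolding Npf by (intro nn_integral_sum) measurable
    also have "\<dots> \<le> ennreal C * Np p (funop a b g f)" by (rule lower[OF fLp])
    also have "\<dots> \<le> ennreal C * (ennreal (2 powr p) *
      ((\<integral>\<^sup>+ s. ennreal (norm (z (Suc N) s) powr p * w (Suc N) s) * indicator J s \<partial>LR) +
       (\<integral>\<^sup>+ s. ennreal (norm (z 0 s) powr p) * indicator J s \<partial>LR)))"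
      by (intro mult_left_mono NpAf) simp
    also have "\<dots> = ennreal (C * 2 powr p) * (\<integral>\<^sup>+ s. (ennreal (norm (z (Suc N) s) powr p * w (Suc N) s) * indicator J s +
       ennreal (norm (z 0 s) powr p) * indicator J s) \<partial>LR)"
      using C by (subst nn_integral_add) (auto simp: ennreal_mult mult.assoc)
    also have "\<dots> = (\<integral>\<^sup>+ s. ennreal (C * 2 powr p) * (ennreal (norm (z (Suc N) s) powr p * w (Suc N) s) * indicator J s +
       ennreal (norm (z 0 s) powr p) * indicator J s) \<partial>LR)"
      by (intro nn_integral_cmult[symmetric]) measurable
    also have "\<dots> = (\<integral>\<^sup>+ s. ennreal (E s) * indicator J s \<partial>LR)"
    proof (rule nn_integral_cong)
      fix s assume "s \<in> space LR"
      then have "0 \<le> norm (z (Suc N) s) powr p * w (Suc N) s" using w_pos[of s "Suc N"] by simp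
      then show "ennreal (C * 2 powr p) * (ennreal (norm (z (Suc N) s) powr p * w (Suc N) s) * indicator J s +
       ennreal (norm (z 0 s) powr p) * indicator J s) = ennreal (E s) * indicator J s"
        unfolding E_def using C by (auto simp: indicator_def ennreal_mult ennreal_plus[symmetric] simp del: ennreal_plus)
    qed
    finally show "(\<integral>\<^sup>+ s. ennreal (L s) * indicator {t..t + d} s \<partial>LR) \<le> (\<integral>\<^sup>+ s. ennreal (E s) * indicator {t..t + d} s \<partial>LR)"
      unfolding J_def .
  qed
  have norm_prod: "norm (\<Prod>i\<in>I. f i) powr p = (\<Prod>i\<in>I. norm (f i) powr p)" for f :: "nat \<Rightarrow> complex" and I
    unfolding prod_norm [symmetric] by (rule prod_powr_distrib)
  have W: "0 < w (Suc N) t" by (rule w_pos[OF t])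
  \<comment> \<open>Taking out the full Jacobian \<open>w (Suc N) t\<close> leaves the derivatives
    at the iterates from \<open>k + 1\<close> to \<open>N\<close> in the denominator, one for each
    factor of \<open>b\<close>.\<close>
  have Lt: "L t = (\<Sum>k\<le>N. (\<Prod>i<k. norm (a ((g ^^ Suc i) t)) powr p) *
            (\<Prod>i\<in>{k<..N}. norm (b ((g ^^ i) t)) powr p / g' ((g ^^ i) t))) * w (Suc N) t"
    unfolding L_def sum_distrib_right
  proof (intro sum.cong refl)
    fix k assume "k \<in> {..N}"
    then have k: "w (Suc N) t = w (Suc k) t * (\<Prod>i\<in>{k<..N}. g' ((g ^^ i) t))" by (intro w_split) simp
    have "(\<Prod>i\<in>{k<..N}. g' ((g ^^ i) t)) \<noteq> 0"
      using W unfolding k by (metis less_irrefl mult_zero_right)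
    then show "norm (x k t) powr p * w (Suc k) t = (\<Prod>i<k. norm (a ((g ^^ Suc i) t)) powr p) *
            (\<Prod>i\<in>{k<..N}. norm (b ((g ^^ i) t)) powr p / g' ((g ^^ i) t)) * w (Suc N) t"
      unfolding k x_def norm_mult powr_mult norm_prod prod_dividef by (simp del: prod_zero_iff funpow.simps)
  qed
  have Et: "E t = ((C * 2 powr p) * ((\<Prod>i<Suc N. norm (a ((g ^^ Suc i) t)) powr p) +
            (\<Prod>i<Suc N. norm (b ((g ^^ i) t)) powr p / g' ((g ^^ i) t)))) * w (Suc N) t"
  proof -
    have "norm (z (Suc N) t) powr p = (\<Prod>i<Suc N. norm (a ((g ^^ Suc i) t)) powr p)"
      unfolding z_def norm_mult norm_prod powr_mult by simp
    moreover have "norm (z 0 t) powr p = (\<Prod>i<Suc N. norm (b ((g ^^ i) t)) powr p / g' ((g ^^ i) t)) * w (Suc N) t"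
      using W unfolding z_def norm_mult norm_prod powr_mult prod_dividef w_def[symmetric]
      by (simp add: atLeast0AtMost lessThan_Suc_atMost del: prod.lessThan_Suc)
    ultimately show ?thesis unfolding E_def by (simp add: algebra_simps del: funpow.simps prod.lessThan_Suc)
  qed
  show ?thesis using \<open>L t \<le> E t\<close> W unfolding Lt Et by simp
qed


text \<open>The dual argument. The right-hand side \<open>u\<close> is the indicator of the l-th
  image of a short interval. Along an orbit starting in that interval, the equation becomes a
  two-term recursion with a single source at index \<open>l\<close>. Summed with the multipliers
  \<open>e j\<close> it telescopes, expressing \<open>e l\<close> through the values of the solution
  at the two ends of the segment; the norm bound on the solution limits these.\<close>

lemma orbit_inequality_onto:
  fixes a b :: "real \<Rightarrow> complex"
  assumes p: "0 < p" and cont: "continuous_on Rplus a" "continuous_on Rplus b" and C: "0 \<le> C"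
    and onto: "\<And>u. u \<in> Lp p \<Longrightarrow>
      \<exists>f\<in>Lp p. (AE r in LR. funop a b g f r = u r) \<and> Np p f \<le> ennreal C * Np p u"
    and t: "0 < t" and l: "l \<le> N"
  shows "(\<Prod>i<l. norm (b ((g ^^ i) t)) powr p / g' ((g ^^ i) t)) * (\<Prod>i\<in>{l<..N}. norm (a ((g ^^ i) t)) powr p)
    \<le> (C * 2 powr p) * ((\<Prod>i<Suc N. norm (b ((g ^^ i) t)) powr p / g' ((g ^^ i) t)) +
            (\<Prod>i<Suc N. norm (a ((g ^^ i) t)) powr p))"
proof -
  define e where "e j s = (\<Prod>i<j. b ((g ^^ i) s)) * (\<Prod>i\<in>{j<..N}. a ((g ^^ i) s))" for j s
  define E where "E j s = (\<Prod>i<j. b ((g ^^ i) s)) * (\<Prod>i\<in>{j..N}. a ((g ^^ i) s))" for j s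
  have ae: "e j s * a ((g ^^ j) s) = E j s" if "j \<le> N" for j s
  proof -
    have "{j..N} = insert j {j<..N}" using that by auto
    then show ?thesis unfolding e_def E_def by (simp add: mult_ac)
  qed
  have be: "e j s * b ((g ^^ j) s) = E (Suc j) s" for j s
    unfolding e_def E_def by (simp add: mult_ac atLeastSucAtMost_greaterThanAtMost)
  have econt: "continuous_on Rplus (e j)" and Econt: "continuous_on Rplus (E j)" for j
    unfolding e_def E_def
    by (intro continuous_on_mult continuous_on_prod continuous_on_comp_g_iter cont)+
  have powr_cont: "continuous_on Rplus (\<lambda>s. norm (f s) powr p)" if "continuous_on Rplus f" for f :: "real \<Rightarrow> complex"
    using that p by (intro continuous_on_powr' continuous_on_norm continuous_on_const) auto
  note [measurable] = measurable_h_iter measurable_g_iter measurable_w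
    continuous_measurable_LR[OF econt] continuous_measurable_LR[OF Econt]
  define G0 where "G0 s = norm (E 0 s) powr p" for s
  define G1 where "G1 s = norm (E (Suc N) s) powr p / w (Suc N) s" for s
  have wnz: "w k s \<noteq> 0" if "0 < s" for k s using w_pos[OF that, of k] by simp
  have Gcont: "continuous_on Rplus G0" "continuous_on Rplus G1"
    unfolding G0_def G1_def
    by (intro continuous_on_divide powr_cont Econt continuous_on_w; use wnz in force)+
  obtain d0 where d0: "0 < d0" "wandering {t..t + d0}"
    using wandering_interval[OF t] by blast
  \<comment> \<open>Near \<open>t\<close> the end weights \<open>G0\<close> and \<open>G1\<close>
    stay below the constants \<open>k0\<close> and \<open>k1\<close>, which can be taken out of the
    integrals. In the end both are lowered to the values at \<open>t\<close> by an epsilon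
    argument.\<close>
  have main: "norm (e l t) powr p \<le> (2 powr p * (k0 + k1) * C) * w l t" if k: "G0 t < k0" "G1 t < k1" for k0 k1
  proof -
    have k_nonneg: "0 \<le> k0" "0 \<le> k1"
    proof -
      have "0 \<le> G0 t" "0 \<le> G1 t" using w_pos[OF t, of "Suc N"] by (auto simp: G0_def G1_def)
      then show "0 \<le> k0" "0 \<le> k1" using k by linarith+
    qed
    have "isCont G0 t" "isCont G1 t"
      using Gcont t by (auto simp: continuous_on_eq_continuous_at)
    then have "eventually (\<lambda>s. G0 s < k0 \<and> G1 s < k1) (nhds t)"
      using k unfolding isCont_def tendsto_at_iff_tendsto_nhds
      by (intro eventually_conj order_tendstoD(2)[of G0 "G0 t"] order_tendstoD(2)[of G1 "G1 t"]) auto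
    then obtain \<delta> where \<delta>: "0 < \<delta>" "\<And>s. dist s t < \<delta> \<Longrightarrow> G0 s < k0 \<and> G1 s < k1"
      by (auto simp: eventually_nhds_metric)
    have d1: "0 < min d0 (\<delta> / 2)" using d0 \<delta> by simp
    show ?thesis
    proof (rule le_if_local_averages_le[OF t _ _ _ d1])
      show "continuous_on Rplus (\<lambda>s. norm (e l s) powr p)" by (rule powr_cont[OF econt])
      show "continuous_on Rplus (\<lambda>s. 2 powr p * (k0 + k1) * C * w l s)"
        by (intro continuous_on_mult continuous_on_const continuous_on_w)
      show "0 \<le> 2 powr p * (k0 + k1) * C * w l t"
        using k_nonneg C w_pos[OF t, of l] by simp
      fix d :: real assume d: "0 < d" "d \<le> min d0 (\<delta> / 2)"
      define J where "J = {t..t + d}"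
      have wJ: "wandering J" using d d0(2) by (auto simp: J_def intro: wandering_subset)
      have Jset [measurable]: "J \<in> sets LR" unfolding J_def using t by (rule Icc_in_sets_LR)
      have Jpos: "0 < s" if "s \<in> J" for s using that t by (auto simp: J_def)
      have JG: "G0 s < k0" "G1 s < k1" if "s \<in> J" for s
        using \<delta>(2)[of s] that d by (auto simp: J_def dist_real_def)
      define u :: "real \<Rightarrow> complex" where "u r = indicator J ((h ^^ l) r)" for r
      have um: "u \<in> borel_measurable LR"
        unfolding u_def by (rule measurable_compose[OF measurable_h_iter]) measurable
      have Npu: "Np p u = (\<integral>\<^sup>+ s. ennreal (w l s) * indicator J s \<partial>LR)"
        unfolding u_def by (subst Np_push_forward) (auto simp: indicator_def intro!: nn_integral_cong)
      have "Np p u < \<infinity>"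
        unfolding Npu J_def using t d by (intro nn_integral_Icc_finite continuous_on_w) auto
      then have "u \<in> Lp p" using um by (simp add: Lp_iff)
      then obtain f where f: "f \<in> Lp p" "AE r in LR. funop a b g f r = u r" "Np p f \<le> ennreal C * Np p u"
        using onto by blast
      have fm [measurable]: "f \<in> borel_measurable LR" using f(1) by (simp add: Lp_iff)
      have "AE s in LR. \<forall>j. funop a b g f ((g ^^ j) s) = u ((g ^^ j) s)"
        using AE_g_iter[OF f(2)] by (simp add: AE_all_countable)
      then have AE_le: "AE s in LR. ennreal (norm (e l s) powr p) * indicator J s \<le>
          ennreal (2 powr p) * (ennreal k0 * ennreal (norm (f s) powr p) +
            ennreal k1 * (ennreal (norm (f ((g ^^ Suc N) s)) powr p) * ennreal (w (Suc N) s)))"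
      proof (eventually_elim)
        case (elim s)
        show ?case
        proof (cases "s \<in> J")
          case True
          note s = Jpos[OF True]
          define F where "F j = f ((g ^^ j) s)" for j
          have eqn: "a ((g ^^ j) s) * F j - b ((g ^^ j) s) * F (Suc j) = (if j = l then 1 else 0)" for j
          proof -
            have "(h ^^ j) ((g ^^ j) s) \<in> J" using True s by (simp add: h_iter_g_iter)
            \<comment> \<open>The images of \<open>J\<close> are disjoint, so the orbit of
              \<open>s\<close> meets the support of \<open>u\<close> exactly at time
              \<open>l\<close>.\<close>
            then have "(h ^^ l) ((g ^^ j) s) \<in> J \<longleftrightarrow> j = l"
              using wandering_unique[OF wJ g_iter_pos[OF s, of j], of j l] by blast
            then have "u ((g ^^ j) s) = (if j = l then 1 else 0)"
              by (simp add: u_def indicator_def)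
            then show ?thesis using elim[rule_format, of j] by (simp add: funop_def Wop_def F_def)
          qed
          \<comment> \<open>Here \<open>e j\<close> times the coefficient \<open>a\<close> is
            \<open>E j\<close>, and times \<open>b\<close> it is \<open>E (Suc j)\<close>; the
            recursion turns each difference into \<open>e j\<close> times its source.\<close>
          have "(\<Sum>j<Suc N. E j s * F j - E (Suc j) s * F (Suc j)) = (\<Sum>j<Suc N. if j = l then e l s else 0)"
          proof (intro sum.cong refl)
            fix j assume "j \<in> {..<Suc N}"
            then have "E j s * F j - E (Suc j) s * F (Suc j) = e j s * (a ((g ^^ j) s) * F j - b ((g ^^ j) s) * F (Suc j))"
              using ae[of j s] be[of j s] by (simp add: algebra_simps)
            then show "E j s * F j - E (Suc j) s * F (Suc j) = (if j = l then e l s else 0)"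
              unfolding eqn by simp
          qed
          also have "\<dots> = e l s" using l by (simp add: sum.delta del: sum.lessThan_Suc)
          finally have "e l s = E 0 s * F 0 + - (E (Suc N) s * F (Suc N))"
            using sum_lessThan_telescope'[of "\<lambda>j. E j s * F j" "Suc N"] by simp
          then have "norm (e l s) powr p \<le> 2 powr p * (norm (E 0 s * F 0) powr p + norm (- (E (Suc N) s * F (Suc N))) powr p)"
            using powr_norm_add_le[OF p] by metis
          also have "\<dots> = 2 powr p * (G0 s * norm (F 0) powr p + G1 s * (norm (F (Suc N)) powr p * w (Suc N) s))"
            using wnz[OF s, of "Suc N"] by (simp add: norm_mult powr_mult G0_def G1_def)
          also have "\<dots> \<le> 2 powr p * (k0 * norm (F 0) powr p + k1 * (norm (F (Suc N)) powr p * w (Suc N) s))"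
            using JG[OF True] w_pos[OF s, of "Suc N"] by (intro mult_left_mono add_mono mult_right_mono) auto
          finally have "ennreal (norm (e l s) powr p) \<le> ennreal (2 powr p * (k0 * norm (F 0) powr p + k1 * (norm (F (Suc N)) powr p * w (Suc N) s)))"
            by (rule ennreal_leI)
          also have "\<dots> = ennreal (2 powr p) * (ennreal k0 * ennreal (norm (f s) powr p) +
            ennreal k1 * (ennreal (norm (f ((g ^^ Suc N) s)) powr p) * ennreal (w (Suc N) s)))"
            using k_nonneg w_pos[OF s, of "Suc N"] by (simp add: F_def ennreal_mult)
          finally show ?thesis using True by simp
        qed simp
      qed
      have fgm [measurable]: "(\<lambda>s. f ((g ^^ Suc N) s)) \<in> borel_measurable LR"
        by (rule measurable_compose[OF measurable_g_iter fm])
      have "(\<integral>\<^sup>+ s. ennreal (norm (e l s) powr p) * indicator J s \<partial>LR) \<le>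
        (\<integral>\<^sup>+ s. ennreal (2 powr p) * (ennreal k0 * ennreal (norm (f s) powr p) +
            ennreal k1 * (ennreal (norm (f ((g ^^ Suc N) s)) powr p) * ennreal (w (Suc N) s))) \<partial>LR)"
        by (rule nn_integral_mono_AE[OF AE_le])
      also have "\<dots> = ennreal (2 powr p) * (ennreal k0 * (\<integral>\<^sup>+ s. ennreal (norm (f s) powr p) \<partial>LR) +
            ennreal k1 * (\<integral>\<^sup>+ s. ennreal (norm (f ((g ^^ Suc N) s)) powr p) * ennreal (w (Suc N) s) \<partial>LR))"
        by (simp add: nn_integral_cmult nn_integral_add del: funpow.simps)
      also have "(\<integral>\<^sup>+ s. ennreal (norm (f ((g ^^ Suc N) s)) powr p) * ennreal (w (Suc N) s) \<partial>LR) = Np p f"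
        unfolding Np_def by (rule nn_integral_change_iter[of "\<lambda>s. ennreal (norm (f s) powr p)"]) measurable
      also have "(\<integral>\<^sup>+ s. ennreal (norm (f s) powr p) \<partial>LR) = Np p f" by (simp add: Np_def)
      also have "ennreal (2 powr p) * (ennreal k0 * Np p f + ennreal k1 * Np p f) = ennreal (2 powr p * (k0 + k1)) * Np p f"
        using k_nonneg by (simp add: ennreal_mult distrib_right mult.assoc)
      also have "\<dots> \<le> ennreal (2 powr p * (k0 + k1)) * (ennreal C * Np p u)"
        by (intro mult_left_mono f(3)) simp
      also have "\<dots> = ennreal (2 powr p * (k0 + k1) * C) * (\<integral>\<^sup>+ s. ennreal (w l s) * indicator J s \<partial>LR)"
        unfolding Npu using k_nonneg C by (subst ennreal_mult) (auto simp: mult.assoc)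
      also have "\<dots> = (\<integral>\<^sup>+ s. ennreal (2 powr p * (k0 + k1) * C) * (ennreal (w l s) * indicator J s) \<partial>LR)"
        by (rule nn_integral_cmult[symmetric]) measurable
      also have "\<dots> = (\<integral>\<^sup>+ s. ennreal (2 powr p * (k0 + k1) * C * w l s) * indicator J s \<partial>LR)"
        using k_nonneg C by (intro nn_integral_cong) (simp add: ennreal_mult' mult.assoc)
      finally show "(\<integral>\<^sup>+ s. ennreal (norm (e l s) powr p) * indicator {t..t + d} s \<partial>LR)
          \<le> (\<integral>\<^sup>+ s. ennreal (2 powr p * (k0 + k1) * C * w l s) * indicator {t..t + d} s \<partial>LR)"
        unfolding J_def .
    qed
  qed
  have wl: "0 < w l t" by (rule w_pos[OF t])
  have "norm (e l t) powr p / w l t \<le> (C * 2 powr p) * (G1 t + G0 t)"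
  proof (rule field_le_epsilon)
    fix \<epsilon> :: real assume \<epsilon>: "0 < \<epsilon>"
    define D where "D = C * 2 powr p"
    have D: "0 \<le> D" using C by (simp add: D_def)
    define \<kappa> where "\<kappa> = \<epsilon> / (D + 1)"
    define \<eta> where "\<eta> = \<kappa> / 2"
    have \<eta>: "0 < \<eta>" using \<epsilon> D by (simp add: \<eta>_def \<kappa>_def)
    have "D * (2 * \<eta>) \<le> (D + 1) * (2 * \<eta>)" using \<eta> by (intro mult_right_mono) auto
    also have "2 * \<eta> = \<kappa>" by (simp add: \<eta>_def)
    also have "(D + 1) * \<kappa> = \<epsilon>" using D by (simp add: \<kappa>_def)
    finally have D\<eta>: "D * (2 * \<eta>) \<le> \<epsilon>" by (simp add: \<eta>_def)
    have "norm (e l t) powr p \<le> (2 powr p * ((G0 t + \<eta>) + (G1 t + \<eta>)) * C) * w l t"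
      using \<eta> by (intro main) auto
    then have "norm (e l t) powr p / w l t \<le> 2 powr p * ((G0 t + \<eta>) + (G1 t + \<eta>)) * C"
      using wl by (simp add: pos_divide_le_eq)
    also have "\<dots> = D * (G1 t + G0 t) + D * (2 * \<eta>)" by (simp add: D_def algebra_simps)
    finally show "norm (e l t) powr p / w l t \<le> (C * 2 powr p) * (G1 t + G0 t) + \<epsilon>"
      using D\<eta> unfolding D_def by linarith
  qed
  moreover
  have norm_prod: "norm (\<Prod>i\<in>I. f i) powr p = (\<Prod>i\<in>I. norm (f i) powr p)" for f :: "nat \<Rightarrow> complex" and I
    unfolding prod_norm [symmetric] by (rule prod_powr_distrib)
  have "norm (e l t) powr p / w l t = (\<Prod>i<l. norm (b ((g ^^ i) t)) powr p / g' ((g ^^ i) t)) * (\<Prod>i\<in>{l<..N}. norm (a ((g ^^ i) t)) powr p)"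
    unfolding e_def norm_mult powr_mult norm_prod prod_dividef w_def by simp
  moreover have "G0 t = (\<Prod>i<Suc N. norm (a ((g ^^ i) t)) powr p)"
    unfolding G0_def E_def norm_mult powr_mult norm_prod by (simp add: atLeast0AtMost lessThan_Suc_atMost del: prod.lessThan_Suc)
  moreover have "G1 t = (\<Prod>i<Suc N. norm (b ((g ^^ i) t)) powr p / g' ((g ^^ i) t))"
    unfolding G1_def E_def norm_mult powr_mult norm_prod prod_dividef w_def by simp
  ultimately show ?thesis by simp
qed

end

section \<open>Excluding mixed signs\<close>

lemma prod_ratio_tendsto_0:
  fixes x y :: "nat \<Rightarrow> real"
  assumes pos: "\<And>i. 0 < x i" and nonneg: "\<And>i. 0 \<le> y i" and q: "0 < q" "q < 1"
    and ev: "\<exists>k0. \<forall>k\<ge>k0. y k \<le> q * x k"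
  shows "(\<lambda>n. (\<Prod>i<n. y i) / (\<Prod>i<n. x i)) \<longlonglongrightarrow> 0"
proof -
  obtain k0 where k0: "\<And>k. k0 \<le> k \<Longrightarrow> y k \<le> q * x k" using ev by blast
  define r where "r i = y i / x i" for i
  have r0: "0 \<le> r i" for i using pos[of i] nonneg[of i] by (simp add: r_def)
  have rq: "r k \<le> q" if "k0 \<le> k" for k
    using k0[OF that] pos[of k] by (simp add: r_def divide_le_eq)
  have bound: "(\<Prod>i<n + k0. r i) \<le> (\<Prod>i<k0. r i) * q ^ n" for n
  proof (induction n)
    case (Suc n)
    have "(\<Prod>i<n + k0. r i) * r (n + k0) \<le> ((\<Prod>i<k0. r i) * q ^ n) * q"
      using Suc rq[of "n + k0"] r0 q by (intro mult_mono) (auto intro!: prod_nonneg mult_nonneg_nonneg)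
    then show ?case by (simp add: mult_ac)
  qed simp
  have "(\<lambda>n. (\<Prod>i<k0. r i) * q ^ n) \<longlonglongrightarrow> (\<Prod>i<k0. r i) * 0"
    using q by (intro tendsto_mult_left LIMSEQ_power_zero) auto
  then have "(\<lambda>n. \<Prod>i<n + k0. r i) \<longlonglongrightarrow> 0"
    by (intro tendsto_sandwich[of "\<lambda>_. 0" "\<lambda>n. \<Prod>i<n + k0. r i" sequentially])
      (use r0 bound in \<open>auto intro!: prod_nonneg always_eventually\<close>)
  then have "(\<lambda>n. \<Prod>i<n. r i) \<longlonglongrightarrow> 0" by (rule LIMSEQ_offset)
  then show ?thesis by (simp add: r_def prod_dividef)
qed

lemma prod_split_at:
  fixes F :: "nat \<Rightarrow> real"
  shows "(\<Prod>i<Suc (n + N). F i) = (\<Prod>i<n. F i) * F n * (\<Prod>j<N. F (n + Suc j))"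
    and "(\<Prod>i\<in>{n<..n + N}. F i) = (\<Prod>j<N. F (n + Suc j))"
proof -
  show "(\<Prod>i<Suc (n + N). F i) = (\<Prod>i<n. F i) * F n * (\<Prod>j<N. F (n + Suc j))"
    by (induction N) (simp_all add: mult_ac)
  show "(\<Prod>i\<in>{n<..n + N}. F i) = (\<Prod>j<N. F (n + Suc j))"
  proof (induction N)
    case (Suc N)
    have "{n<..n + Suc N} = insert (n + Suc N) {n<..n + N}" by auto
    then show ?case using Suc by (simp add: mult_ac)
  qed simp
qed

text \<open>Go to the last zero \<open>s\<close> of \<open>X\<close> on the orbit, which exists
  because \<open>X\<close> is eventually positive. There the first term on the right of
  \<open>ineq\<close> drops out, so products of \<open>X\<close> are bounded by a constant times
  products of \<open>Y\<close>, although the ratio of \<open>Y\<close> products to \<open>X\<close>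
  products tends to 0.\<close>

lemma positive_along_orbit:
  fixes \<phi> X Y :: "real \<Rightarrow> real"
  assumes pos: "\<And>t. 0 < t \<Longrightarrow> 0 < \<phi> t"
    and nonneg: "\<And>t. 0 < t \<Longrightarrow> 0 \<le> X t" "\<And>t. 0 < t \<Longrightarrow> 0 \<le> Y t" and q: "0 < q" "q < 1"
    and ineq: "\<And>t n. 0 < t \<Longrightarrow> (\<Prod>i<n. X ((\<phi> ^^ Suc i) t)) \<le>
        C * (X t * (\<Prod>i<n. X ((\<phi> ^^ Suc i) t)) + Y t * (\<Prod>i<n. Y ((\<phi> ^^ Suc i) t)))"
    and ev: "\<And>t. 0 < t \<Longrightarrow> \<exists>k0. \<forall>k\<ge>k0. 0 < X ((\<phi> ^^ k) t) \<and> Y ((\<phi> ^^ k) t) \<le> q * X ((\<phi> ^^ k) t)"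
    and t: "0 < t"
  shows "0 < X t"
proof (rule ccontr)
  assume "\<not> 0 < X t"
  then have X0: "X t = 0" using nonneg(1)[OF t] by simp
  have ipos: "0 < (\<phi> ^^ k) t" for k by (induction k) (auto intro: pos t)
  define Z where "Z = {k. X ((\<phi> ^^ k) t) = 0}"
  obtain k0 where k0: "\<And>k. k0 \<le> k \<Longrightarrow> 0 < X ((\<phi> ^^ k) t)" using ev[OF t] by blast
  have "Z \<subseteq> {..<k0}" using k0 by (force simp: Z_def not_less[symmetric])
  then have fin: "finite Z" by (rule finite_subset) simp
  have ne: "Z \<noteq> {}" using X0 by (auto simp: Z_def intro!: exI[of _ 0])
  define j where "j = Max Z"
  define s where "s = (\<phi> ^^ j) t"
  have s: "0 < s" unfolding s_def by (rule ipos)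
  have "j \<in> Z" unfolding j_def by (rule Max_in[OF fin ne])
  then have Xs: "X s = 0" by (simp add: s_def Z_def)
  have iter: "(\<phi> ^^ k) s = (\<phi> ^^ (k + j)) t" for k by (simp add: s_def funpow_add)
  have Xpos: "0 < X ((\<phi> ^^ Suc i) s)" for i
  proof -
    have "Suc i + j \<notin> Z" using Max_ge[OF fin, of "Suc i + j"] by (auto simp: j_def)
    then show ?thesis using nonneg(1)[OF ipos[of "Suc i + j"]] unfolding iter Z_def by simp
  qed
  have Ynn: "0 \<le> Y ((\<phi> ^^ Suc i) s)" for i unfolding iter by (rule nonneg(2)[OF ipos])
  obtain k1 where k1: "\<And>k. k1 \<le> k \<Longrightarrow> Y ((\<phi> ^^ k) s) \<le> q * X ((\<phi> ^^ k) s)" using ev[OF s] by blast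
  have "\<exists>k0. \<forall>k\<ge>k0. Y ((\<phi> ^^ Suc k) s) \<le> q * X ((\<phi> ^^ Suc k) s)"
    using k1 by (intro exI[of _ k1]) (simp del: funpow.simps)
  then have lim: "(\<lambda>n. (\<Prod>i<n. Y ((\<phi> ^^ Suc i) s)) / (\<Prod>i<n. X ((\<phi> ^^ Suc i) s))) \<longlonglongrightarrow> 0"
    by (rule prod_ratio_tendsto_0[OF Xpos Ynn q])
  have "1 \<le> C * Y s * ((\<Prod>i<n. Y ((\<phi> ^^ Suc i) s)) / (\<Prod>i<n. X ((\<phi> ^^ Suc i) s)))" for n
  proof -
    have "0 < (\<Prod>i<n. X ((\<phi> ^^ Suc i) s))" using Xpos by (intro prod_pos) blast
    then show ?thesis using ineq[OF s, of n] Xs by (simp add: field_simps del: funpow.simps)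
  qed
  then have "1 \<le> C * Y s * 0"
    by (intro LIMSEQ_le_const[OF tendsto_mult_left[OF lim]]) blast
  then show False by simp
qed

context Rplus_diffeo
begin

text \<open>Both consequences of invertibility take this form, with \<open>a\<close> and
  \<open>b\<close> in exchanged roles, so that one exclusion argument serves both. On the left the
  factor changes from \<open>X\<close> to \<open>Y\<close> at index \<open>l\<close>, which is
  itself omitted.\<close>

definition orbit_ineq :: "(real \<Rightarrow> real) \<Rightarrow> (real \<Rightarrow> real) \<Rightarrow> real \<Rightarrow> bool" where
  "orbit_ineq X Y C \<longleftrightarrow> (\<forall>t>0. \<forall>N. \<forall>l\<le>N.
     (\<Prod>i<l. X ((g ^^ i) t)) * (\<Prod>i\<in>{l<..N}. Y ((g ^^ i) t))
       \<le> C * ((\<Prod>i<Suc N. X ((g ^^ i) t)) + (\<Prod>i<Suc N. Y ((g ^^ i) t))))"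

text \<open>Starting the segment at \<open>(h ^^ n) t\<close> places the omitted index at
  \<open>t\<close>. What precedes it is a backward orbit of \<open>t\<close>, what follows a forward
  orbit, so the behaviour at the two ends can be used separately.\<close>

lemma orbit_ineq_centered:
  assumes ineq: "orbit_ineq X Y C" and t: "0 < t"
  shows "(\<Prod>i<n. X ((h ^^ Suc i) t)) * (\<Prod>i<N. Y ((g ^^ Suc i) t)) \<le>
    C * (X t * (\<Prod>i<n. X ((h ^^ Suc i) t)) * (\<Prod>i<N. X ((g ^^ Suc i) t)) +
         Y t * (\<Prod>i<n. Y ((h ^^ Suc i) t)) * (\<Prod>i<N. Y ((g ^^ Suc i) t)))"
proof -
  define s where "s = (h ^^ n) t"
  have s: "0 < s" unfolding s_def by (rule h_iter_pos[OF t])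
  have mid: "(g ^^ n) s = t" unfolding s_def by (rule g_iter_h_iter[OF t])
  have fwd: "(g ^^ (n + Suc j)) s = (g ^^ Suc j) t" for j
    using mid unfolding add.commute[of n] funpow_add by simp
  have bwd: "(\<Prod>i<n. Z ((g ^^ i) s)) = (\<Prod>i<n. Z ((h ^^ Suc i) t))" for Z :: "real \<Rightarrow> real"
  proof -
    have "(\<Prod>i<n. Z ((g ^^ i) s)) = (\<Prod>i<n. Z ((h ^^ Suc (n - Suc i)) t))"
    proof (intro prod.cong refl)
      fix i assume i: "i \<in> {..<n}"
      have "s = (h ^^ i) ((h ^^ (n - i)) t)"
        unfolding s_def using i by (metis comp_apply funpow_add le_add_diff_inverse lessThan_iff less_imp_le)
      then have "(g ^^ i) s = (h ^^ (n - i)) t" using g_iter_h_iter[OF h_iter_pos[OF t]] by simp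
      moreover have "Suc (n - Suc i) = n - i" using i by (simp add: Suc_diff_Suc)
      ultimately show "Z ((g ^^ i) s) = Z ((h ^^ Suc (n - Suc i)) t)" by simp
    qed
    also have "\<dots> = (\<Prod>i<n. Z ((h ^^ Suc i) t))"
      by (rule prod.nat_diff_reindex[of "\<lambda>i. Z ((h ^^ Suc i) t)"])
    finally show ?thesis .
  qed
  have "(\<Prod>i<n. X ((g ^^ i) s)) * (\<Prod>i\<in>{n<..n + N}. Y ((g ^^ i) s))
       \<le> C * ((\<Prod>i<Suc (n + N). X ((g ^^ i) s)) + (\<Prod>i<Suc (n + N). Y ((g ^^ i) s)))"
    using ineq s unfolding orbit_ineq_def by (metis le_add1)
  then show ?thesis
    unfolding prod_split_at bwd fwd mid by (simp add: mult_ac del: funpow.simps)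
qed

context
  fixes X Y :: "real \<Rightarrow> real" and C q :: real
  assumes ineq: "orbit_ineq X Y C"
    and nonneg: "\<And>t. 0 < t \<Longrightarrow> 0 \<le> X t" "\<And>t. 0 < t \<Longrightarrow> 0 \<le> Y t" and q: "0 < q" "q < 1"
begin

lemma X_positive:
  assumes "\<And>t. 0 < t \<Longrightarrow> \<exists>k0. \<forall>k\<ge>k0. 0 < X ((h ^^ k) t) \<and> Y ((h ^^ k) t) \<le> q * X ((h ^^ k) t)"
    and "0 < t"
  shows "0 < X t"
proof (rule positive_along_orbit[of h X Y q C, OF h_pos nonneg q _ assms])
  fix t :: real and n assume "0 < t"
  from orbit_ineq_centered[OF ineq this, of n 0]
  show "(\<Prod>i<n. X ((h ^^ Suc i) t)) \<le>
      C * (X t * (\<Prod>i<n. X ((h ^^ Suc i) t)) + Y t * (\<Prod>i<n. Y ((h ^^ Suc i) t)))"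
    by (simp del: funpow.simps)
qed

lemma Y_positive:
  assumes "\<And>t. 0 < t \<Longrightarrow> \<exists>k0. \<forall>k\<ge>k0. 0 < Y ((g ^^ k) t) \<and> X ((g ^^ k) t) \<le> q * Y ((g ^^ k) t)"
    and "0 < t"
  shows "0 < Y t"
proof (rule positive_along_orbit[of g Y X q C, OF g_pos nonneg(2,1) q _ assms])
  fix t :: real and n assume "0 < t"
  from orbit_ineq_centered[OF ineq this, of 0 n]
  show "(\<Prod>i<n. Y ((g ^^ Suc i) t)) \<le>
      C * (Y t * (\<Prod>i<n. Y ((g ^^ Suc i) t)) + X t * (\<Prod>i<n. X ((g ^^ Suc i) t)))"
    by (simp add: add.commute del: funpow.simps)
qed

text \<open>Under these assumptions the left side of the centred inequality is the product of the
  dominating factors on both sides. Dividing by it bounds 1 by terms that each contain a ratio of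
  dominated to dominating products, and both ratios tend to 0. The base point 1 is an arbitrary
  choice.\<close>

lemma not_mixed:
  assumes bwd: "\<And>t. 0 < t \<Longrightarrow> \<exists>k0. \<forall>k\<ge>k0. 0 < X ((h ^^ k) t) \<and> Y ((h ^^ k) t) \<le> q * X ((h ^^ k) t)"
    and fwd: "\<And>t. 0 < t \<Longrightarrow> \<exists>k0. \<forall>k\<ge>k0. 0 < Y ((g ^^ k) t) \<and> X ((g ^^ k) t) \<le> q * Y ((g ^^ k) t)"
  shows False
proof -
  \<comment> \<open>Domination is known only far out; the division needs positivity along the entire
    orbit.\<close>
  have Xp: "0 < X t" and Yp: "0 < Y t" if "0 < t" for t
    using X_positive[OF bwd that] Y_positive[OF fwd that] by blast+
  let ?A = "\<lambda>n. (\<Prod>i<n. X ((g ^^ Suc i) 1)) / (\<Prod>i<n. Y ((g ^^ Suc i) 1))"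
  let ?B = "\<lambda>n. (\<Prod>i<n. Y ((h ^^ Suc i) 1)) / (\<Prod>i<n. X ((h ^^ Suc i) 1))"
  have A: "?A \<longlonglongrightarrow> 0"
  proof (rule prod_ratio_tendsto_0[OF _ _ q])
    obtain k where "\<forall>j\<ge>k. X ((g ^^ j) 1) \<le> q * Y ((g ^^ j) 1)" using fwd[of 1] by auto
    then show "\<exists>k0. \<forall>k\<ge>k0. X ((g ^^ Suc k) 1) \<le> q * Y ((g ^^ Suc k) 1)"
      by (intro exI[of _ k]) (simp del: funpow.simps)
  qed (use Yp Xp g_iter_pos[of 1] in \<open>auto simp: less_imp_le simp del: funpow.simps\<close>)
  have B: "?B \<longlonglongrightarrow> 0"
  proof (rule prod_ratio_tendsto_0[OF _ _ q])
    obtain k where "\<forall>j\<ge>k. Y ((h ^^ j) 1) \<le> q * X ((h ^^ j) 1)" using bwd[of 1] by auto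
    then show "\<exists>k0. \<forall>k\<ge>k0. Y ((h ^^ Suc k) 1) \<le> q * X ((h ^^ Suc k) 1)"
      by (intro exI[of _ k]) (simp del: funpow.simps)
  qed (use Yp Xp h_iter_pos[of 1] in \<open>auto simp: less_imp_le simp del: funpow.simps\<close>)
  have "1 \<le> C * (X 1 * ?A n + Y 1 * ?B n)" for n
  proof -
    have pos: "0 < (\<Prod>i<n. Y ((g ^^ Suc i) 1))" "0 < (\<Prod>i<n. X ((h ^^ Suc i) 1))"
      using Xp Yp g_iter_pos[of 1] h_iter_pos[of 1] by (auto intro!: prod_pos simp del: funpow.simps)
    have scale: "u * v \<le> C * (x * u * w + y * z * v) \<Longrightarrow> 0 < u \<Longrightarrow> 0 < v \<Longrightarrow> 1 \<le> C * (x * (w / v) + y * (z / u))"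
      for u v w x y z :: real
      by (simp add: field_simps)
    show ?thesis
      by (rule scale[OF orbit_ineq_centered[OF ineq, of 1 n n] pos(2,1)]) simp
  qed
  moreover have "(\<lambda>n. C * (X 1 * ?A n + Y 1 * ?B n)) \<longlonglongrightarrow> C * (X 1 * 0 + Y 1 * 0)"
    by (intro tendsto_intros A B)
  ultimately have "1 \<le> C * (X 1 * 0 + Y 1 * 0)"
    by (intro LIMSEQ_le_const) auto
  then show False by simp
qed

end

end

section \<open>Slow oscillation\<close>

text \<open>A common description of 0 and infinity: a decreasing sequence of base sets allows the
  choice of sequences tending to the end, and their connectedness forces a continuous function
  bounded away from zero to keep one sign.\<close>

definition end_basis :: "real filter \<Rightarrow> (nat \<Rightarrow> real set) \<Rightarrow> bool" where
  "end_basis F S \<longleftrightarrow> (\<forall>P. eventually P F \<longleftrightarrow> (\<exists>n. \<forall>x\<in>S n. P x)) \<and> decseq S \<and>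
     (\<forall>n. S n \<subseteq> Rplus \<and> connected (S n))"

lemma end_basis_0: "end_basis (at_right 0) (\<lambda>n. {0<..<inverse (real (Suc n))})"
  unfolding end_basis_def
proof (intro conjI allI)
  fix P :: "real \<Rightarrow> bool"
  show "eventually P (at_right 0) \<longleftrightarrow> (\<exists>n. \<forall>x\<in>{0<..<inverse (real (Suc n))}. P x)"
  proof
    assume "eventually P (at_right 0)"
    then obtain b where b: "0 < b" "\<And>y. 0 < y \<Longrightarrow> y < b \<Longrightarrow> P y"
      by (auto simp: eventually_at_right_field)
    obtain n where "inverse (real (Suc n)) < b" using reals_Archimedean[OF b(1)] by blast
    then show "\<exists>n. \<forall>x\<in>{0<..<inverse (real (Suc n))}. P x"
      using b(2) by (intro exI[of _ n]) auto
  next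
    assume "\<exists>n. \<forall>x\<in>{0<..<inverse (real (Suc n))}. P x"
    then obtain n where "\<And>x. 0 < x \<Longrightarrow> x < inverse (real (Suc n)) \<Longrightarrow> P x"
      by (metis greaterThanLessThan_iff)
    then show "eventually P (at_right 0)"
      unfolding eventually_at_right_field by (intro exI[of _ "inverse (real (Suc n))"]) auto
  qed
  show "decseq (\<lambda>n. {0<..<inverse (real (Suc n))})"
  proof (rule decseq_SucI)
    fix n
    have "inverse (real (Suc (Suc n))) \<le> inverse (real (Suc n))" by (rule le_imp_inverse_le) auto
    then show "{0<..<inverse (real (Suc (Suc n)))} \<subseteq> {0<..<inverse (real (Suc n))}"
      by (intro subsetI) (metis greaterThanLessThan_iff less_le_trans)
  qed
qed auto

lemma end_basis_at_top: "end_basis at_top (\<lambda>n. {real n<..})"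
  unfolding end_basis_def
proof (intro conjI allI)
  fix P :: "real \<Rightarrow> bool"
  show "eventually P at_top \<longleftrightarrow> (\<exists>n. \<forall>x\<in>{real n<..}. P x)"
  proof
    assume "eventually P at_top"
    then obtain b where b: "\<And>y. b < y \<Longrightarrow> P y"
      by (auto simp: eventually_at_top_dense)
    obtain n where "b < real n" using reals_Archimedean2 by blast
    then show "\<exists>n. \<forall>x\<in>{real n<..}. P x"
      using b by (intro exI[of _ n]) auto
  qed (auto simp: eventually_at_top_dense)
  show "decseq (\<lambda>n. {real n<..})" by (intro decseq_SucI) auto
qed (auto simp: connected_Ioi)

lemma end_basis_sequence:
  fixes D :: "real \<Rightarrow> real"
  assumes F: "end_basis F S" and no: "\<And>c. 0 < c \<Longrightarrow> \<not> eventually (\<lambda>t. c \<le> \<bar>D t\<bar>) F"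
  obtains \<tau> where "filterlim \<tau> F sequentially" "(\<lambda>n. D (\<tau> n)) \<longlonglongrightarrow> 0" "\<And>n::nat. 0 < \<tau> n"
proof -
  have "\<exists>t\<in>S n. \<bar>D t\<bar> < inverse (real (Suc n))" for n
    using no[of "inverse (real (Suc n))"] F unfolding end_basis_def by (auto simp: not_le)
  then obtain \<tau> where \<tau>: "\<And>n. \<tau> n \<in> S n" "\<And>n. \<bar>D (\<tau> n)\<bar> < inverse (real (Suc n))"
    by metis
  have dec: "S k \<subseteq> S n" if "n \<le> k" for n k
    using F that unfolding end_basis_def decseq_def by blast
  have "filterlim \<tau> F sequentially"
    unfolding filterlim_iff
  proof (intro allI impI)
    fix P assume "eventually P F"
    then obtain n where "\<forall>x\<in>S n. P x" using F unfolding end_basis_def by blast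
    then show "eventually (\<lambda>k. P (\<tau> k)) sequentially"
      unfolding eventually_sequentially using dec \<tau>(1) by blast
  qed
  moreover have "(\<lambda>n. D (\<tau> n)) \<longlonglongrightarrow> 0"
    by (rule Lim_null_comparison[OF _ LIMSEQ_inverse_real_of_nat])
      (use \<tau>(2) in \<open>auto intro!: always_eventually less_imp_le\<close>)
  moreover have "0 < \<tau> n" for n using \<tau>(1)[of n] F unfolding end_basis_def by auto
  ultimately show ?thesis by (rule that)
qed

lemma end_basis_sign:
  fixes D :: "real \<Rightarrow> real"
  assumes F: "end_basis F S" and cont: "continuous_on Rplus D"
    and c: "0 < c" "eventually (\<lambda>t. c \<le> \<bar>D t\<bar>) F"
  shows "eventually (\<lambda>t. c \<le> D t) F \<or> eventually (\<lambda>t. D t \<le> - c) F"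
proof -
  obtain n where n: "\<forall>x\<in>S n. c \<le> \<bar>D x\<bar>" using F c(2) unfolding end_basis_def by blast
  have S: "S n \<subseteq> Rplus" "connected (S n)" using F unfolding end_basis_def by blast+
  have conn: "connected (D ` S n)"
    by (intro connected_continuous_image continuous_on_subset[OF cont] S)
  have "(\<forall>x\<in>S n. c \<le> D x) \<or> (\<forall>x\<in>S n. D x \<le> - c)"
  proof (rule ccontr)
    assume "\<not> ?thesis"
    then obtain x y where xy: "x \<in> S n" "y \<in> S n" "D x \<le> 0" "0 \<le> D y" using n c(1) by fastforce
    then have "0 \<in> D ` S n" using connectedD_interval[OF conn imageI[OF xy(1)] imageI[OF xy(2)]] by simp
    then obtain x where "x \<in> S n" "D x = 0" by force
    then show False using n c(1) by force
  qed
  moreover have ev: "eventually P F" if "\<forall>x\<in>S n. P x" for P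
    using F that unfolding end_basis_def by blast
  ultimately show ?thesis using ev[of "\<lambda>t. c \<le> D t"] ev[of "\<lambda>t. D t \<le> - c"] by blast
qed

text \<open>Boundedness of \<open>f\<close> makes the supremum in \<open>osc\<close> a genuine one;
  only then does it dominate the individual differences.\<close>

lemma norm_diff_le_osc:
  assumes "f \<in> Cb" "S \<subseteq> Rplus" "s \<in> S" "t \<in> S"
  shows "norm (f s - f t) \<le> osc f S"
proof -
  obtain B where B: "\<And>x. x \<in> Rplus \<Longrightarrow> norm (f x) \<le> B"
    using assms(1) unfolding Cb_def bounded_iff by auto
  have "bdd_above ((\<lambda>tt. norm (f (fst tt) - f (snd tt))) ` (S \<times> S))"
  proof (rule bdd_aboveI2)
    fix tt assume "tt \<in> S \<times> S"
    then have "norm (f (fst tt)) \<le> B" "norm (f (snd tt)) \<le> B" using assms(2) B by auto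
    then show "norm (f (fst tt) - f (snd tt)) \<le> B + B"
      using norm_triangle_ineq4[of "f (fst tt)" "f (snd tt)"] by linarith
  qed
  then show ?thesis
    unfolding osc_def using cSUP_upper[of "(s, t)" "S \<times> S" "\<lambda>tt. norm (f (fst tt) - f (snd tt))"] assms by simp
qed

context Rplus_diffeo
begin

text \<open>The mean value theorem on an interval from \<open>s\<close> to \<open>t\<close>, with
  \<open>s\<close> close to 0. For the lower bound \<open>g s\<close> is positive and
  \<open>m * s <= e\<close>; for the upper bound \<open>s <= h e\<close> ensures
  \<open>g s <= e\<close>.\<close>

lemma g_linear_bounds:
  assumes t: "0 < t"
  shows "m * t \<le> g t" "g t \<le> M * t"
proof -
  have mvt: "m * (t - s) \<le> g t - g s" "g t - g s \<le> M * (t - s)" if s: "0 < s" "s < t" for s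
  proof -
    obtain z where z: "s < z" "z < t" "g t - g s = (t - s) * g' z"
      using MVT2[OF s(2), of g g'] g_deriv s by force
    have "m \<le> g' z" "g' z \<le> M" using g'_ge[of z] g'_le[of z] z s by auto
    then show "m * (t - s) \<le> g t - g s" "g t - g s \<le> M * (t - s)"
      unfolding z(3) using s by (auto simp: mult.commute intro!: mult_left_mono)
  qed
  show "m * t \<le> g t"
  proof (rule field_le_epsilon)
    fix e :: real assume e: "0 < e"
    define s where "s = min (t / 2) (e / m)"
    have s: "0 < s" "s < t" "s \<le> e / m" using t e m_pos by (auto simp: s_def)
    have "m * s \<le> e" using s(3) m_pos by (simp add: field_simps)
    then show "m * t \<le> g t + e" using mvt(1)[OF s(1,2)] g_pos[OF s(1)] by (simp add: algebra_simps)
  qed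
  show "g t \<le> M * t"
  proof (rule field_le_epsilon)
    fix e :: real assume e: "0 < e"
    define s where "s = min (t / 2) (h e)"
    have s: "0 < s" "s < t" "s \<le> h e" using t e h_pos by (auto simp: s_def)
    have "g s \<le> e" using g_le[OF s(1,3)] gh[OF e] by simp
    moreover have "0 < M * s" using M_pos s by simp
    ultimately show "g t \<le> M * t + e" using mvt(2)[OF s(1,2)] by (simp add: algebra_simps)
  qed
qed

lemma filterlim_g_at_top: "filterlim g at_top at_top"
proof (rule filterlim_at_top_mono)
  show "filterlim (\<lambda>t. m * t) at_top at_top"
    by (rule filterlim_tendsto_pos_mult_at_top[OF tendsto_const m_pos filterlim_ident])
  show "eventually (\<lambda>t. m * t \<le> g t) at_top"
    using eventually_gt_at_top[of 0] by eventually_elim (rule g_linear_bounds)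
qed

lemma tendsto_mult_at_right_0: "((\<lambda>t. K * t) \<longlongrightarrow> 0) (at_right (0::real))" for K :: real
proof -
  have "((\<lambda>t. K * t) \<longlongrightarrow> K * 0) (at_right (0::real))" by (intro tendsto_intros)
  then show ?thesis by simp
qed

lemma filterlim_g_at_0: "filterlim g (at_right 0) (at_right 0)"
  unfolding filterlim_at
proof
  have "eventually (\<lambda>t. 0 < t) (at_right (0::real))" by (simp add: eventually_at_right_less)
  then show "eventually (\<lambda>t. g t \<in> {0<..} \<and> g t \<noteq> 0) (at_right 0)"
    by eventually_elim (use g_pos in force)
  show "(g \<longlongrightarrow> 0) (at_right 0)"
  proof (rule tendsto_sandwich[OF _ _ tendsto_const tendsto_mult_at_right_0[of M]])
    show "eventually (\<lambda>t. 0 \<le> g t) (at_right 0)"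
      using eventually_at_right_less[of 0] by eventually_elim (rule less_imp_le[OF g_pos])
    show "eventually (\<lambda>t. g t \<le> M * t) (at_right 0)"
      using eventually_at_right_less[of 0] by eventually_elim (rule g_linear_bounds(2))
  qed
qed

text \<open>The linear bounds on \<open>g\<close> put \<open>t\<close> and \<open>g t\<close> into
  one interval from \<open>l * r\<close> to \<open>r\<close>, where \<open>r\<close> is the larger
  of the two and \<open>l\<close> depends only on \<open>m\<close> and \<open>M\<close>. Since
  \<open>r\<close> tends to the same end as \<open>t\<close>, slow oscillation applies.\<close>

lemma SO_shift_tendsto_0:
  assumes f: "f \<in> SO" and F: "F = at_right 0 \<or> F = at_top"
  shows "((\<lambda>t. f (g t) - f t) \<longlongrightarrow> 0) F"
proof -
  define r where "r t = max t (g t)" for t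
  \<comment> \<open>The bound \<open>m\<close> covers \<open>g t < t\<close>, the bound
    \<open>1 / M\<close> covers \<open>g t > t\<close>, and \<open>1 / 2\<close> keeps
    \<open>l\<close> below 1.\<close>
  define l where "l = min (1 / 2) (min m (1 / M))"
  have l: "0 < l" "l < 1" "l \<le> m" "l \<le> 1 / M"
    using m_pos M_pos by (auto simp: l_def)
  have lM: "l * M \<le> 1" using l(4) M_pos by (simp add: field_simps)
  have osc: "((\<lambda>r. osc f {l * r..r}) \<longlongrightarrow> 0) F"
    using f F l unfolding SO_def by auto
  have ev: "eventually (\<lambda>t. 0 < t) F"
    using F by (auto simp: eventually_at_right_less eventually_gt_at_top)
  have "filterlim r F F"
    using F
  proof
    assume F: "F = at_top"
    show ?thesis unfolding F
      by (rule filterlim_at_top_mono[OF filterlim_ident]) (auto simp: r_def)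
  next
    assume F: "F = at_right 0"
    have "(r \<longlongrightarrow> max 0 0) (at_right 0)"
      unfolding r_def using filterlim_g_at_0 by (intro tendsto_intros) (simp add: filterlim_at)
    moreover have "eventually (\<lambda>t. r t \<in> {0<..} \<and> r t \<noteq> 0) (at_right 0)"
      using ev unfolding F by eventually_elim (auto simp: r_def)
    ultimately show ?thesis unfolding F filterlim_at by simp
  qed
  then have lim: "((\<lambda>t. osc f {l * r t..r t}) \<longlongrightarrow> 0) F"
    using filterlim_compose[OF osc] by blast
  show ?thesis
  proof (rule Lim_null_comparison[OF _ lim])
    show "eventually (\<lambda>t. norm (f (g t) - f t) \<le> osc f {l * r t..r t}) F"
      using ev
    proof eventually_elim
      case (elim t)
      have rp: "0 < r t" using elim by (simp add: r_def)
      have 1: "l * t \<le> g t"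
        using mult_right_mono[OF l(3), of t] g_linear_bounds(1)[OF elim] elim by linarith
      have "l * g t \<le> l * (M * t)" using g_linear_bounds(2)[OF elim] l by (intro mult_left_mono) auto
      also have "\<dots> = (l * M) * t" by simp
      also have "\<dots> \<le> 1 * t" using lM elim by (intro mult_right_mono) auto
      finally have 2: "l * g t \<le> t" by simp
      have 3: "l * x \<le> x" if "0 < x" for x using mult_right_mono[of l 1 x] l that by simp
      have "g t \<in> {l * r t..r t}" "t \<in> {l * r t..r t}"
        using 1 2 3[OF elim] 3[OF g_pos[OF elim]] by (auto simp: r_def max_def)
      moreover have "{l * r t..r t} \<subseteq> Rplus" using mult_pos_pos[OF l(1) rp] by auto
      ultimately show ?case using f by (intro norm_diff_le_osc) (auto simp: SO_def)
    qed
  qed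
qed

lemma filterlim_g_iter:
  assumes "F = at_right 0 \<or> F = at_top"
  shows "filterlim (g ^^ i) F F"
proof (induction i)
  case 0
  show ?case by (simp add: id_def filterlim_ident)
next
  case (Suc i)
  have "filterlim g F F" using assms filterlim_g_at_0 filterlim_g_at_top by blast
  from filterlim_compose[OF this Suc] show ?case by (simp add: comp_def)
qed

lemma SO_iter_tendsto_0:
  assumes f: "f \<in> SO" and F: "F = at_right 0 \<or> F = at_top"
  shows "((\<lambda>t. f ((g ^^ i) t) - f t) \<longlongrightarrow> 0) F"
proof (induction i)
  case (Suc i)
  have "((\<lambda>t. f (g ((g ^^ i) t)) - f ((g ^^ i) t)) \<longlongrightarrow> 0) F"
    by (rule filterlim_compose[OF SO_shift_tendsto_0[OF f F] filterlim_g_iter[OF F]])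
  from tendsto_add[OF this Suc] show ?case by simp
qed simp

end

section \<open>Signs at the two ends and necessity of the conditions\<close>

lemma positive_inf_Rplus:
  fixes f :: "real \<Rightarrow> real"
  assumes cont: "continuous_on Rplus f" and pos: "\<And>t. 0 < t \<Longrightarrow> 0 < f t" and k: "0 < k"
    and ev: "eventually (\<lambda>t. k \<le> f t) (at_right 0)" "eventually (\<lambda>t. k \<le> f t) at_top"
  obtains k' where "0 < k'" "\<And>t. 0 < t \<Longrightarrow> k' \<le> f t"
proof -
  obtain d where d: "0 < d" "\<And>t. 0 < t \<Longrightarrow> t < d \<Longrightarrow> k \<le> f t"
    using ev(1) by (auto simp: eventually_at_right_field)
  obtain e where e: "\<And>t. e < t \<Longrightarrow> k \<le> f t"
    using ev(2) by (auto simp: eventually_at_top_dense)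
  define e' where "e' = max d e"
  have ne: "{d..e'} \<noteq> {}" by (simp add: e'_def)
  have "continuous_on {d..e'} f" by (rule continuous_on_subset[OF cont]) (use d in auto)
  then obtain x where x: "x \<in> {d..e'}" "\<And>t. t \<in> {d..e'} \<Longrightarrow> f x \<le> f t"
    using continuous_attains_inf[of "{d..e'}" f] ne by auto
  show ?thesis
  proof (rule that[of "min k (f x)"])
    show "0 < min k (f x)" using k pos[of x] x(1) d by simp
    fix t :: real assume t: "0 < t"
    consider "t < d" | "e < t" | "t \<in> {d..e'}" unfolding e'_def atLeastAtMost_iff by linarith
    then show "min k (f x) \<le> f t"
    proof cases
      case 1
      then show ?thesis using d(2)[OF t] by simp
    next
      case 2
      then show ?thesis using e by (simp add: min.coboundedI1)
    next
      case 3
      then show ?thesis using x(2) by (simp add: min.coboundedI2)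
    qed
  qed
qed

context Rplus_diffeo
begin

text \<open>\<open>Fp\<close> is the attracting end and \<open>Fm\<close> the repelling one. Naming
  them this way frees later case distinctions from the direction in which \<open>g\<close> moves
  points.\<close>

lemma orbit_ends:
  obtains Fp Fm where "Fp = at_top \<and> Fm = at_right 0 \<or> Fp = at_right 0 \<and> Fm = at_top"
    and "\<And>t. 0 < t \<Longrightarrow> filterlim (\<lambda>k. (g ^^ k) t) Fp sequentially"
    and "\<And>t. 0 < t \<Longrightarrow> filterlim (\<lambda>k. (h ^^ k) t) Fm sequentially"
proof -
  interpret inv: Rplus_diffeo h g "\<lambda>t. inverse (g' (h t))" "inverse M" "inverse m"
    by (rule inverse_diffeo)
  show ?thesis using up_or_down
  proof
    assume up: "\<forall>t>0. t < g t"
    then have "\<forall>t>0. h t < t" using h_pos gh by metis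
    then show ?thesis using that[of at_top "at_right 0"] orbit_at_top[OF up] inv.orbit_at_0 by blast
  next
    assume down: "\<forall>t>0. g t < t"
    then have "\<forall>t>0. t < h t" using h_pos gh by metis
    then show ?thesis using that[of "at_right 0" at_top] orbit_at_0[OF down] inv.orbit_at_top by blast
  qed
qed

context
  fixes p :: real and a b :: "real \<Rightarrow> complex"
  assumes p: "0 < p" and a: "a \<in> SO" and b: "b \<in> SO" and g'_SO: "g' \<in> SO"
begin

definition weight_gap :: "real \<Rightarrow> real" where
  "weight_gap t = norm (a t) - norm (b t) * g' t powr (-1/p)"

lemma cont_ab: "continuous_on Rplus a" "continuous_on Rplus b"
  using a b by (auto simp: SO_def Cb_def)

lemma continuous_on_weight: "continuous_on Rplus (\<lambda>t. norm (b t) * g' t powr (-1/p))"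
  by (intro continuous_on_mult continuous_on_powr continuous_on_norm cont_ab g'_cont continuous_on_const)
    (use g'_pos in force)

lemma continuous_on_weight_gap: "continuous_on Rplus weight_gap"
  unfolding weight_gap_def by (intro continuous_on_diff continuous_on_norm cont_ab continuous_on_weight)

text \<open>Where \<open>weight_gap\<close> is small and the coefficients hardly vary along the orbit, the left side of the
  inequality has \<open>N + 1\<close> almost equal terms, which is too many for large \<open>N\<close>.\<close>

lemma weight_gap_bounded_away:
  assumes F: "F = at_right 0 \<or> F = at_top" and basis: "end_basis F S"
    and ineq: "\<And>t N. 0 < t \<Longrightarrow>
      (\<Sum>k\<le>N. (\<Prod>i<k. norm (a ((g ^^ Suc i) t)) powr p) *
            (\<Prod>i\<in>{k<..N}. norm (b ((g ^^ i) t)) powr p / g' ((g ^^ i) t)))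
    \<le> C * ((\<Prod>i<Suc N. norm (a ((g ^^ Suc i) t)) powr p) +
            (\<Prod>i<Suc N. norm (b ((g ^^ i) t)) powr p / g' ((g ^^ i) t)))"
  obtains c where "0 < c" "eventually (\<lambda>t. c \<le> weight_gap t) F \<or> eventually (\<lambda>t. weight_gap t \<le> - c) F"
proof (cases "\<exists>c>0. eventually (\<lambda>t. c \<le> \<bar>weight_gap t\<bar>) F")
  case True
  then show ?thesis using that end_basis_sign[OF basis continuous_on_weight_gap] by blast
next
  case False
  then obtain \<tau> where \<tau>: "filterlim \<tau> F sequentially" "(\<lambda>n. weight_gap (\<tau> n)) \<longlonglongrightarrow> 0" "\<And>n::nat. 0 < \<tau> n"
    using end_basis_sequence[OF basis, of weight_gap] by blast
  \<comment> \<open>Bundling the three coefficients gives one bounded sequence in a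
    finite-dimensional space, hence one subsequence along which all of them converge.\<close>
  define v where "v t = (a t, b t, g' t)" for t
  have "bounded (a ` Rplus)" "bounded (b ` Rplus)" "bounded (g' ` Rplus)"
    using a b g'_SO by (auto simp: SO_def Cb_def)
  then have "bounded (a ` Rplus \<times> b ` Rplus \<times> g' ` Rplus)" by (intro bounded_Times)
  then have "bounded (range (v \<circ> \<tau>))"
    by (rule bounded_subset) (use \<tau>(3) in \<open>auto simp: v_def\<close>)
  then obtain l r where lr: "strict_mono (r :: nat \<Rightarrow> nat)" "((v \<circ> \<tau>) \<circ> r) \<longlonglongrightarrow> l"
    using bounded_imp_convergent_subsequence by blast
  obtain A B E where l: "l = (A, B, E)" by (cases l) auto
  define \<sigma> where "\<sigma> = \<tau> \<circ> r"
  have \<sigma>: "filterlim \<sigma> F sequentially" "\<And>n. 0 < \<sigma> n"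
    unfolding \<sigma>_def using filterlim_compose[OF \<tau>(1) filterlim_subseq[OF lr(1)]] \<tau>(3) by (auto simp: comp_def)
  have lims: "(\<lambda>n. a (\<sigma> n)) \<longlonglongrightarrow> A" "(\<lambda>n. b (\<sigma> n)) \<longlonglongrightarrow> B" "(\<lambda>n. g' (\<sigma> n)) \<longlonglongrightarrow> E"
    using tendsto_fst[OF lr(2)] tendsto_fst[OF tendsto_snd[OF lr(2)]] tendsto_snd[OF tendsto_snd[OF lr(2)]]
    by (simp_all add: l v_def \<sigma>_def comp_def)
  have iter: "(\<lambda>n. f ((g ^^ i) (\<sigma> n))) \<longlonglongrightarrow> x" if "f \<in> SO" "(\<lambda>n. f (\<sigma> n)) \<longlonglongrightarrow> x"
    for f :: "real \<Rightarrow> 'z::real_normed_vector" and x i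
    using tendsto_add[OF filterlim_compose[OF SO_iter_tendsto_0[OF that(1) F, of i] \<sigma>(1)] that(2)] by simp
  have E: "m \<le> E"
    using lims(3) by (rule LIMSEQ_le_const) (use g'_ge[OF \<sigma>(2)] in blast)
  then have E0: "0 < E" using m_pos by simp
  \<comment> \<open>Since the gap tends to 0, this is the common limit of |a|^p and |b|^p / g' along
    the subsequence, and by slow oscillation also along each fixed iterate of it.\<close>
  define \<rho> where "\<rho> = norm A powr p"
  have "(\<lambda>n. weight_gap (\<sigma> n)) \<longlonglongrightarrow> norm A - norm B * E powr (-1/p)"
    unfolding weight_gap_def by (intro tendsto_intros lims) (use E0 in simp)
  moreover have "(\<lambda>n. weight_gap (\<sigma> n)) \<longlonglongrightarrow> 0"
    using LIMSEQ_subseq_LIMSEQ[OF \<tau>(2) lr(1)] by (simp add: \<sigma>_def comp_def)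
  ultimately have "norm A = norm B * E powr (-1/p)" using LIMSEQ_unique by fastforce
  then have "\<rho> = norm B powr p * (E powr (-1/p)) powr p" by (simp add: \<rho>_def powr_mult)
  also have "(E powr (-1/p)) powr p = E powr (-1)" using p by (simp only: powr_powr) simp
  finally have \<rho>B: "\<rho> = norm B powr p / E" using E0 by (simp add: powr_minus divide_inverse)
  have U: "(\<lambda>n. norm (a ((g ^^ i) (\<sigma> n))) powr p) \<longlonglongrightarrow> \<rho>" for i
    unfolding \<rho>_def by (intro tendsto_powr' tendsto_norm iter[OF a lims(1)] tendsto_const) (use p in auto)
  have V: "(\<lambda>n. norm (b ((g ^^ i) (\<sigma> n))) powr p / g' ((g ^^ i) (\<sigma> n))) \<longlonglongrightarrow> \<rho>" for i
    unfolding \<rho>B by (intro tendsto_divide tendsto_powr' tendsto_norm iter[OF b lims(2)] iter[OF g'_SO lims(3)] tendsto_const)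
      (use p E0 in auto)
  \<comment> \<open>The limit is taken with \<open>N\<close> fixed, so that only finitely many
    iterates are involved.\<close>
  have key: "(\<Sum>k\<le>N. (\<Prod>i<k. \<rho>) * (\<Prod>i\<in>{k<..N}. \<rho>)) \<le> C * ((\<Prod>i<Suc N. \<rho>) + (\<Prod>i<Suc N. \<rho>))" for N
  proof (rule tendsto_le[OF sequentially_bot])
    show "(\<lambda>n. \<Sum>k\<le>N. (\<Prod>i<k. norm (a ((g ^^ Suc i) (\<sigma> n))) powr p) *
            (\<Prod>i\<in>{k<..N}. norm (b ((g ^^ i) (\<sigma> n))) powr p / g' ((g ^^ i) (\<sigma> n))))
        \<longlonglongrightarrow> (\<Sum>k\<le>N. (\<Prod>i<k. \<rho>) * (\<Prod>i\<in>{k<..N}. \<rho>))"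
      by (intro tendsto_sum tendsto_mult tendsto_prod U V)
    show "(\<lambda>n. C * ((\<Prod>i<Suc N. norm (a ((g ^^ Suc i) (\<sigma> n))) powr p) +
            (\<Prod>i<Suc N. norm (b ((g ^^ i) (\<sigma> n))) powr p / g' ((g ^^ i) (\<sigma> n)))))
        \<longlonglongrightarrow> C * ((\<Prod>i<Suc N. \<rho>) + (\<Prod>i<Suc N. \<rho>))"
      by (intro tendsto_add tendsto_mult_left tendsto_prod U V)
    show "eventually (\<lambda>n. (\<Sum>k\<le>N. (\<Prod>i<k. norm (a ((g ^^ Suc i) (\<sigma> n))) powr p) *
            (\<Prod>i\<in>{k<..N}. norm (b ((g ^^ i) (\<sigma> n))) powr p / g' ((g ^^ i) (\<sigma> n))))
      \<le> C * ((\<Prod>i<Suc N. norm (a ((g ^^ Suc i) (\<sigma> n))) powr p) +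
            (\<Prod>i<Suc N. norm (b ((g ^^ i) (\<sigma> n))) powr p / g' ((g ^^ i) (\<sigma> n))))) sequentially"
      by (intro always_eventually allI ineq \<sigma>(2))
  qed
  have key': "real (Suc N) * \<rho> ^ N \<le> C * (2 * \<rho> ^ Suc N)" for N
  proof -
    have "(\<Sum>k\<le>N. (\<Prod>i<k. \<rho>) * (\<Prod>i\<in>{k<..N}. \<rho>)) = (\<Sum>k\<le>N. \<rho> ^ N)"
      by (intro sum.cong refl) (simp add: power_add[symmetric])
    then show ?thesis using key[of N] by simp
  qed
  have "0 \<le> \<rho>" by (simp add: \<rho>_def)
  \<comment> \<open>For \<open>N = 0\<close> the left side is the empty product 1, while the right
    side would be 0.\<close>
  moreover have "\<rho> \<noteq> 0" using key'[of 0] by auto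
  ultimately have \<rho>: "0 < \<rho>" by simp
  obtain N where N: "C * 2 * \<rho> < real N" using reals_Archimedean2 by blast
  have "real (Suc N) * \<rho> ^ N \<le> (C * 2 * \<rho>) * \<rho> ^ N" using key'[of N] by (simp add: mult_ac)
  then have "real (Suc N) \<le> C * 2 * \<rho>" using \<rho> by simp
  with N show ?thesis by simp
qed

lemma SO_norm_bound:
  assumes "f \<in> SO"
  obtains B where "\<And>t. 0 < t \<Longrightarrow> norm (f t) \<le> B"
  using assms unfolding SO_def Cb_def bounded_iff by auto

lemma coefficient_bounds_at_end:
  assumes "0 < c"
  shows "eventually (\<lambda>t. c \<le> weight_gap t) F \<Longrightarrow> eventually (\<lambda>t. 0 < t) F \<Longrightarrow> eventually (\<lambda>t. c \<le> norm (a t)) F"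
    and "eventually (\<lambda>t. weight_gap t \<le> - c) F \<Longrightarrow> eventually (\<lambda>t. 0 < t) F \<Longrightarrow> eventually (\<lambda>t. c * m powr (1/p) \<le> norm (b t)) F"
proof -
  assume "eventually (\<lambda>t. c \<le> weight_gap t) F" "eventually (\<lambda>t. 0 < t) F"
  then show "eventually (\<lambda>t. c \<le> norm (a t)) F"
  proof eventually_elim
    case (elim t)
    have "0 \<le> norm (b t) * g' t powr (-1/p)" by simp
    with elim show ?case unfolding weight_gap_def by linarith
  qed
next
  assume "eventually (\<lambda>t. weight_gap t \<le> - c) F" "eventually (\<lambda>t. 0 < t) F"
  then show "eventually (\<lambda>t. c * m powr (1/p) \<le> norm (b t)) F"
  proof eventually_elim
    case (elim t)
    have "c \<le> norm (b t) * g' t powr (-1/p)"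
      using elim(1) norm_ge_zero[of "a t"] unfolding weight_gap_def by linarith
    then have "c * g' t powr (1/p) \<le> (norm (b t) * g' t powr (-1/p)) * g' t powr (1/p)"
      by (intro mult_right_mono) auto
    also have "\<dots> = norm (b t)"
      using g'_pos[OF elim(2)] by (simp add: powr_minus field_simps)
    finally have "c * g' t powr (1/p) \<le> norm (b t)" .
    moreover have "c * m powr (1/p) \<le> c * g' t powr (1/p)"
      using assms g'_ge[OF elim(2)] m_pos p by (intro mult_left_mono powr_mono2) auto
    ultimately show ?case by linarith
  qed
qed

text \<open>\<open>VU\<close> stems from surjectivity, \<open>UV\<close> from boundedness below.
  With equal signs, \<open>VU\<close> gives positivity of the dominating coefficient on every orbit,
  and together with its bounds near both ends this yields a positive infimum by compactness. With
  opposite signs, \<open>VU\<close> excludes dominance of \<open>V\<close> backward and of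
  \<open>U\<close> forward, and \<open>UV\<close> excludes the reverse.\<close>

lemma necessity:
  assumes Q: "Lp_inverse p (funop a b g) Q"
  shows "(\<exists>k>0. \<forall>t>0. k \<le> norm (a t)) \<and> (\<exists>c>0. eventually (\<lambda>t. c \<le> weight_gap t) (at_right 0) \<and> eventually (\<lambda>t. c \<le> weight_gap t) at_top)
    \<or> (\<exists>k>0. \<forall>t>0. k \<le> norm (b t)) \<and> (\<exists>c>0. eventually (\<lambda>t. weight_gap t \<le> - c) (at_right 0) \<and> eventually (\<lambda>t. weight_gap t \<le> - c) at_top)"
proof -
  obtain A where A: "\<And>t. 0 < t \<Longrightarrow> norm (a t) \<le> A" using SO_norm_bound[OF a] by blast
  obtain B where B: "\<And>t. 0 < t \<Longrightarrow> norm (b t) \<le> B" using SO_norm_bound[OF b] by blast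
  note meas = continuous_measurable_LR[OF cont_ab(1)] continuous_measurable_LR[OF cont_ab(2)]
  have op: "Lp_op p (funop a b g)" by (rule Lp_op_funop[OF p meas A B])
  obtain C where C: "0 \<le> C" "\<And>f. f \<in> Lp p \<Longrightarrow> Np p (Q f) \<le> ennreal C * Np p f"
    using Lp_inverse_Np_bound[OF p Q] by blast
  have lower: "Np p f \<le> ennreal C * Np p (funop a b g f)" if "f \<in> Lp p" for f
  proof -
    have "funop a b g f \<in> Lp p" using op that unfolding Lp_op_def by blast
    from C(2)[OF this] show ?thesis using Np_cong_AE[OF Lp_inverseD(3)[OF Q that]] by simp
  qed
  have onto: "\<exists>f\<in>Lp p. (AE r in LR. funop a b g f r = u r) \<and> Np p f \<le> ennreal C * Np p u" if "u \<in> Lp p" for u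
    using Lp_inverseD(1,2)[OF Q that] C(2)[OF that] by blast
  define C' where "C' = C * 2 powr p"
  note ineq1 = orbit_inequality_lower[OF p cont_ab C(1) lower, folded C'_def]
  note ineq2 = orbit_inequality_onto[OF p cont_ab C(1) onto, folded C'_def]
  define U where "U t = norm (a t) powr p" for t
  define V where "V t = norm (b t) powr p / g' t" for t
  have Vp: "V t = (norm (b t) * g' t powr (-1/p)) powr p" if "0 < t" for t
    unfolding V_def by (rule weight_powr[OF p that, symmetric])
  have nonneg: "0 \<le> U t" "0 \<le> U (g t)" "0 \<le> V t" if "0 < t" for t
    using g'_pos[OF that] by (auto simp: U_def V_def)
  have VU: "orbit_ineq V U C'"
    unfolding orbit_ineq_def U_def V_def using ineq2 by blast
  \<comment> \<open>A single term of the sum suffices here, the other terms being nonnegative. In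
    this inequality \<open>a\<close> is evaluated one step ahead of \<open>b\<close>, which explains
    the composition with \<open>g\<close>.\<close>
  have UV: "orbit_ineq (\<lambda>t. U (g t)) V C'"
    unfolding orbit_ineq_def
  proof (intro allI impI)
    fix t :: real and N l :: nat assume t: "0 < t" and l: "l \<le> N"
    have eq: "U (g ((g ^^ i) t)) = norm (a ((g ^^ Suc i) t)) powr p" for i by (simp add: U_def)
    have "(\<Prod>i<l. norm (a ((g ^^ Suc i) t)) powr p) * (\<Prod>i\<in>{l<..N}. V ((g ^^ i) t))
        \<le> (\<Sum>k\<le>N. (\<Prod>i<k. norm (a ((g ^^ Suc i) t)) powr p) * (\<Prod>i\<in>{k<..N}. V ((g ^^ i) t)))"
      using l nonneg(3)[OF g_iter_pos[OF t]]
      by (intro member_le_sum[of l "{..N}" "\<lambda>k. (\<Prod>i<k. norm (a ((g ^^ Suc i) t)) powr p) * (\<Prod>i\<in>{k<..N}. V ((g ^^ i) t))"])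
        (auto intro!: mult_nonneg_nonneg prod_nonneg)
    also have "\<dots> \<le> C' * ((\<Prod>i<Suc N. norm (a ((g ^^ Suc i) t)) powr p) + (\<Prod>i<Suc N. V ((g ^^ i) t)))"
      using ineq1[OF _ t, of N] unfolding V_def .
    finally show "(\<Prod>i<l. U (g ((g ^^ i) t))) * (\<Prod>i\<in>{l<..N}. V ((g ^^ i) t))
       \<le> C' * ((\<Prod>i<Suc N. U (g ((g ^^ i) t))) + (\<Prod>i<Suc N. V ((g ^^ i) t)))"
      unfolding eq .
  qed
  obtain Fp Fm where ends: "Fp = at_top \<and> Fm = at_right 0 \<or> Fp = at_right 0 \<and> Fm = at_top"
    and fwd: "\<And>t. 0 < t \<Longrightarrow> filterlim (\<lambda>k. (g ^^ k) t) Fp sequentially"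
    and bwd: "\<And>t. 0 < t \<Longrightarrow> filterlim (\<lambda>k. (h ^^ k) t) Fm sequentially"
    using orbit_ends by blast
  have F: "Fp = at_right 0 \<or> Fp = at_top" "Fm = at_right 0 \<or> Fm = at_top" using ends by auto
  have evpos: "eventually (\<lambda>t. 0 < t) Fp" "eventually (\<lambda>t. 0 < t) Fm"
    using F by (auto simp: eventually_at_right_less eventually_gt_at_top)
  have gap: "\<exists>c>0. eventually (\<lambda>t. c \<le> weight_gap t) F \<or> eventually (\<lambda>t. weight_gap t \<le> - c) F"
    if F: "F = at_right 0 \<or> F = at_top" for F
  proof -
    obtain S where "end_basis F S" using F end_basis_0 end_basis_at_top by blast
    then show ?thesis using weight_gap_bounded_away[OF F _ ineq1] by blast
  qed
  obtain cp where cp: "0 < cp" "eventually (\<lambda>t. cp \<le> weight_gap t) Fp \<or> eventually (\<lambda>t. weight_gap t \<le> - cp) Fp"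
    using gap[OF F(1)] by blast
  obtain cm where cm: "0 < cm" "eventually (\<lambda>t. cm \<le> weight_gap t) Fm \<or> eventually (\<lambda>t. weight_gap t \<le> - cm) Fm"
    using gap[OF F(2)] by blast
  define c where "c = min cp cm"
  have c: "0 < c" using cp cm by (simp add: c_def)
  have signs: "eventually (\<lambda>t. c \<le> weight_gap t) Fp \<or> eventually (\<lambda>t. weight_gap t \<le> - c) Fp"
    "eventually (\<lambda>t. c \<le> weight_gap t) Fm \<or> eventually (\<lambda>t. weight_gap t \<le> - c) Fm"
  proof -
    have "eventually (\<lambda>t. c \<le> weight_gap t) F" if "eventually (\<lambda>t. x \<le> weight_gap t) F" "c \<le> x" for x F
      using that(1) by eventually_elim (use that(2) in linarith)
    moreover have "eventually (\<lambda>t. weight_gap t \<le> - c) F" if "eventually (\<lambda>t. weight_gap t \<le> - x) F" "c \<le> x" for x F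
      using that(1) by eventually_elim (use that(2) in linarith)
    moreover have "c \<le> cp" "c \<le> cm" by (auto simp: c_def)
    ultimately show "eventually (\<lambda>t. c \<le> weight_gap t) Fp \<or> eventually (\<lambda>t. weight_gap t \<le> - c) Fp"
      "eventually (\<lambda>t. c \<le> weight_gap t) Fm \<or> eventually (\<lambda>t. weight_gap t \<le> - c) Fm"
      using cp(2) cm(2) by blast+
  qed
  \<comment> \<open>Half of the gap is held in reserve: it absorbs the change of \<open>a\<close>
    between \<open>t\<close> and \<open>g t\<close> when \<open>U\<close> and \<open>V\<close> are
    compared at neighbouring orbit points.\<close>
  obtain q where q: "0 < q" "q < 1"
    and pg: "\<And>x y. 0 \<le> x \<Longrightarrow> x \<le> y - c / 2 \<Longrightarrow> y \<le> max A (B * m powr (-1/p)) \<Longrightarrow> x powr p \<le> q * y powr p"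
    using powr_gap[of "c / 2" p "max A (B * m powr (-1/p))"] c p by auto
  have wt_bound: "norm (b t) * g' t powr (-1/p) \<le> max A (B * m powr (-1/p))" if "0 < t" for t
  proof -
    have "norm (b t) * g' t powr (-1/p) \<le> B * m powr (-1/p)"
      using B[OF that] g'_ge[OF that] m_pos p norm_ge_zero[of "b t"]
      by (intro mult_mono powr_mono2') (auto simp del: norm_ge_zero)
    then show ?thesis by simp
  qed
  have dom_U: "0 < U s \<and> V t \<le> q * U s" if "0 < t" "0 < s" "norm (b t) * g' t powr (-1/p) \<le> norm (a s) - c / 2" for s t
  proof
    have "0 \<le> norm (b t) * g' t powr (-1/p)" by simp
    then have "0 < norm (a s)" using that(3) c by linarith
    then show "0 < U s" by (auto simp: U_def)
    show "V t \<le> q * U s"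
      unfolding Vp[OF that(1)] U_def using that A[OF that(2)] by (intro pg) auto
  qed
  have dom_V: "0 < V t \<and> U s \<le> q * V t" if "0 < t" "norm (a s) \<le> norm (b t) * g' t powr (-1/p) - c / 2" for s t
  proof
    have "0 < norm (b t) * g' t powr (-1/p)" using that(2) c norm_ge_zero[of "a s"] by linarith
    then show "0 < V t" unfolding Vp[OF that(1)] using g'_pos[OF that(1)] by auto
    show "U s \<le> q * V t"
      unfolding Vp[OF that(1)] U_def using that wt_bound[OF that(1)] by (intro pg) auto
  qed
  have slow: "eventually (\<lambda>t. norm (a (g t) - a t) < c / 2) F" if "F = at_right 0 \<or> F = at_top" for F
    using tendstoD[OF SO_shift_tendsto_0[OF a that], of "c / 2"] c by (simp add: dist_norm)
  have along_fwd: "\<exists>k0. \<forall>k\<ge>k0. P ((g ^^ k) t)" if "eventually P Fp" "0 < t" for P t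
    using filterlim_iff[THEN iffD1, OF fwd[OF that(2)]] that(1) by (auto simp: eventually_sequentially)
  have along_bwd: "\<exists>k0. \<forall>k\<ge>k0. P ((h ^^ k) t)" if "eventually P Fm" "0 < t" for P t
    using filterlim_iff[THEN iffD1, OF bwd[OF that(2)]] that(1) by (auto simp: eventually_sequentially)
  have U_fwd: "\<exists>k0. \<forall>k\<ge>k0. 0 < U ((g ^^ k) t) \<and> V ((g ^^ k) t) \<le> q * U ((g ^^ k) t)"
    if "eventually (\<lambda>t. c \<le> weight_gap t) Fp" "0 < t" for t
  proof (rule along_fwd[OF _ that(2)])
    show "eventually (\<lambda>t. 0 < U t \<and> V t \<le> q * U t) Fp"
      using that(1) evpos(1)
      by eventually_elim (rule dom_U, use c in \<open>auto simp: weight_gap_def\<close>)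
  qed
  have V_bwd: "\<exists>k0. \<forall>k\<ge>k0. 0 < V ((h ^^ k) t) \<and> U ((h ^^ k) t) \<le> q * V ((h ^^ k) t)"
    if "eventually (\<lambda>t. weight_gap t \<le> - c) Fm" "0 < t" for t
  proof (rule along_bwd[OF _ that(2)])
    show "eventually (\<lambda>t. 0 < V t \<and> U t \<le> q * V t) Fm"
      using that(1) evpos(2)
      by eventually_elim (rule dom_V, use c in \<open>auto simp: weight_gap_def\<close>)
  qed
  consider "eventually (\<lambda>t. c \<le> weight_gap t) Fp" "eventually (\<lambda>t. c \<le> weight_gap t) Fm"
    | "eventually (\<lambda>t. weight_gap t \<le> - c) Fp" "eventually (\<lambda>t. weight_gap t \<le> - c) Fm"
    | "eventually (\<lambda>t. c \<le> weight_gap t) Fp" "eventually (\<lambda>t. weight_gap t \<le> - c) Fm"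
    | "eventually (\<lambda>t. weight_gap t \<le> - c) Fp" "eventually (\<lambda>t. c \<le> weight_gap t) Fm"
    using signs by blast
  then show ?thesis
  proof cases
    case 1
    have "0 < norm (a t)" if "0 < t" for t
      using Y_positive[OF VU nonneg(3) nonneg(1) q U_fwd[OF 1(1)] that] by (simp add: U_def)
    moreover have ev: "eventually (\<lambda>t. c \<le> norm (a t)) Fp" "eventually (\<lambda>t. c \<le> norm (a t)) Fm"
      using coefficient_bounds_at_end(1)[OF c 1(1) evpos(1)] coefficient_bounds_at_end(1)[OF c 1(2) evpos(2)] .
    ultimately have "\<exists>k>0. \<forall>t>0. k \<le> norm (a t)"
      using positive_inf_Rplus[OF continuous_on_norm[OF cont_ab(1)] _ c] ends by metis
    then show ?thesis using 1 ends c by auto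
  next
    case 2
    have "0 < norm (b t)" if "0 < t" for t
      using X_positive[OF VU nonneg(3) nonneg(1) q V_bwd[OF 2(2)] that] by (auto simp: V_def)
    moreover have "eventually (\<lambda>t. c * m powr (1/p) \<le> norm (b t)) Fp" "eventually (\<lambda>t. c * m powr (1/p) \<le> norm (b t)) Fm"
      using coefficient_bounds_at_end(2)[OF c 2(1) evpos(1)] coefficient_bounds_at_end(2)[OF c 2(2) evpos(2)] .
    moreover have "0 < c * m powr (1/p)" using c m_pos by simp
    ultimately have "\<exists>k>0. \<forall>t>0. k \<le> norm (b t)"
      using positive_inf_Rplus[OF continuous_on_norm[OF cont_ab(2)]] ends by metis
    then show ?thesis using 2 ends c by auto
  next
    case 3
    have False
      by (rule not_mixed[OF VU nonneg(3) nonneg(1) q V_bwd[OF 3(2)] U_fwd[OF 3(1)]])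
    then show ?thesis ..
  next
    \<comment> \<open>Here \<open>V\<close> dominates forward and \<open>U\<close> backward.
      \<open>UV\<close> involves \<open>U (g t)\<close>, so the gap at \<open>t\<close> is first
      transferred through \<open>slow\<close>, at a cost below \<open>c / 2\<close>.\<close>
    case 4
    have "eventually (\<lambda>t. 0 < U (g t) \<and> V t \<le> q * U (g t)) Fm"
      using 4(2) evpos(2) slow[OF F(2)]
    proof eventually_elim
      case (elim t)
      have "norm (a t) - norm (a (g t)) \<le> norm (a (g t) - a t)"
        by (metis norm_minus_commute norm_triangle_ineq2)
      then show ?case using elim by (intro dom_U g_pos) (auto simp: weight_gap_def)
    qed
    note bw = along_bwd[OF this]
    have "eventually (\<lambda>t. 0 < V t \<and> U (g t) \<le> q * V t) Fp"
      using 4(1) evpos(1) slow[OF F(1)]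
    proof eventually_elim
      case (elim t)
      have "norm (a (g t)) - norm (a t) \<le> norm (a (g t) - a t)"
        by (rule norm_triangle_ineq2)
      then show ?case using elim by (intro dom_V) (auto simp: weight_gap_def)
    qed
    note fw = along_fwd[OF this]
    have False by (rule not_mixed[OF UV nonneg(2) nonneg(3) q bw fw])
    then show ?thesis ..
  qed
qed

end

end

section \<open>Translation of the hypotheses and conditions, and assembly of the equivalence\<close>

lemma SOS_diffeo:
  assumes "\<alpha> \<in> SOS"
  obtains m M where "Rplus_diffeo \<alpha> (inv_into Rplus \<alpha>) (deriv \<alpha>) m M"
proof -
  have bij: "bij_betw \<alpha> Rplus Rplus" and diff: "\<And>t. 0 < t \<Longrightarrow> \<alpha> differentiable (at t)"
    and cont: "continuous_on Rplus (deriv \<alpha>)" and ne: "\<And>t. 0 < t \<Longrightarrow> \<alpha> t \<noteq> t"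
    and pos: "\<And>t. 0 < t \<Longrightarrow> 0 < deriv \<alpha> t" and Cb: "(\<lambda>t. ln (deriv \<alpha> t)) \<in> Cb"
    using assms unfolding SOS_def by auto
  obtain L where L: "\<And>t. 0 < t \<Longrightarrow> \<bar>ln (deriv \<alpha> t)\<bar> \<le> L"
    using Cb unfolding Cb_def bounded_iff by auto
  have "Rplus_diffeo \<alpha> (inv_into Rplus \<alpha>) (deriv \<alpha>) (exp (- L)) (exp L)"
  proof
    fix t :: real assume t: "0 < t"
    show "0 < \<alpha> t" using bij_betw_apply[OF bij, of t] t by simp
    show "0 < inv_into Rplus \<alpha> t" using bij_betw_apply[OF bij_betw_inv_into[OF bij], of t] t by simp
    show "inv_into Rplus \<alpha> (\<alpha> t) = t" using bij_betw_inv_into_left[OF bij, of t] t by simp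
    show "\<alpha> (inv_into Rplus \<alpha> t) = t" using bij_betw_inv_into_right[OF bij, of t] t by simp
    show "(\<alpha> has_real_derivative deriv \<alpha> t) (at t)"
      using diff[OF t] by (simp add: DERIV_deriv_iff_real_differentiable)
    have "- L \<le> ln (deriv \<alpha> t)" "ln (deriv \<alpha> t) \<le> L" using L[OF t] by linarith+
    then have "exp (- L) \<le> exp (ln (deriv \<alpha> t))" "exp (ln (deriv \<alpha> t)) \<le> exp L" by simp_all
    then show "exp (- L) \<le> deriv \<alpha> t" "deriv \<alpha> t \<le> exp L" using pos[OF t] by simp_all
    show "\<alpha> t \<noteq> t" by (rule ne[OF t])
  qed (simp_all add: cont)
  then show ?thesis by (rule that)
qed

lemma INF_norm_pos_iff:
  fixes f :: "real \<Rightarrow> complex"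
  shows "(INF t\<in>Rplus. cmod (f t)) > 0 \<longleftrightarrow> (\<exists>k>0. \<forall>t>0. k \<le> cmod (f t))"
proof
  assume "(INF t\<in>Rplus. cmod (f t)) > 0"
  moreover have "(INF t\<in>Rplus. cmod (f t)) \<le> cmod (f t)" if "0 < t" for t
    by (rule cINF_lower) (use that in \<open>auto intro!: bdd_belowI2[of _ 0]\<close>)
  ultimately show "\<exists>k>0. \<forall>t>0. k \<le> cmod (f t)" by blast
next
  assume "\<exists>k>0. \<forall>t>0. k \<le> cmod (f t)"
  then obtain k where k: "0 < k" "\<And>t. 0 < t \<Longrightarrow> k \<le> cmod (f t)" by blast
  have "k \<le> (INF t\<in>Rplus. cmod (f t))"
    using k(2) by (intro cINF_greatest) auto
  then show "(INF t\<in>Rplus. cmod (f t)) > 0" using k(1) by linarith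
qed

lemma Liminf_ereal_pos_iff:
  fixes f :: "real \<Rightarrow> real"
  shows "Liminf F (\<lambda>t. ereal (f t)) > 0 \<longleftrightarrow> (\<exists>c>0. eventually (\<lambda>t. c \<le> f t) F)"
proof
  assume "Liminf F (\<lambda>t. ereal (f t)) > 0"
  then obtain c where c: "0 < ereal c" "ereal c < Liminf F (\<lambda>t. ereal (f t))"
    using ereal_dense2 by blast
  have "eventually (\<lambda>t. c \<le> f t) F"
    using less_LiminfD[OF c(2)] by eventually_elim simp
  with c(1) show "\<exists>c>0. eventually (\<lambda>t. c \<le> f t) F" by auto
next
  assume "\<exists>c>0. eventually (\<lambda>t. c \<le> f t) F"
  then obtain c where c: "0 < c" "eventually (\<lambda>t. c \<le> f t) F" by blast
  have "ereal c \<le> Liminf F (\<lambda>t. ereal (f t))"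
    by (rule Liminf_bounded) (use c(2) in simp)
  then show "Liminf F (\<lambda>t. ereal (f t)) > 0" using c(1) by (auto intro: less_le_trans[of _ "ereal c"])
qed

lemma Limsup_ereal_neg_iff:
  fixes f :: "real \<Rightarrow> real"
  shows "Limsup F (\<lambda>t. ereal (f t)) < 0 \<longleftrightarrow> (\<exists>c>0. eventually (\<lambda>t. f t \<le> - c) F)"
proof -
  have "Limsup F (\<lambda>t. ereal (f t)) < 0 \<longleftrightarrow> Liminf F (\<lambda>t. ereal (- f t)) > 0"
    using ereal_Liminf_uminus[of F "\<lambda>t. ereal (f t)"] by simp
  also have "\<dots> \<longleftrightarrow> (\<exists>c>0. eventually (\<lambda>t. f t \<le> - c) F)"
    unfolding Liminf_ereal_pos_iff by (simp add: le_minus_iff)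
  finally show ?thesis .
qed

lemma eventually_both_ends:
  assumes "eventually P (at_right 0)" "eventually P at_top"
  obtains d e :: real where "0 < d" "\<And>t. 0 < t \<Longrightarrow> t \<notin> {d..e} \<Longrightarrow> P t"
proof -
  obtain d where d: "0 < d" "\<And>t. 0 < t \<Longrightarrow> t < d \<Longrightarrow> P t"
    using assms(1) by (auto simp: eventually_at_right_field)
  obtain e where e: "\<And>t. e < t \<Longrightarrow> P t"
    using assms(2) by (auto simp: eventually_at_top_dense)
  show ?thesis by (rule that[of d e]) (use d e in \<open>auto simp: not_le\<close>)
qed

theorem theorem1p1:
  fixes p :: real and a b :: "real \<Rightarrow> complex" and \<alpha> :: "real \<Rightarrow> real"
  assumes "1 < p" and "a \<in> SO" and "b \<in> SO" and "\<alpha> \<in> SOS"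
  defines "D \<equiv> (\<lambda>t. ereal (cmod (a t) - cmod (b t) * (deriv \<alpha> t) powr (-1/p)))"
  defines "C1 \<equiv> (INF t\<in>Rplus. cmod (a t)) > 0
                  \<and> Liminf (at_right 0) D > 0 \<and> Liminf at_top D > 0"
  defines "C2 \<equiv> (INF t\<in>Rplus. cmod (b t)) > 0
                  \<and> Limsup (at_right 0) D < 0 \<and> Limsup at_top D < 0"
  shows "(Lp_invertible p (funop a b \<alpha>) \<longleftrightarrow> C1 \<or> C2)
     \<and> (C1 \<longrightarrow> (\<forall>B. Lp_inverse p (funop a b \<alpha>) B \<longrightarrow> Lp_opnorm_conv p (series1 a b \<alpha>) B))
     \<and> (C2 \<longrightarrow> (\<forall>B. Lp_inverse p (funop a b \<alpha>) B \<longrightarrow> Lp_opnorm_conv p (series2 a b \<alpha>) B))"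
proof -
  have p: "0 < p" using assms(1) by simp
  obtain m M where "Rplus_diffeo \<alpha> (inv_into Rplus \<alpha>) (deriv \<alpha>) m M"
    using SOS_diffeo[OF assms(4)] .
  then interpret Rplus_diffeo \<alpha> "inv_into Rplus \<alpha>" "deriv \<alpha>" m M .
  define \<delta> where "\<delta> t = cmod (a t) - cmod (b t) * (deriv \<alpha> t) powr (-1/p)" for t
  have SO': "deriv \<alpha> \<in> SO" using assms(4) by (simp add: SOS_def)
  have C1: "C1 \<longleftrightarrow> (\<exists>k>0. \<forall>t>0. k \<le> cmod (a t)) \<and> (\<exists>c>0. eventually (\<lambda>t. c \<le> \<delta> t) (at_right 0))
      \<and> (\<exists>c>0. eventually (\<lambda>t. c \<le> \<delta> t) at_top)"
    unfolding C1_def D_def INF_norm_pos_iff Liminf_ereal_pos_iff \<delta>_def ..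
  have C2: "C2 \<longleftrightarrow> (\<exists>k>0. \<forall>t>0. k \<le> cmod (b t)) \<and> (\<exists>c>0. eventually (\<lambda>t. \<delta> t \<le> - c) (at_right 0))
      \<and> (\<exists>c>0. eventually (\<lambda>t. \<delta> t \<le> - c) at_top)"
    unfolding C2_def D_def INF_norm_pos_iff Limsup_ereal_neg_iff \<delta>_def ..
  obtain A where A: "\<And>t. 0 < t \<Longrightarrow> cmod (a t) \<le> A" using SO_norm_bound[OF p assms(2,3) SO' assms(2)] by blast
  obtain B where B: "\<And>t. 0 < t \<Longrightarrow> cmod (b t) \<le> B" using SO_norm_bound[OF p assms(2,3) SO' assms(3)] by blast
  have meas: "a \<in> borel_measurable LR" "b \<in> borel_measurable LR"
    using assms(2,3) by (auto simp: SO_def Cb_def intro: continuous_measurable_LR)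
  have 1: "Lp_invertible p (funop a b \<alpha>) \<and> (\<forall>B. Lp_inverse p (funop a b \<alpha>) B \<longrightarrow> Lp_opnorm_conv p (series1 a b \<alpha>) B)"
    if cond: "C1"
  proof -
    obtain k c c' where k: "0 < k" "\<And>t. 0 < t \<Longrightarrow> k \<le> cmod (a t)"
      and c: "0 < c" "eventually (\<lambda>t. c \<le> \<delta> t) (at_right 0)" "0 < c'" "eventually (\<lambda>t. c' \<le> \<delta> t) at_top"
      using cond unfolding C1 by blast
    \<comment> \<open>One gap valid at both ends, so that a single constant works outside one
      compact interval.\<close>
    have "eventually (\<lambda>t. min c c' \<le> \<delta> t) (at_right 0)" "eventually (\<lambda>t. min c c' \<le> \<delta> t) at_top"
      using c(2,4) by (auto elim!: eventually_mono)
    then obtain d e where d: "0 < d" and out: "\<And>t. 0 < t \<Longrightarrow> t \<notin> {d..e} \<Longrightarrow> min c c' \<le> \<delta> t"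
      using eventually_both_ends[of "\<lambda>t. min c c' \<le> \<delta> t"] by blast
    have c0: "0 < min c c'" using c by simp
    obtain K q where "contractive_weighted_shift \<alpha> (inv_into Rplus \<alpha>) (deriv \<alpha>) m M p (\<lambda>t. b t / a t) K q"
      using contractive_if_a_dominates[OF p meas A B k c0 d out[unfolded \<delta>_def]] .
    from funop_invertible_series1[OF p meas A B k this] show ?thesis by blast
  qed
  have 2: "Lp_invertible p (funop a b \<alpha>) \<and> (\<forall>B. Lp_inverse p (funop a b \<alpha>) B \<longrightarrow> Lp_opnorm_conv p (series2 a b \<alpha>) B)"
    if cond: "C2"
  proof -
    obtain k c c' where k: "0 < k" "\<And>t. 0 < t \<Longrightarrow> k \<le> cmod (b t)"
      and c: "0 < c" "eventually (\<lambda>t. \<delta> t \<le> - c) (at_right 0)" "0 < c'" "eventually (\<lambda>t. \<delta> t \<le> - c') at_top"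
      using cond unfolding C2 by blast
    have "eventually (\<lambda>t. \<delta> t \<le> - min c c') (at_right 0)" "eventually (\<lambda>t. \<delta> t \<le> - min c c') at_top"
      using c(2,4) by (auto elim!: eventually_mono)
    then obtain d e where d: "0 < d" and out: "\<And>t. 0 < t \<Longrightarrow> t \<notin> {d..e} \<Longrightarrow> \<delta> t \<le> - min c c'"
      using eventually_both_ends[of "\<lambda>t. \<delta> t \<le> - min c c'"] by blast
    have c0: "0 < min c c'" using c by simp
    obtain K q where "contractive_weighted_shift (inv_into Rplus \<alpha>) \<alpha> (\<lambda>t. inverse (deriv \<alpha> (inv_into Rplus \<alpha> t)))
        (inverse M) (inverse m) p (\<lambda>t. a t / b t) K q"
      using contractive_if_b_dominates[OF p meas A B k c0 d out[unfolded \<delta>_def]] .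
    from funop_invertible_series2[OF p meas A B k this refl] show ?thesis by blast
  qed
  have 3: "C1 \<or> C2" if inv: "Lp_invertible p (funop a b \<alpha>)"
  proof -
    obtain Q where Q: "Lp_inverse p (funop a b \<alpha>) Q" using inv unfolding Lp_invertible_def by blast
    have "weight_gap p a b = \<delta>"
      by (rule ext) (simp add: weight_gap_def[OF p assms(2,3) SO'] \<delta>_def)
    with necessity[OF p assms(2,3) SO' Q] show ?thesis unfolding C1 C2 by auto
  qed
  show ?thesis using 1 2 3 by blast
qed

end
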